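(* Let $L_B$ be a self-adjoint operator on $H_B=L^2(B,d\mu_B)$ with $L_B\ge \ell_B\,\mathrm{Id}$ in the sense of quadratic forms for some constant $\ell_B>0$. For $s>3/2$, with normalization constant $\kappa_s$, let $$V_{B,s}:=\kappa_s\int_{\mathbb{R}^3}\frac{d^3q}{(2\pi)^3}\,(L_B+|q|^2)^{-s}$$ be the brane-restricted mediator (an operator-norm Bochner integral). Then $V_{B,s}$ is the spectral multiplier $$V_{B,s}=\kappa_s\,C_{3,s}\,L_B^{3/2-s},\qquad C_{3,s}:=\frac{1}{(4\pi)^{3/2}}\frac{\Gamma(s-3/2)}{\Gamma(s)}.$$ In particular, writing $\kappa:=\kappa_{5/2}$, $$V_{B,5/2}=\frac{\kappa}{6\pi^2}\,L_B^{-1}.$$ Thus, after setting $g:=\kappa/(6\pi^2)$, this brane restriction is exactly $V_B=V_{B,5/2}=g\,L_B^{-1}$.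
   Context: $B$ is a three-dimensional Riemannian manifold or a compactified three-dimensional region, with measure $\mu_B$. The ambient space is $M=B\times\mathbb{R}^3_\perp$, with Hilbert space $H_M=H_B\otimes L^2(\mathbb{R}^3_\perp)$ and ambient operator $L_M=L_B\otimes\mathrm{Id}+\mathrm{Id}\otimes(-\Delta_\perp)$, where $-\Delta_\perp$ is the non-negative Euclidean Laplacian on $\mathbb{R}^3_\perp$. The ambient mediator is $\kappa_s L_M^{-s}$, where $\kappa_s$ is an arbitrary constant; its "brane restriction" is by definition the operator $V_{B,s}$ displayed in the claim. Powers of $L_B$ and $L_B+|q|^2$ are defined by the spectral theorem. *)

theory Defs
  imports "HOL-Analysis.Analysis"
begin

text \<open>
  A type of class \<open>brane\<close> is the set of points of \<open>B\<close>, with its measure \<open>\<mu>\<^sub>B\<close>. The measure is a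
  class parameter so that \<open>L\<^sup>2(B, \<mu>\<^sub>B)\<close> is a type, as the library's normed space of bounded
  operators requires. No condition is imposed on the measure.
\<close>

class brane =
  fixes brane_measure :: "'a measure"

definition sq_integrable :: "('b::brane \<Rightarrow> complex) \<Rightarrow> bool" where
  "sq_integrable f \<longleftrightarrow>
     f \<in> borel_measurable brane_measure \<and> integrable brane_measure (\<lambda>x. (cmod (f x))\<^sup>2)"

definition L2_rel :: "('b::brane \<Rightarrow> complex) \<Rightarrow> ('b \<Rightarrow> complex) \<Rightarrow> bool" where
  "L2_rel f g \<longleftrightarrow> sq_integrable f \<and> sq_integrable g \<and> (AE x in brane_measure. f x = g x)"

lemma sq_integrable_zero: "sq_integrable (\<lambda>_. 0)"
  by (simp add: sq_integrable_def)

lemma sq_integrable_add: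
  assumes "sq_integrable f" "sq_integrable g"
  shows "sq_integrable (\<lambda>x. f x + g x)"
proof -
  have "integrable brane_measure (\<lambda>x. 2 * (cmod (f x))\<^sup>2 + 2 * (cmod (g x))\<^sup>2)"
    using assms by (auto simp: sq_integrable_def)
  moreover have "(\<lambda>x. (cmod (f x + g x))\<^sup>2) \<in> borel_measurable brane_measure"
    using assms by (auto simp: sq_integrable_def)
  moreover have "(cmod (a + b))\<^sup>2 \<le> 2 * (cmod a)\<^sup>2 + 2 * (cmod b)\<^sup>2" for a b :: complex
  proof -
    have "(cmod (a + b))\<^sup>2 \<le> (cmod a + cmod b)\<^sup>2"
      by (intro power_mono norm_triangle_ineq) auto
    also have "\<dots> \<le> 2 * (cmod a)\<^sup>2 + 2 * (cmod b)\<^sup>2"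
      using zero_le_power2[of "cmod a - cmod b"] by (simp add: power2_eq_square algebra_simps)
    finally show ?thesis .
  qed
  ultimately have "integrable brane_measure (\<lambda>x. (cmod (f x + g x))\<^sup>2)"
    by (auto intro: Bochner_Integration.integrable_bound)
  then show ?thesis
    using assms by (auto simp: sq_integrable_def)
qed

lemma sq_integrable_scale:
  assumes "sq_integrable f"
  shows "sq_integrable (\<lambda>x. c * f x)"
  using assms by (auto simp: sq_integrable_def norm_mult power_mult_distrib)

lemma sq_integrable_inner:
  assumes "sq_integrable f" "sq_integrable g"
  shows "integrable brane_measure (\<lambda>x. cnj (f x) * g x)"
proof -
  have "integrable brane_measure (\<lambda>x. (cmod (f x))\<^sup>2 + (cmod (g x))\<^sup>2)"
    using assms by (auto simp: sq_integrable_def)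
  moreover have "(\<lambda>x. cnj (f x) * g x) \<in> borel_measurable brane_measure"
  proof (rule borel_measurable_times)
    show "(\<lambda>x. cnj (f x)) \<in> borel_measurable brane_measure"
      using assms unfolding sq_integrable_def
      by (intro measurable_compose[of f _ borel cnj] borel_measurable_continuous_onI
          continuous_intros) auto
    show "g \<in> borel_measurable brane_measure"
      using assms by (simp add: sq_integrable_def)
  qed
  moreover have "cmod (cnj a * b) \<le> (cmod a)\<^sup>2 + (cmod b)\<^sup>2" for a b :: complex
  proof -
    have "2 * (cmod a * cmod b) \<le> (cmod a)\<^sup>2 + (cmod b)\<^sup>2"
      using sum_squares_bound[of "cmod a" "cmod b"] by simp
    moreover have "0 \<le> cmod a * cmod b" by simp
    ultimately show ?thesis unfolding norm_mult complex_mod_cnj by linarith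
  qed
  ultimately show ?thesis
    by (auto intro: Bochner_Integration.integrable_bound)
qed

lemma L2_rel_part_equivp: "part_equivp L2_rel"
proof (rule part_equivpI)
  show "\<exists>f. L2_rel f f"
    by (rule exI[of _ "\<lambda>_. 0"]) (simp add: L2_rel_def sq_integrable_zero)
  show "symp L2_rel"
    by (auto simp: symp_def L2_rel_def elim: AE_mp)
  show "transp L2_rel"
    unfolding transp_def L2_rel_def by (auto elim: AE_mp)
qed

quotient_type (overloaded) 'b L2 = "'b::brane \<Rightarrow> complex" / partial: L2_rel
  by (rule L2_rel_part_equivp)

text \<open>The complex inner product is conjugate-linear in its first argument.\<close>

lift_definition cinner :: "'b::brane L2 \<Rightarrow> 'b L2 \<Rightarrow> complex"
  is "\<lambda>f g. \<integral>x. cnj (f x) * g x \<partial>brane_measure"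
proof -
  fix f f' g g' :: "'b \<Rightarrow> complex"
  assume r: "L2_rel f f'" "L2_rel g g'"
  have "AE x in brane_measure. cnj (f x) * g x = cnj (f' x) * g' x"
    using r by (auto simp: L2_rel_def elim: AE_mp)
  moreover have "integrable brane_measure (\<lambda>x. cnj (f x) * g x)"
    "integrable brane_measure (\<lambda>x. cnj (f' x) * g' x)"
    using r by (auto simp: L2_rel_def intro: sq_integrable_inner)
  ultimately show "(\<integral>x. cnj (f x) * g x \<partial>brane_measure) = (\<integral>x. cnj (f' x) * g' x \<partial>brane_measure)"
    by (intro integral_cong_AE) auto
qed

lift_definition scaleC :: "complex \<Rightarrow> 'b::brane L2 \<Rightarrow> 'b L2"  (infixr \<open>*\<^sub>C\<close> 75)
  is "\<lambda>c f x. c * f x"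
  by (auto simp: L2_rel_def intro: sq_integrable_scale)

instantiation L2 :: (brane) real_inner
begin

lift_definition zero_L2 :: "'a L2" is "\<lambda>_. 0"
  by (simp add: L2_rel_def sq_integrable_zero)

lift_definition plus_L2 :: "'a L2 \<Rightarrow> 'a L2 \<Rightarrow> 'a L2" is "\<lambda>f g x. f x + g x"
  by (auto simp: L2_rel_def intro: sq_integrable_add elim: AE_mp)

definition uminus_L2 :: "'a L2 \<Rightarrow> 'a L2" where
  "- u = (-1) *\<^sub>C u"

definition minus_L2 :: "'a L2 \<Rightarrow> 'a L2 \<Rightarrow> 'a L2" where
  "u - v = u + - (v :: 'a L2)"

definition scaleR_L2 :: "real \<Rightarrow> 'a L2 \<Rightarrow> 'a L2" where
  "r *\<^sub>R u = complex_of_real r *\<^sub>C u"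

definition inner_L2 :: "'a L2 \<Rightarrow> 'a L2 \<Rightarrow> real" where
  "u \<bullet> v = Re (cinner u v)"

definition norm_L2 :: "'a L2 \<Rightarrow> real" where
  "norm (u :: 'a L2) = sqrt (u \<bullet> u)"

definition sgn_L2 :: "'a L2 \<Rightarrow> 'a L2" where
  "sgn (u :: 'a L2) = inverse (norm u) *\<^sub>R u"

definition dist_L2 :: "'a L2 \<Rightarrow> 'a L2 \<Rightarrow> real" where
  "dist (u :: 'a L2) v = norm (u - v)"

definition uniformity_L2 :: "('a L2 \<times> 'a L2) filter" where
  "uniformity_L2 = (INF e\<in>{0<..}. principal {(u, v). dist u v < e})"

definition open_L2 :: "'a L2 set \<Rightarrow> bool" where
  "open_L2 U \<longleftrightarrow> (\<forall>x\<in>U. \<forall>\<^sub>F (x', y) in uniformity. x' = x \<longrightarrow> y \<in> U)"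

instance
proof
  fix a b c :: "'a L2" and r t :: real
  have diff: "a - b = a + (-1) *\<^sub>C b" for a b :: "'a L2"
    by (simp add: minus_L2_def uminus_L2_def)
  show "a + b + c = a + (b + c)"
    by transfer (auto simp: L2_rel_def algebra_simps intro!: sq_integrable_add)
  show "a + b = b + a"
    by transfer (auto simp: L2_rel_def algebra_simps intro!: sq_integrable_add)
  show "0 + a = a"
    by transfer (auto simp: L2_rel_def)
  show "- a + a = 0"
    unfolding uminus_L2_def
    by transfer (auto simp: L2_rel_def sq_integrable_zero)
  show "a - b = a + - b"
    by (simp add: minus_L2_def)
  show "r *\<^sub>R (a + b) = r *\<^sub>R a + r *\<^sub>R b"
    unfolding scaleR_L2_def
    by transfer (auto simp: L2_rel_def ring_distribs intro!: sq_integrable_add sq_integrable_scale)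
  show "(r + t) *\<^sub>R a = r *\<^sub>R a + t *\<^sub>R a"
    unfolding scaleR_L2_def
    by transfer (auto simp: L2_rel_def ring_distribs intro!: sq_integrable_add sq_integrable_scale)
  show "r *\<^sub>R t *\<^sub>R a = (r * t) *\<^sub>R a"
    unfolding scaleR_L2_def
    by transfer (auto simp: L2_rel_def mult.assoc intro!: sq_integrable_scale)
  show "1 *\<^sub>R a = a"
    unfolding scaleR_L2_def
    by transfer (auto simp: L2_rel_def)
  show "dist a b = norm (a - b)"
    by (simp add: dist_L2_def)
  show "sgn a = inverse (norm a) *\<^sub>R a"
    by (simp add: sgn_L2_def)
  show "uniformity = (INF e\<in>{0<..}. principal {(x, y :: 'a L2). dist x y < e})"
    by (simp add: uniformity_L2_def)
  show "open U \<longleftrightarrow> (\<forall>x\<in>U. \<forall>\<^sub>F (x', y) in uniformity. x' = x \<longrightarrow> y \<in> U)" for U :: "'a L2 set"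
    by (simp add: open_L2_def)
  show "a \<bullet> b = b \<bullet> a"
  proof -
    have "cinner b a = cnj (cinner a b)"
    proof transfer
      fix f g :: "'a \<Rightarrow> complex"
      have "cnj (\<integral>x. cnj (f x) * g x \<partial>brane_measure) = (\<integral>x. cnj (cnj (f x) * g x) \<partial>brane_measure)"
        by (rule Bochner_Integration.integral_cnj[symmetric])
      then show "(\<integral>x. cnj (g x) * f x \<partial>brane_measure) = cnj (\<integral>x. cnj (f x) * g x \<partial>brane_measure)"
        by (simp add: mult.commute)
    qed
    then show ?thesis by (simp add: inner_L2_def)
  qed
  have add: "cinner (a + b) c = cinner a c + cinner b c"
    by transfer (auto simp: L2_rel_def ring_distribs sq_integrable_inner)
  show "(a + b) \<bullet> c = a \<bullet> c + b \<bullet> c"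
    by (simp add: inner_L2_def add)
  have "cinner (complex_of_real r *\<^sub>C a) b = complex_of_real r * cinner a b"
    by transfer (auto simp: L2_rel_def mult.assoc)
  then show "r *\<^sub>R a \<bullet> b = r * (a \<bullet> b)"
    by (simp add: inner_L2_def scaleR_L2_def)
  have sq: "cnj z * z = complex_of_real ((cmod z)\<^sup>2)" for z
    by (metis complex_norm_square mult.commute)
  have self: "a \<bullet> a \<ge> 0 \<and> (a \<bullet> a = 0 \<longrightarrow> a = 0)"
    unfolding inner_L2_def
  proof transfer
    fix f :: "'a \<Rightarrow> complex"
    assume "L2_rel f f"
    then have f: "sq_integrable f" by (simp add: L2_rel_def)
    have eq: "Re (\<integral>x. cnj (f x) * f x \<partial>brane_measure) = (\<integral>x. (cmod (f x))\<^sup>2 \<partial>brane_measure)"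
      unfolding sq by (simp only: integral_complex_of_real Re_complex_of_real)
    have "AE x in brane_measure. f x = 0" if "(\<integral>x. (cmod (f x))\<^sup>2 \<partial>brane_measure) = 0"
    proof -
      have "AE x in brane_measure. (cmod (f x))\<^sup>2 = 0"
        using f that by (subst integral_nonneg_eq_0_iff_AE[symmetric]) (auto simp: sq_integrable_def)
      then show ?thesis by simp
    qed
    then show "0 \<le> Re (\<integral>x. cnj (f x) * f x \<partial>brane_measure) \<and>
        (Re (\<integral>x. cnj (f x) * f x \<partial>brane_measure) = 0 \<longrightarrow> L2_rel f (\<lambda>_. 0))"
      unfolding eq using f by (auto simp: L2_rel_def sq_integrable_zero)
  qed
  show "a \<bullet> a \<ge> 0"
    using self by simp
  have "cinner (0 :: 'a L2) 0 = 0"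
    by transfer simp
  then show "a \<bullet> a = 0 \<longleftrightarrow> a = 0"
    using self by (auto simp: inner_L2_def)
  show "norm a = sqrt (a \<bullet> a)"
    by (simp add: norm_L2_def)
qed

end

text \<open>
  An operator in \<open>H\<^sub>B\<close> is the set of pairs \<open>(x, T x)\<close> with \<open>x\<close> in the domain of \<open>T\<close>; two operators
  are equal iff their domains and their values agree.
\<close>

definition linear_operator :: "'b::brane L2 rel \<Rightarrow> bool" where
  "linear_operator T \<longleftrightarrow> single_valued T \<and> (0, 0) \<in> T \<and>
     (\<forall>x y x' y'. (x, y) \<in> T \<longrightarrow> (x', y') \<in> T \<longrightarrow> (x + x', y + y') \<in> T) \<and>
     (\<forall>c x y. (x, y) \<in> T \<longrightarrow> (c *\<^sub>C x, c *\<^sub>C y) \<in> T)"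

definition op_adjoint :: "'b::brane L2 rel \<Rightarrow> 'b L2 rel" where
  "op_adjoint T = {(u, v). \<forall>(x, y) \<in> T. cinner u y = cinner v x}"

definition self_adjoint :: "'b::brane L2 rel \<Rightarrow> bool" where
  "self_adjoint T \<longleftrightarrow> linear_operator T \<and> closure (Domain T) = UNIV \<and> op_adjoint T = T"

definition form_ge :: "'b::brane L2 rel \<Rightarrow> real \<Rightarrow> bool" where
  "form_ge T l \<longleftrightarrow> (\<forall>(x, y) \<in> T. Re (cinner x y) \<ge> l * (norm x)\<^sup>2)"

definition op_shift :: "'b::brane L2 rel \<Rightarrow> real \<Rightarrow> 'b L2 rel" where
  "op_shift T c = {(x, y + c *\<^sub>R x) | x y. (x, y) \<in> T}"

definition op_scale :: "complex \<Rightarrow> 'b::brane L2 rel \<Rightarrow> 'b L2 rel" where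
  "op_scale c T = {(x, c *\<^sub>C y) | x y. (x, y) \<in> T}"

definition op_graph :: "('b::brane L2 \<Rightarrow>\<^sub>L 'b L2) \<Rightarrow> 'b L2 rel" where
  "op_graph T = {(x, blinfun_apply T x) | x. True}"

text \<open>
  The library's \<open>\<Rightarrow>\<^sub>L\<close> only asks for real-linearity. On complex-linear maps its norm is the usual
  operator norm.
\<close>

definition bounded_op :: "'b::brane L2 rel \<Rightarrow> bool" where
  "bounded_op G \<longleftrightarrow> (\<exists>T. op_graph T = G)"

definition the_bounded_op :: "'b::brane L2 rel \<Rightarrow> 'b L2 \<Rightarrow>\<^sub>L 'b L2" where
  "the_bounded_op G = (THE T. op_graph T = G)"

definition projection_valued_measure :: "(real set \<Rightarrow> 'b::brane L2 \<Rightarrow>\<^sub>L 'b L2) \<Rightarrow> bool" where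
  "projection_valued_measure E \<longleftrightarrow>
     (\<forall>A\<in>sets borel. \<forall>x y. cinner (E A x) y = cinner x (E A y)) \<and>
     (\<forall>A\<in>sets borel. \<forall>B\<in>sets borel. \<forall>x. E (A \<inter> B) x = E A (E B x)) \<and>
     E {} = 0 \<and> E UNIV = id_blinfun \<and>
     (\<forall>A. range A \<subseteq> sets borel \<longrightarrow> disjoint_family A \<longrightarrow>
        (\<forall>x. (\<lambda>n::nat. E (A n) x) sums E (\<Union>n. A n) x))"

text \<open>The finite measure \<open>A \<mapsto> \<langle>x, E(A) x\<rangle>\<close>.\<close>

definition spectral_weight ::
    "(real set \<Rightarrow> 'b::brane L2 \<Rightarrow>\<^sub>L 'b L2) \<Rightarrow> 'b L2 \<Rightarrow> real measure" where
  "spectral_weight E x = measure_of UNIV (sets borel) (\<lambda>A. ennreal (Re (cinner x (E A x))))"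

definition simple_spectral_integral ::
    "(real set \<Rightarrow> 'b::brane L2 \<Rightarrow>\<^sub>L 'b L2) \<Rightarrow> (real \<Rightarrow> real) \<Rightarrow> 'b L2 \<Rightarrow> 'b L2" where
  "simple_spectral_integral E h x = (\<Sum>c\<in>range h. c *\<^sub>R E (h -` {c}) x)"

text \<open>
  \<open>\<integral> f dE\<close> is defined at \<open>x\<close> iff \<open>f\<close> is square-integrable for \<open>\<langle>x, E(\<cdot>) x\<rangle>\<close>, and its value is
  then the limit of \<open>\<integral> h\<^sub>n dE x\<close> for simple functions \<open>h\<^sub>n\<close> tending to \<open>f\<close> in the \<open>L\<^sup>2\<close> space of that
  measure; \<open>h \<mapsto> \<integral> h dE x\<close> is isometric, so the choice of \<open>h\<^sub>n\<close> does not matter.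
\<close>

definition spectral_integral ::
    "(real set \<Rightarrow> 'b::brane L2 \<Rightarrow>\<^sub>L 'b L2) \<Rightarrow> (real \<Rightarrow> real) \<Rightarrow> 'b L2 rel" where
  "spectral_integral E f = {(x, y).
     (\<integral>\<^sup>+t. ennreal ((f t)\<^sup>2) \<partial>spectral_weight E x) < \<infinity> \<and>
     (\<exists>h. (\<forall>n::nat. simple_function borel (h n)) \<and>
        (\<lambda>n. \<integral>\<^sup>+t. ennreal ((f t - h n t)\<^sup>2) \<partial>spectral_weight E x) \<longlonglongrightarrow> 0 \<and>
        (\<lambda>n. simple_spectral_integral E (h n) x) \<longlonglongrightarrow> y)}"

text \<open>
  By the spectral theorem a self-adjoint operator has exactly one spectral measure. It is unique on
  the Borel sets only, hence the choice operator; the values elsewhere are never used.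
\<close>

definition spectral_measure :: "'b::brane L2 rel \<Rightarrow> real set \<Rightarrow> 'b L2 \<Rightarrow>\<^sub>L 'b L2" where
  "spectral_measure T =
     (SOME E. projection_valued_measure E \<and> spectral_integral E (\<lambda>t. t) = T)"

text \<open>
  Meant for operators with spectrum in the positive half-line; on non-positive arguments \<open>powr\<close> has
  a conventional value.
\<close>

definition op_powr :: "'b::brane L2 rel \<Rightarrow> real \<Rightarrow> 'b L2 rel"  (infixr \<open>op'_powr\<close> 80) where
  "T op_powr a = spectral_integral (spectral_measure T) (\<lambda>t. t powr a)"

text \<open>
  The library's Bochner integral is restricted to second-countable spaces, which excludes the
  bounded operators with the operator norm. The simple integrals are the library's.
\<close>

definition has_norm_bochner_integral ::
    "'a measure \<Rightarrow> ('a \<Rightarrow> 'e::real_normed_vector) \<Rightarrow> 'e \<Rightarrow> bool" where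
  "has_norm_bochner_integral M f I \<longleftrightarrow>
     (\<exists>h. (\<forall>n::nat. Bochner_Integration.simple_bochner_integrable M (h n)) \<and>
        (AE x in M. (\<lambda>n. h n x) \<longlonglongrightarrow> f x) \<and>
        (\<lambda>n. \<integral>\<^sup>+x. ennreal (norm (f x - h n x)) \<partial>M) \<longlonglongrightarrow> 0 \<and>
        (\<lambda>n. Bochner_Integration.simple_bochner_integral M (h n)) \<longlonglongrightarrow> I)"

definition norm_bochner_integrable :: "'a measure \<Rightarrow> ('a \<Rightarrow> 'e::real_normed_vector) \<Rightarrow> bool" where
  "norm_bochner_integrable M f \<longleftrightarrow> (\<exists>I. has_norm_bochner_integral M f I)"

definition norm_bochner_integral :: "'a measure \<Rightarrow> ('a \<Rightarrow> 'e::real_normed_vector) \<Rightarrow> 'e" where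
  "norm_bochner_integral M f = (THE I. has_norm_bochner_integral M f I)"

definition mediator_power :: "'b::brane L2 rel \<Rightarrow> real \<Rightarrow> real ^ 3 \<Rightarrow> 'b L2 rel" where
  "mediator_power L s q = op_shift L ((norm q)\<^sup>2) op_powr (- s)"

definition mediator_integrand ::
    "'b::brane L2 rel \<Rightarrow> real \<Rightarrow> real ^ 3 \<Rightarrow> 'b L2 \<Rightarrow>\<^sub>L 'b L2" where
  "mediator_integrand L s q = (1 / (2 * pi) ^ 3) *\<^sub>R the_bounded_op (mediator_power L s q)"

definition brane_mediator :: "(real \<Rightarrow> complex) \<Rightarrow> 'b::brane L2 rel \<Rightarrow> real \<Rightarrow> 'b L2 rel" where
  "brane_mediator \<kappa> L s =
     op_scale (\<kappa> s) (op_graph (norm_bochner_integral lborel (mediator_integrand L s)))"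

definition C3 :: "real \<Rightarrow> real" where
  "C3 s = 1 / (4 * pi) powr (3 / 2) * (Gamma (s - 3 / 2) / Gamma s)"

end

theory Submission
  imports Defs "HOL-Probability.Probability"
begin

text \<open>
  Every operator \<open>(L + |q|\<^sup>2)\<^sup>-\<^sup>s\<close> is a function of \<open>L\<close>. Tested on a vector \<open>x\<close>, the momentum integral is
  therefore a double integral of \<open>(t + |q|\<^sup>2) powr - s\<close> over \<open>q\<close> and over the spectral measure of \<open>L\<close>
  at \<open>x\<close>, and Tonelli's theorem leaves the scalar identity
  \<open>\<integral> (t + |q|\<^sup>2) powr - s dq = (2 \<pi>)\<^sup>3 C3 s t powr (3/2 - s)\<close> (\<open>nn_integral_momentum_power\<close>).
  That identity follows by writing the power as a Gamma integral of exponentials, which makes the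
  integral over \<open>q\<close> Gaussian. The Bochner integral converges in norm because the integrand depends
  continuously on \<open>|q|\<^sup>2\<close> alone and its norm is at most \<open>(l + |q|\<^sup>2) powr - s\<close>; symmetric operators
  being determined by their quadratic forms, the tested identity is the operator identity
  (\<open>momentum_operator_integral\<close>).

  Two facts make this argument legitimate. The first is the spectral theorem
  (\<open>spectral_measure_exists\<close>): the powers are defined through a chosen projection-valued measure,
  so one has to exist. Since \<open>L \<ge> l > 0\<close>, the operator \<open>A = l L\<inverse>\<close> is a bounded operator with
  \<open>0 \<le> A \<le> 1\<close> (\<open>self_adjoint_inverse\<close>). The numbers \<open>\<langle>x, A\<^sup>k (1 - A)\<^sup>j x\<rangle>\<close> are non-negative, and
  Hausdorff's moment theorem (\<open>hausdorff_moment\<close>) turns them into a measure on \<open>[0, 1]\<close> with the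
  moments \<open>\<langle>x, A\<^sup>m x\<rangle>\<close>. A signed measure on \<open>[0, 1]\<close> is determined by its moments
  (\<open>moments_determine_functional\<close>), so each algebraic identity between the powers of \<open>A\<close> becomes
  an identity between these measures: bilinearity, which produces the spectral projections through
  Riesz representation, and multiplicativity. Pushing forward along \<open>u \<mapsto> l / u\<close> gives the spectral
  measure of \<open>L\<close>.

  The second fact is that the measures chosen for \<open>L\<close> and for \<open>L + |q|\<^sup>2\<close> are compatible
  (\<open>Phi_powr_shift\<close>). Both represent the same resolvent \<open>(L + |q|\<^sup>2)\<inverse>\<close>, hence all polynomials in it,
  hence by Weierstrass approximation all its positive powers.
\<close>

section \<open>The complex Hilbert space structure\<close>

lemma scaleC_add_right: "c *\<^sub>C (x + y) = c *\<^sub>C x + c *\<^sub>C (y :: 'b::brane L2)"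
  by transfer (auto simp: L2_rel_def ring_distribs intro!: sq_integrable_add sq_integrable_scale)

lemma scaleC_scaleC: "c *\<^sub>C d *\<^sub>C x = (c * d) *\<^sub>C (x :: 'b::brane L2)"
  by transfer (auto simp: L2_rel_def mult.assoc intro!: sq_integrable_scale)

lemma scaleC_of_real: "complex_of_real r *\<^sub>C x = r *\<^sub>R (x :: 'b::brane L2)"
  by (simp add: scaleR_L2_def)

lemma scaleC_scaleR: "c *\<^sub>C r *\<^sub>R x = r *\<^sub>R c *\<^sub>C (x :: 'b::brane L2)"
  by (simp add: scaleR_L2_def scaleC_scaleC mult.commute)

lemma scaleC_minus: "c *\<^sub>C (- x) = - (c *\<^sub>C (x :: 'b::brane L2))"
  by (metis scaleC_scaleR scaleR_minus1_left)

lemma scaleC_diff: "c *\<^sub>C (x - y) = c *\<^sub>C x - c *\<^sub>C (y :: 'b::brane L2)"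
  by (metis diff_conv_add_uminus scaleC_add_right scaleC_minus)

lemma cinner_add_left: "cinner (a + b) c = cinner a c + cinner b (c :: 'b::brane L2)"
  by transfer (auto simp: L2_rel_def ring_distribs sq_integrable_inner)

lemma cinner_commute: "cinner b a = cnj (cinner a (b :: 'b::brane L2))"
proof transfer
  fix f g :: "'b \<Rightarrow> complex"
  have "cnj (\<integral>x. cnj (f x) * g x \<partial>brane_measure) = (\<integral>x. cnj (cnj (f x) * g x) \<partial>brane_measure)"
    by (rule Bochner_Integration.integral_cnj[symmetric])
  then show "(\<integral>x. cnj (g x) * f x \<partial>brane_measure) = cnj (\<integral>x. cnj (f x) * g x \<partial>brane_measure)"
    by (simp add: mult.commute)
qed

lemma cinner_add_right: "cinner c (a + b) = cinner c a + cinner c (b :: 'b::brane L2)"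
  by (metis cinner_add_left cinner_commute complex_cnj_add)

lemma cinner_scaleC_left: "cinner (c *\<^sub>C a) b = cnj c * cinner a (b :: 'b::brane L2)"
  by transfer (auto simp: L2_rel_def mult.assoc)

lemma cinner_scaleC_right: "cinner a (c *\<^sub>C b) = c * cinner a (b :: 'b::brane L2)"
  by (metis cinner_scaleC_left cinner_commute complex_cnj_cnj complex_cnj_mult)

lemma cinner_eq_inner: "cinner x y = Complex (x \<bullet> y) ((\<i> *\<^sub>C x) \<bullet> (y :: 'b::brane L2))"
  by (simp add: inner_L2_def cinner_scaleC_left complex_eq_iff)

lemma inner_scaleC_left: "(c *\<^sub>C x) \<bullet> y = x \<bullet> (cnj c *\<^sub>C (y :: 'b::brane L2))"
  by (simp add: inner_L2_def cinner_scaleC_left cinner_scaleC_right)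

lemma norm_scaleC: "norm (c *\<^sub>C x) = cmod c * norm (x :: 'b::brane L2)"
proof -
  have "cnj c * c = complex_of_real ((cmod c)\<^sup>2)"
    by (metis complex_norm_square mult.commute)
  then have "(norm (c *\<^sub>C x))\<^sup>2 = (cmod c)\<^sup>2 * (norm x)\<^sup>2"
    by (simp add: power2_norm_eq_inner inner_scaleC_left scaleC_scaleC scaleC_of_real)
  then show ?thesis
    by (metis norm_ge_zero power2_eq_imp_eq power_mult_distrib mult_nonneg_nonneg)
qed

lemma bounded_linear_scaleC: "bounded_linear (\<lambda>x :: 'b::brane L2. c *\<^sub>C x)"
  by (rule bounded_linear_intro[where K = "cmod c"])
    (simp_all add: scaleC_add_right scaleC_scaleR norm_scaleC)

lemmas tendsto_scaleC [tendsto_intros] = bounded_linear.tendsto [OF bounded_linear_scaleC]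

lemma norm_abs_L2:
  fixes f :: "'b::brane \<Rightarrow> complex"
  assumes "sq_integrable f"
  shows "(norm (abs_L2 f))\<^sup>2 = (\<integral>x. (cmod (f x))\<^sup>2 \<partial>brane_measure)"
proof -
  have r: "L2_rel f f" using assms by (simp add: L2_rel_def)
  have sq: "cnj z * z = complex_of_real ((cmod z)\<^sup>2)" for z
    by (metis complex_norm_square mult.commute)
  have "cinner (abs_L2 f) (abs_L2 f) = (\<integral>x. cnj (f x) * f x \<partial>brane_measure)"
    by (rule cinner.abs_eq[OF r r])
  then show ?thesis
    unfolding power2_norm_eq_inner inner_L2_def sq
    by (simp only: integral_complex_of_real Re_complex_of_real)
qed

lemma nn_norm_abs_L2:
  fixes f :: "'b::brane \<Rightarrow> complex"
  assumes "sq_integrable f"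
  shows "(\<integral>\<^sup>+x. ennreal ((cmod (f x))\<^sup>2) \<partial>brane_measure) = ennreal ((norm (abs_L2 f))\<^sup>2)"
  using assms unfolding norm_abs_L2[OF assms]
  by (subst nn_integral_eq_integral) (auto simp: sq_integrable_def)

lemma L2_representative: "\<exists>f. sq_integrable f \<and> u = abs_L2 f" for u :: "'b::brane L2"
  by (metis L2_rel_def Quotient3_L2 Quotient3_def)

lemma abs_L2_diff:
  fixes f g :: "'b::brane \<Rightarrow> complex"
  assumes "sq_integrable f" "sq_integrable g"
  shows "abs_L2 f - abs_L2 g = abs_L2 (\<lambda>x. f x - g x)" "sq_integrable (\<lambda>x. f x - g x)"
proof -
  have r: "L2_rel f f" "L2_rel g g" using assms by (auto simp: L2_rel_def)
  have s: "L2_rel (\<lambda>x. - 1 * g x) (\<lambda>x. - 1 * g x)"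
    using sq_integrable_scale[OF assms(2), of "-1"] by (simp only: L2_rel_def) simp
  show "abs_L2 f - abs_L2 g = abs_L2 (\<lambda>x. f x - g x)"
    unfolding minus_L2_def uminus_L2_def scaleC.abs_eq[OF r(2)] plus_L2.abs_eq[OF r(1) s] by simp
  show "sq_integrable (\<lambda>x. f x - g x)"
    using sq_integrable_add[OF assms(1) sq_integrable_scale[OF assms(2), of "-1"]] by simp
qed

text \<open>
  Even with the weights \<open>2 ^ n\<close> the squared increments have a finite integral of their sum. Hence at
  almost every point the increments are eventually below \<open>(1 / sqrt 2) ^ n\<close>.
\<close>

lemma AE_convergent_fast_L2:
  fixes f :: "nat \<Rightarrow> 'a \<Rightarrow> complex"
  assumes [measurable]: "\<And>n. f n \<in> borel_measurable M"
    and bound: "\<And>n. (\<integral>\<^sup>+x. ennreal ((cmod (f (Suc n) x - f n x))\<^sup>2) \<partial>M) \<le> ennreal ((1/4) ^ n)"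
  shows "AE x in M. convergent (\<lambda>n. f n x)"
proof -
  have "(\<integral>\<^sup>+x. (\<Sum>n. ennreal (2 ^ n * (cmod (f (Suc n) x - f n x))\<^sup>2)) \<partial>M)
      = (\<Sum>n. \<integral>\<^sup>+x. ennreal (2 ^ n * (cmod (f (Suc n) x - f n x))\<^sup>2) \<partial>M)"
    by (rule nn_integral_suminf) measurable
  also have "\<dots> = (\<Sum>n. ennreal (2 ^ n) * (\<integral>\<^sup>+x. ennreal ((cmod (f (Suc n) x - f n x))\<^sup>2) \<partial>M))"
    by (simp add: ennreal_mult nn_integral_cmult)
  also have "\<dots> \<le> (\<Sum>n. ennreal (2 ^ n) * ennreal ((1/4) ^ n))"
    by (intro suminf_le mult_left_mono bound) auto
  also have "\<dots> = (\<Sum>n. ennreal ((1/2) ^ n))"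
    by (simp add: ennreal_mult[symmetric] power_mult_distrib[symmetric])
  also have "\<dots> = ennreal (\<Sum>n. (1/2) ^ n)"
    by (intro suminf_ennreal2) (auto intro: summable_geometric)
  finally have "(\<integral>\<^sup>+x. (\<Sum>n. ennreal (2 ^ n * (cmod (f (Suc n) x - f n x))\<^sup>2)) \<partial>M) \<noteq> \<infinity>"
    by (auto simp: top_unique)
  then have "AE x in M. (\<Sum>n. ennreal (2 ^ n * (cmod (f (Suc n) x - f n x))\<^sup>2)) \<noteq> \<infinity>"
    by (intro nn_integral_noteq_infinite) measurable
  then show ?thesis
  proof eventually_elim
    case (elim x)
    define d where "d n = cmod (f (Suc n) x - f n x)" for n
    have "summable (\<lambda>n. 2 ^ n * (d n)\<^sup>2)"
      using elim unfolding d_def by (intro summable_suminf_not_top) auto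
    then have "(\<lambda>n. 2 ^ n * (d n)\<^sup>2) \<longlonglongrightarrow> 0"
      by (rule summable_LIMSEQ_zero)
    then have "\<forall>\<^sub>F n in sequentially. 2 ^ n * (d n)\<^sup>2 < 1"
      by (rule order_tendstoD) simp
    then have "\<forall>\<^sub>F n in sequentially. norm (f (Suc n) x - f n x) \<le> (1 / sqrt 2) ^ n"
    proof eventually_elim
      case (elim n)
      have "((1 / sqrt 2) ^ n)\<^sup>2 = ((1 / sqrt 2)\<^sup>2) ^ n"
        by (simp only: power_mult[symmetric] mult.commute)
      also have "\<dots> = 1 / 2 ^ n"
        by (simp add: power_divide)
      finally have "(d n)\<^sup>2 \<le> ((1 / sqrt 2) ^ n)\<^sup>2"
        using elim by (simp add: field_simps)
      then show ?case
        unfolding d_def[symmetric] by (rule power2_le_imp_le) simp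
    qed
    moreover have "summable (\<lambda>n. (1 / sqrt 2) ^ n)"
      by (rule summable_geometric) simp
    ultimately have "summable (\<lambda>n. f (Suc n) x - f n x)"
      by (rule summable_comparison_test_ev)
    then have "convergent (\<lambda>n. \<Sum>k<n. f (Suc k) x - f k x)"
      by (simp add: summable_iff_convergent)
    then have "convergent (\<lambda>n. f n x - f 0 x)"
      using sum_lessThan_telescope[of "\<lambda>n. f n x"] by simp
    then show ?case
      using convergent_diff_const_right_iff by blast
  qed
qed

text \<open>
  Along a fast subsequence the representatives converge almost everywhere, and Fatou's lemma
  bounds the distance of the pointwise limit from the subsequence in the norm.
\<close>

instance L2 :: (brane) complete_space
proof
  fix u :: "nat \<Rightarrow> 'a L2"
  assume "Cauchy u"
  then have "\<exists>N. \<forall>m\<ge>N. \<forall>n\<ge>N. dist (u m) (u n) < (1/2) ^ k" for k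
    by (auto intro!: metric_CauchyD)
  then obtain N where N: "\<And>k m n. m \<ge> N k \<Longrightarrow> n \<ge> N k \<Longrightarrow> dist (u m) (u n) < (1/2) ^ k"
    by metis
  define r where "r k = (\<Sum>i\<le>k. N i)" for k
  have r: "N k \<le> r m" if "k \<le> m" for k m
    using that unfolding r_def by (intro member_le_sum) auto
  have "\<forall>k. \<exists>f. sq_integrable f \<and> u (r k) = abs_L2 f"
    using L2_representative by blast
  then obtain f where f: "\<And>k. sq_integrable (f k)" "\<And>k. u (r k) = abs_L2 (f k)"
    by metis
  have [measurable]: "f k \<in> borel_measurable brane_measure" for k
    using f(1) by (simp add: sq_integrable_def)
  have dist: "(\<integral>\<^sup>+x. ennreal ((cmod (f m x - f k x))\<^sup>2) \<partial>brane_measure) \<le> ennreal ((1/4) ^ k)"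
    if "k \<le> m" for k m
  proof -
    have "dist (u (r m)) (u (r k)) < (1/2) ^ k"
      using that by (intro N r) auto
    then have "(dist (u (r m)) (u (r k)))\<^sup>2 \<le> ((1/2) ^ k)\<^sup>2"
      by (intro power_mono) auto
    then show ?thesis
      using nn_norm_abs_L2[OF abs_L2_diff(2)[OF f(1) f(1)], of m k]
      by (simp add: dist_norm f abs_L2_diff ennreal_leI power_mult[symmetric] mult.commute[of k 2])
        (simp add: power_mult power2_eq_square)
  qed
  define g where "g x = lim (\<lambda>n. f n x)" for x
  have g [measurable]: "g \<in> borel_measurable brane_measure"
    unfolding g_def by measurable
  have conv: "AE x in brane_measure. (\<lambda>n. f n x) \<longlonglongrightarrow> g x"
    using AE_convergent_fast_L2[of f brane_measure] dist[of n "Suc n" for n]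
    by (auto simp: g_def convergent_LIMSEQ_iff)
  have gf: "(\<integral>\<^sup>+x. ennreal ((cmod (g x - f k x))\<^sup>2) \<partial>brane_measure) \<le> ennreal ((1/4) ^ k)" for k
  proof -
    have "(\<integral>\<^sup>+x. ennreal ((cmod (g x - f k x))\<^sup>2) \<partial>brane_measure)
        = (\<integral>\<^sup>+x. liminf (\<lambda>m. ennreal ((cmod (f m x - f k x))\<^sup>2)) \<partial>brane_measure)"
      using conv
      by (intro nn_integral_cong_AE)
        (auto elim!: eventually_mono intro!: lim_imp_Liminf[symmetric] tendsto_intros)
    also have "\<dots> \<le> liminf (\<lambda>m. \<integral>\<^sup>+x. ennreal ((cmod (f m x - f k x))\<^sup>2) \<partial>brane_measure)"
      by (rule nn_integral_liminf) measurable
    also have "\<dots> \<le> liminf (\<lambda>m::nat. ennreal ((1/4) ^ k))"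
      by (intro Liminf_mono eventually_sequentiallyI[of k] dist)
    finally show ?thesis by (simp add: Liminf_const)
  qed
  have diff: "sq_integrable (\<lambda>x. g x - f k x)" for k
    using gf[of k] unfolding sq_integrable_def
    by (auto intro!: integrableI_bounded intro: le_less_trans)
  have "sq_integrable g"
    using sq_integrable_add[OF diff[of 0] f(1)[of 0]] by simp
  have lim: "norm (u (r k) - abs_L2 g) \<le> (1/2) ^ k" for k
  proof -
    have "ennreal ((norm (abs_L2 g - u (r k)))\<^sup>2) \<le> ennreal ((1/4) ^ k)"
      using gf[of k] nn_norm_abs_L2[OF diff, of k] by (simp add: f abs_L2_diff \<open>sq_integrable g\<close>)
    then have "(norm (abs_L2 g - u (r k)))\<^sup>2 \<le> ((1/2) ^ k)\<^sup>2"
      by (simp add: power_mult[symmetric] mult.commute[of k 2]) (simp add: power_mult power2_eq_square)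
    then show ?thesis
      unfolding norm_minus_commute[of "u (r k)"] by (rule power2_le_imp_le) simp
  qed
  have "u \<longlonglongrightarrow> abs_L2 g"
  proof (rule metric_LIMSEQ_I)
    fix e :: real assume "e > 0"
    then obtain k where k: "(1/2) ^ k < e / 2"
      using real_arch_pow_inv[of "e/2" "1/2"] by auto
    show "\<exists>n0. \<forall>n\<ge>n0. dist (u n) (abs_L2 g) < e"
    proof (intro exI allI impI)
      fix n assume "n \<ge> N k"
      then have "dist (u n) (u (r k)) < (1/2) ^ k"
        by (intro N r) auto
      moreover have "dist (u (r k)) (abs_L2 g) \<le> (1/2) ^ k"
        using lim[of k] by (simp add: dist_norm)
      ultimately show "dist (u n) (abs_L2 g) < e"
        using k dist_triangle[of "u n" "abs_L2 g" "u (r k)"] by linarith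
    qed
  qed
  then show "convergent u" by (auto simp: convergent_def)
qed

instance L2 :: (brane) banach by standard

section \<open>Orthogonal minimisation and the Riesz representation\<close>

text \<open>
  The representing vector minimises \<open>x \<bullet> x / 2 - \<phi> x\<close> over the subspace. For the whole space this
  is Riesz representation; for \<open>\<phi> = (\<bullet>) z\<close> the minimiser is the orthogonal projection of \<open>z\<close>.
\<close>

lemma riesz_on_closed_subspace:
  fixes \<phi> :: "'b::{real_inner, complete_space} \<Rightarrow> real"
  assumes W: "subspace W" "closed W" and "bounded_linear \<phi>"
  shows "\<exists>v\<in>W. \<forall>w\<in>W. \<phi> w = v \<bullet> w"
proof -
  interpret \<phi>: bounded_linear \<phi> by fact
  obtain K where K: "K > 0" "\<And>x. \<bar>\<phi> x\<bar> \<le> norm x * K"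
    using \<phi>.pos_bounded by (auto simp: real_norm_def)
  define J where "J x = x \<bullet> x / 2 - \<phi> x" for x
  have below: "- K\<^sup>2 / 2 \<le> J x" for x
  proof -
    have "0 \<le> (norm x - K)\<^sup>2" by simp
    then have "norm x * K \<le> (norm x)\<^sup>2 / 2 + K\<^sup>2 / 2"
      by (simp add: power2_diff)
    then show ?thesis
      using K(2)[of x] by (simp add: J_def power2_norm_eq_inner)
  qed
  define m where "m = Inf (J ` W)"
  have bdd: "bdd_below (J ` W)"
    using below by (auto simp: bdd_below_def)
  have m_le: "m \<le> J w" if "w \<in> W" for w
    unfolding m_def using that bdd by (auto intro: cInf_lower)
  have "\<exists>w\<in>W. J w < m + 1 / real (Suc n)" for n
  proof -
    have "J ` W \<noteq> {}" using W(1) subspace_0 by auto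
    then have "\<exists>y\<in>J ` W. y < m + 1 / real (Suc n)"
      unfolding m_def using bdd by (intro cInf_lessD) auto
    then show ?thesis by auto
  qed
  then obtain w where w: "\<And>n. w n \<in> W" "\<And>n. J (w n) < m + 1 / real (Suc n)"
    by metis
  \<comment> \<open>By the parallelogram law, near-minimisers of the strictly convex functional are close.\<close>
  have close: "(norm (w i - w j))\<^sup>2 \<le> 4 * (1 / real (Suc i) + 1 / real (Suc j))" for i j
  proof -
    have "(1/2) *\<^sub>R (w i + w j) \<in> W"
      using W(1) w(1) by (intro subspace_scale subspace_add) auto
    then have "m \<le> J ((1/2) *\<^sub>R (w i + w j))" by (rule m_le)
    moreover have "J (w i) + J (w j) - 2 * J ((1/2) *\<^sub>R (w i + w j)) = (norm (w i - w j))\<^sup>2 / 4"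
      by (simp add: J_def power2_norm_eq_inner inner_simps \<phi>.add \<phi>.scaleR field_simps inner_commute)
    ultimately show ?thesis
      using w(2)[of i] w(2)[of j] by argo
  qed
  have "Cauchy w"
  proof (rule metric_CauchyI)
    fix e :: real assume "e > 0"
    then obtain N where N: "1 / real (Suc N) < e\<^sup>2 / 8"
      using reals_Archimedean[of "e\<^sup>2 / 8"] by (auto simp: inverse_eq_divide)
    show "\<exists>M. \<forall>i\<ge>M. \<forall>j\<ge>M. dist (w i) (w j) < e"
    proof (intro exI allI impI)
      fix i j assume "i \<ge> N" "j \<ge> N"
      then have "1 / real (Suc i) \<le> 1 / real (Suc N)" "1 / real (Suc j) \<le> 1 / real (Suc N)"
        by (auto intro!: divide_left_mono)
      then have "(norm (w i - w j))\<^sup>2 < e\<^sup>2"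
        using close[of i j] N by argo
      then show "dist (w i) (w j) < e"
        unfolding dist_norm using \<open>e > 0\<close> by (auto intro: power2_less_imp_less)
    qed
  qed
  then obtain v where v: "w \<longlonglongrightarrow> v"
    by (auto simp: Cauchy_convergent_iff convergent_def)
  have "v \<in> W"
    using closed_sequentially[OF W(2)] w(1) v by blast
  have "(\<lambda>n. J (w n)) \<longlonglongrightarrow> J v"
    unfolding J_def by (intro tendsto_intros v \<phi>.tendsto) simp
  moreover have "(\<lambda>n. m + 1 / real (Suc n)) \<longlonglongrightarrow> m + 0"
    by (intro tendsto_add tendsto_const LIMSEQ_Suc lim_1_over_n)
  ultimately have Jv: "J v \<le> m"
    using w(2) by (intro LIMSEQ_le[of "\<lambda>n. J (w n)" _ "\<lambda>n. m + 1 / real (Suc n)"])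
      (auto intro: less_imp_le)
  have "\<phi> z = v \<bullet> z" if "z \<in> W" for z
  proof -
    define d where "d = v \<bullet> z - \<phi> z"
    have "0 \<le> 2 * t * d + t\<^sup>2 * (z \<bullet> z)" for t
    proof -
      have "v + t *\<^sub>R z \<in> W"
        using W(1) \<open>v \<in> W\<close> that by (intro subspace_add subspace_scale) auto
      then have "J v \<le> J (v + t *\<^sub>R z)" using Jv m_le by (meson order_trans)
      then show ?thesis
        by (simp add: J_def d_def inner_simps \<phi>.add \<phi>.scaleR field_simps inner_commute power2_eq_square)
    qed
    \<comment> \<open>The quadratic in \<open>t\<close> is smallest near \<open>- d / (z \<bullet> z)\<close>; the summand \<open>1\<close> covers \<open>z = 0\<close>.\<close>
    note this[of "- d / (1 + z \<bullet> z)"]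
    moreover have k: "0 < 1 + z \<bullet> z" using inner_ge_zero[of z] by linarith
    moreover have "2 * (- d / k) * d + (- d / k)\<^sup>2 * s = d\<^sup>2 * (s - 2 * k) / k\<^sup>2" if "0 < k" for k s
      using that by (simp add: power2_eq_square field_simps)
    ultimately have "0 \<le> d\<^sup>2 * (z \<bullet> z - 2 * (1 + z \<bullet> z)) / (1 + z \<bullet> z)\<^sup>2"
      by metis
    then have "0 \<le> d\<^sup>2 * (z \<bullet> z - 2 * (1 + z \<bullet> z))"
      using k by (simp add: zero_le_divide_iff)
    then have "d\<^sup>2 * (2 + z \<bullet> z) \<le> 0" by (simp add: algebra_simps)
    then have "d\<^sup>2 \<le> 0"
      using inner_ge_zero[of z] by (auto simp: mult_le_0_iff)
    then show ?thesis by (simp add: d_def)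
  qed
  with \<open>v \<in> W\<close> show ?thesis by blast
qed

section \<open>The Hausdorff moment problem\<close>

lemma sum_choose_Suc:
  fixes a :: "nat \<Rightarrow> real"
  shows "(\<Sum>i\<le>Suc n. real (Suc n choose i) * a i)
    = (\<Sum>i\<le>n. real (n choose i) * a i) + (\<Sum>i\<le>n. real (n choose i) * a (Suc i))"
proof -
  have "(\<Sum>i\<le>n. real (n choose i) * a i) = (\<Sum>i\<le>Suc n. real (n choose i) * a i)"
    by (simp add: binomial_eq_0)
  also have "\<dots> = a 0 + (\<Sum>i\<le>n. real (n choose Suc i) * a (Suc i))"
    by (simp add: sum.atMost_Suc_shift del: sum.atMost_Suc)
  finally show ?thesis
    by (simp add: sum.atMost_Suc_shift sum.distrib[symmetric] algebra_simps del: sum.atMost_Suc)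
qed

text \<open>
  Applying the recursion \<open>n\<close> times spreads \<open>q m p\<close> over row \<open>n\<close> of Pascal's triangle.
\<close>

lemma moment_sequence_binomial_sum:
  fixes q :: "nat \<Rightarrow> nat \<Rightarrow> real"
  assumes rec: "\<And>k j. q k j = q (Suc k) j + q k (Suc j)"
  shows "(\<Sum>i\<le>n. real (n choose i) * q (m + i) (p + (n - i))) = q m p"
proof (induction n arbitrary: m p)
  case 0
  then show ?case by simp
next
  case (Suc n)
  have "(\<Sum>i\<le>Suc n. real (Suc n choose i) * q (m + i) (p + (Suc n - i)))
    = (\<Sum>i\<le>n. real (n choose i) * q (m + i) (p + (Suc n - i)))
    + (\<Sum>i\<le>n. real (n choose i) * q (m + Suc i) (p + (Suc n - Suc i)))"
    by (rule sum_choose_Suc)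
  also have "(\<Sum>i\<le>n. real (n choose i) * q (m + i) (p + (Suc n - i)))
      = (\<Sum>i\<le>n. real (n choose i) * q (m + i) (Suc p + (n - i)))"
    by (intro sum.cong refl) (simp add: Suc_diff_le)
  also have "\<dots> = q m (Suc p)" by (rule Suc)
  also have "(\<Sum>i\<le>n. real (n choose i) * q (m + Suc i) (p + (Suc n - Suc i))) = q (Suc m) p"
    using Suc[of "Suc m" p] by simp
  finally show ?case using rec[of m p] by simp
qed

lemma choose_ratio_prod:
  assumes "m \<le> n"
  shows "real (k choose m) / real (n choose m) = (\<Prod>i<m. (real k - real i) / (real n - real i))"
  by (simp add: binomial_gbinomial gbinomial_prod_rev prod_dividef atLeast0LessThan)

text \<open>
  The Bernstein weights reproduce the moments exactly when powers of \<open>k / n\<close> are replaced by ratios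
  of falling factorials, that is, of binomial coefficients. The replacement costs \<open>O (1 / n)\<close>,
  uniformly in \<open>k\<close>.
\<close>

lemma choose_ratio_approx:
  assumes "2 * m < n" "k \<le> n"
  shows "\<bar>real (k choose m) / real (n choose m) - (real k / real n) ^ m\<bar>
    \<le> real m * (real m / (real n - real m))"
proof -
  have *: "\<bar>(real k - real i) / (real n - real i)\<bar> \<le> 1" if "i < m" for i
    using assms that unfolding abs_divide by (intro divide_le_eq_1_pos[THEN iffD2]) auto
  have **: "\<bar>(real k - real i) / (real n - real i) - real k / real n\<bar> \<le> real m / (real n - real m)"
    if "i < m" for i
  proof -
    have "real k / real n - (real k - real i) / (real n - real i)
        = (real i / (real n - real i)) * (1 - real k / real n)"
      using assms that by (simp add: field_simps)
    moreover have "0 \<le> 1 - real k / real n" "1 - real k / real n \<le> 1"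
      using assms by (auto simp: divide_le_eq)
    moreover have "0 \<le> real i / (real n - real i)"
      using assms that by auto
    ultimately have "\<bar>(real k - real i) / (real n - real i) - real k / real n\<bar>
        \<le> real i / (real n - real i)"
      by (metis abs_minus_commute abs_mult abs_of_nonneg mult_left_le)
    also have "\<dots> \<le> real m / (real n - real m)"
      using assms that by (intro frac_le) auto
    finally show ?thesis .
  qed
  have "\<bar>(\<Prod>i<m. (real k - real i) / (real n - real i)) - (\<Prod>i<m. real k / real n)\<bar>
      \<le> (\<Sum>i<m. \<bar>(real k - real i) / (real n - real i) - real k / real n\<bar>)"
    using norm_prod_diff[of "{..<m}" "\<lambda>i. (real k - real i) / (real n - real i)" "\<lambda>_. real k / real n"]
      * assms by (simp add: divide_le_eq)
  also have "\<dots> \<le> (\<Sum>i<m. real m / (real n - real m))"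
    using ** by (intro sum_mono) auto
  finally show ?thesis
    using assms by (simp add: choose_ratio_prod)
qed

text \<open>
  The weights \<open>(n choose k) * q k (n - k)\<close> at the points \<open>k / n\<close> are what Bernstein's polynomials
  prescribe for a measure with moments \<open>q m 0\<close>; their \<open>m\<close>-th moments converge to \<open>q m 0\<close>, and a
  weak limit exists because all the masses sit in \<open>[0, 1]\<close>.
\<close>

proposition hausdorff_moment:
  fixes q :: "nat \<Rightarrow> nat \<Rightarrow> real"
  assumes nonneg: "\<And>k j. 0 \<le> q k j" and rec: "\<And>k j. q k j = q (Suc k) j + q k (Suc j)"
    and one: "q 0 0 = 1"
  shows "\<exists>M. real_distribution M \<and> (AE t in M. t \<in> {0..1}) \<and> (\<forall>m. (\<integral>t. t ^ m \<partial>M) = q m 0)"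
proof -
  define w where "w n k = real (n choose k) * q k (n - k)" for n k
  have w0: "0 \<le> w n k" for n k by (simp add: w_def nonneg)
  have w1: "(\<Sum>k\<le>n. w n k) = 1" for n
    using moment_sequence_binomial_sum[where q = q, OF rec, of n 0 0] by (simp add: w_def one)
  define P where "P n = point_measure {..n} (w n)" for n
  define N where "N n = distr (P n) borel (\<lambda>k. real k / real n)" for n
  have meas [measurable]: "f \<in> measurable (P n) borel" for f :: "nat \<Rightarrow> real" and n
    by (simp add: P_def point_measure_def)
  have N: "real_distribution (N n)" for n
  proof -
    have "emeasure (P n) (space (P n)) = (\<Sum>k\<le>n. ennreal (w n k))"
      unfolding P_def by (subst emeasure_point_measure_finite) (auto simp: space_point_measure)
    then have "prob_space (P n)"
      by (intro prob_spaceI) (simp add: sum_ennreal w0 w1)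
    then show ?thesis
      unfolding real_distribution_def real_distribution_axioms_def N_def
      by (auto intro: prob_space.prob_space_distr)
  qed
  have intN: "(\<integral>t. f t \<partial>N n) = (\<Sum>k\<le>n. w n k * f (real k / real n))"
    if [measurable]: "f \<in> borel_measurable borel" for n and f :: "real \<Rightarrow> real"
    unfolding N_def by (subst integral_distr) (auto simp: P_def lebesgue_integral_point_measure_finite w0)
  have moment: "(\<lambda>n. \<Sum>k\<le>n. w n k * (real k / real n) ^ m) \<longlonglongrightarrow> q m 0" for m
  proof -
    \<comment> \<open>The falling-factorial moments are exact.\<close>
    have eq: "(\<Sum>k\<le>n. w n k * (real (k choose m) / real (n choose m))) = q m 0" if "m \<le> n" for n
    proof -
      have "(\<Sum>k\<le>n. w n k * (real (k choose m) / real (n choose m)))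
          = (\<Sum>k\<in>{m..n}. w n k * (real (k choose m) / real (n choose m)))"
        by (rule sum.mono_neutral_right) (auto simp: binomial_eq_0)
      also have "\<dots> = (\<Sum>k\<in>{m..n}. real ((n - m) choose (k - m)) * q k (n - k))"
      proof (rule sum.cong[OF refl])
        fix k assume "k \<in> {m..n}"
        then have "real (n choose k) * real (k choose m) = real (n choose m) * real ((n - m) choose (k - m))"
          using choose_mult[of m k n] by (metis atLeastAtMost_iff of_nat_mult)
        moreover have "real (n choose m) \<noteq> 0" using that by (simp add: binomial_eq_0_iff)
        ultimately show "w n k * (real (k choose m) / real (n choose m))
            = real ((n - m) choose (k - m)) * q k (n - k)"
          by (simp add: w_def field_simps)
      qed
      also have "\<dots> = (\<Sum>i\<le>n - m. real ((n - m) choose i) * q (m + i) (n - (m + i)))"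
        using that by (intro sum.reindex_bij_witness[of _ "\<lambda>i. m + i" "\<lambda>k. k - m"]) auto
      also have "\<dots> = q m 0"
        using moment_sequence_binomial_sum[where q = q, OF rec, of "n - m" m 0] by (simp add: diff_diff_left)
      finally show ?thesis .
    qed
    have "\<forall>\<^sub>F n in sequentially. \<bar>(\<Sum>k\<le>n. w n k * (real k / real n) ^ m) - q m 0\<bar>
        \<le> real m * (real m / (real n - real m))"
      using eventually_gt_at_top[of "2 * m"]
    proof eventually_elim
      case (elim n)
      have "(\<Sum>k\<le>n. w n k * (real k / real n) ^ m) - q m 0
          = (\<Sum>k\<le>n. w n k * ((real k / real n) ^ m - real (k choose m) / real (n choose m)))"
        using eq[of n] elim by (simp add: sum_subtractf right_diff_distrib)
      also have "\<bar>\<dots>\<bar> \<le> (\<Sum>k\<le>n. w n k * (real m * (real m / (real n - real m))))"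
      proof (intro order_trans[OF sum_abs] sum_mono)
        fix k assume "k \<in> {..n}"
        then show "\<bar>w n k * ((real k / real n) ^ m - real (k choose m) / real (n choose m))\<bar>
            \<le> w n k * (real m * (real m / (real n - real m)))"
          using choose_ratio_approx[of m n k] elim w0[of n k]
          unfolding abs_mult abs_minus_commute[of "(real k / real n) ^ m"]
          by (intro mult_mono) auto
      qed
      finally show ?case by (simp only: sum_distrib_right[symmetric] w1 mult_1_left)
    qed
    moreover have "filterlim (\<lambda>n. - real m + real n) at_top sequentially"
      by (intro filterlim_tendsto_add_at_top[OF tendsto_const] filterlim_real_sequentially)
    then have "filterlim (\<lambda>n. real n - real m) at_infinity sequentially"
      using filterlim_at_top_imp_at_infinity by simp
    from tendsto_mult_right_zero[OF tendsto_divide_0[OF tendsto_const this]]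
    have "(\<lambda>n. real m * (real m / (real n - real m))) \<longlonglongrightarrow> 0" .
    ultimately have "(\<lambda>n. (\<Sum>k\<le>n. w n k * (real k / real n) ^ m) - q m 0) \<longlonglongrightarrow> 0"
      unfolding real_norm_def[symmetric] by (rule Lim_null_comparison)
    then show ?thesis by (rule LIM_zero_cancel)
  qed
  have "tight N"
    unfolding tight_def
  proof (intro conjI allI impI N)
    fix e :: real assume "e > 0"
    have "measure (N n) {-1<..2} = 1" for n
    proof -
      have "measure (N n) {-1<..2} = (\<integral>t. indicator {-1<..2} t \<partial>N n)"
        using real_distribution.events_eq_borel[OF N] by simp
      also have "\<dots> = (\<Sum>k\<le>n. w n k)"
        by (subst intN) (auto simp: indicator_def divide_le_eq intro!: sum.cong intro: less_le_trans[of _ 0])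
      finally show ?thesis by (simp add: w1)
    qed
    then show "\<exists>a b. a < b \<and> (\<forall>n. 1 - e < measure (N n) {a<..b})"
      using \<open>e > 0\<close> by (intro exI[of _ "-1"] exI[of _ 2]) auto
  qed
  then obtain r M where r: "strict_mono r" and M: "real_distribution M"
    and conv: "weak_conv_m (N \<circ> id \<circ> r) M"
    using tight_imp_convergent_subsubsequence[of N id] by (auto simp: strict_mono_id)
  interpret M: real_distribution M by fact
  have lim: "(\<lambda>n. \<integral>t. f t \<partial>N (r n)) \<longlonglongrightarrow> (\<integral>t. f t \<partial>M)"
    if "continuous_on UNIV f" "\<And>t. \<bar>f t\<bar> \<le> B" for f :: "real \<Rightarrow> real" and B
    using weak_conv_imp_integral_bdd_continuous_conv[of "N \<circ> id \<circ> r" M f B] that M N conv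
    by (auto simp: continuous_on_eq_continuous_at)
  \<comment> \<open>Weak convergence only tests bounded functions, so \<open>t\<close> is clamped to \<open>[0, 1]\<close>.\<close>
  define c where "c t = max 0 (min 1 t)" for t :: real
  have c_cont: "continuous_on UNIV c" unfolding c_def by (intro continuous_intros)
  have c01: "0 \<le> c t" "c t \<le> 1" "t \<in> {0..1} \<Longrightarrow> c t = t" for t
    by (auto simp: c_def)
  have supp: "AE t in M. t \<in> {0..1}"
  proof -
    define g where "g t = min 1 \<bar>t - c t\<bar>" for t
    have g_cont: "continuous_on UNIV g" unfolding g_def by (intro continuous_intros c_cont)
    then have [measurable]: "g \<in> borel_measurable borel" by (rule borel_measurable_continuous_onI)
    have g0: "0 \<le> g t" "g t \<le> 1" for t by (auto simp: g_def)
    have "(\<integral>t. g t \<partial>N n) = 0" for n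
      by (subst intN) (auto simp: g_def c01 divide_le_eq intro!: sum.neutral)
    with lim[OF g_cont, of 1] g0 have "(\<integral>t. g t \<partial>M) = 0"
      by (auto simp: LIMSEQ_const_iff)
    moreover have "integrable M g"
      using g0 by (intro M.integrable_const_bound[of _ 1]) auto
    ultimately have "AE t in M. g t = 0"
      using g0 by (subst (asm) integral_nonneg_eq_0_iff_AE) auto
    then show ?thesis
      by eventually_elim (auto simp: g_def c_def min_def max_def split: if_splits)
  qed
  moreover have "(\<integral>t. t ^ m \<partial>M) = q m 0" for m
  proof -
    have cm: "continuous_on UNIV (\<lambda>t. c t ^ m)" by (intro continuous_intros c_cont)
    have [measurable]: "(\<lambda>t. c t ^ m) \<in> borel_measurable borel"
      by (rule borel_measurable_continuous_onI[OF cm])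
    have "(\<integral>t. c t ^ m \<partial>N n) = (\<Sum>k\<le>n. w n k * (real k / real n) ^ m)" for n
      by (subst intN) (auto simp: c01 divide_le_eq intro!: sum.cong)
    moreover have "(\<lambda>n. \<integral>t. c t ^ m \<partial>N (r n)) \<longlonglongrightarrow> (\<integral>t. c t ^ m \<partial>M)"
      by (rule lim[OF cm, of 1]) (simp add: c01 power_le_one)
    ultimately have "(\<integral>t. c t ^ m \<partial>M) = q m 0"
      using LIMSEQ_subseq_LIMSEQ[OF moment r, of m] by (auto simp: o_def intro: LIMSEQ_unique)
    moreover have "(\<integral>t. c t ^ m \<partial>M) = (\<integral>t. t ^ m \<partial>M)"
    proof (rule integral_cong_AE)
      show "AE t in M. c t ^ m = t ^ m"
        using supp by eventually_elim (simp add: c01(3))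
    qed auto
    ultimately show ?thesis by simp
  qed
  ultimately show ?thesis using M by blast
qed

section \<open>Functionals determined by their moments\<close>

definition bounded_borel :: "(real \<Rightarrow> real) \<Rightarrow> bool" where
  "bounded_borel f \<longleftrightarrow> f \<in> borel_measurable borel \<and> (\<exists>B. \<forall>t. \<bar>f t\<bar> \<le> B)"

lemma bounded_borelI: "f \<in> borel_measurable borel \<Longrightarrow> (\<And>t. \<bar>f t\<bar> \<le> B) \<Longrightarrow> bounded_borel f"
  by (auto simp: bounded_borel_def)

lemma bounded_borel_measurable: "bounded_borel f \<Longrightarrow> f \<in> borel_measurable borel"
  by (simp add: bounded_borel_def)

lemma bounded_borel_const [simp, intro]: "bounded_borel (\<lambda>t. c)"
  by (rule bounded_borelI[of _ "\<bar>c\<bar>"]) auto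

lemma bounded_borel_indicator [intro]: "A \<in> sets borel \<Longrightarrow> bounded_borel (indicator A)"
  by (rule bounded_borelI[of _ 1]) (auto simp: indicator_def)

lemma bounded_borel_add [intro]:
  assumes "bounded_borel f" "bounded_borel g" shows "bounded_borel (\<lambda>t. f t + g t)"
proof -
  obtain B C where B: "\<And>t. \<bar>f t\<bar> \<le> B" "\<And>t. \<bar>g t\<bar> \<le> C"
    using assms by (auto simp: bounded_borel_def)
  show ?thesis
    using assms B by (intro bounded_borelI[of _ "B + C"])
      (auto simp: bounded_borel_def intro: order_trans[OF abs_triangle_ineq add_mono])
qed

lemma bounded_borel_mult [intro]:
  assumes "bounded_borel f" "bounded_borel g" shows "bounded_borel (\<lambda>t. f t * g t)"
proof -
  obtain B C where B: "\<And>t. \<bar>f t\<bar> \<le> B" "\<And>t. \<bar>g t\<bar> \<le> C"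
    using assms by (auto simp: bounded_borel_def)
  show ?thesis
    using assms B by (intro bounded_borelI[of _ "B * C"])
      (auto simp: bounded_borel_def abs_mult intro!: mult_mono order_trans[OF abs_ge_zero B(1)])
qed

lemma bounded_borel_uminus [intro]: "bounded_borel f \<Longrightarrow> bounded_borel (\<lambda>t. - f t)"
  using bounded_borel_mult[of "\<lambda>_. -1" f] by simp

lemma bounded_borel_diff [intro]:
  assumes "bounded_borel f" "bounded_borel g" shows "bounded_borel (\<lambda>t. f t - g t)"
  using bounded_borel_add[OF assms(1) bounded_borel_uminus[OF assms(2)]] by simp

text \<open>
  The signed measures on \<open>[0, 1]\<close>, as functionals: differences of finite measures satisfy this, and
  unlike measures such functionals can be subtracted freely.
\<close>

definition sigma_functional :: "((real \<Rightarrow> real) \<Rightarrow> real) \<Rightarrow> bool" where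
  "sigma_functional F \<longleftrightarrow>
     (\<forall>f g. bounded_borel f \<longrightarrow> bounded_borel g \<longrightarrow> F (\<lambda>t. f t + g t) = F f + F g) \<and>
     (\<forall>c f. bounded_borel f \<longrightarrow> F (\<lambda>t. c * f t) = c * F f) \<and>
     (\<forall>f g. (\<forall>t\<in>{0..1}. f t = g t) \<longrightarrow> F f = F g) \<and>
     (\<forall>u f B. (\<forall>n. u n \<in> borel_measurable borel) \<longrightarrow> (\<forall>n t. \<bar>u n t\<bar> \<le> B) \<longrightarrow>
        (\<forall>t. (\<lambda>n. u n t) \<longlonglongrightarrow> f t) \<longrightarrow> (\<lambda>n. F (u n)) \<longlonglongrightarrow> F f)"

lemma
  assumes "sigma_functional F"
  shows sigma_functional_add: "bounded_borel f \<Longrightarrow> bounded_borel g \<Longrightarrow> F (\<lambda>t. f t + g t) = F f + F g"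
    and sigma_functional_cmult: "bounded_borel f \<Longrightarrow> F (\<lambda>t. c * f t) = c * F f"
    and sigma_functional_cong: "(\<And>t. t \<in> {0..1} \<Longrightarrow> f t = g t) \<Longrightarrow> F f = F g"
    and sigma_functional_lim: "(\<And>n. u n \<in> borel_measurable borel) \<Longrightarrow> (\<And>n t. \<bar>u n t\<bar> \<le> B) \<Longrightarrow>
      (\<And>t. (\<lambda>n. u n t) \<longlonglongrightarrow> f t) \<Longrightarrow> (\<lambda>n. F (u n)) \<longlonglongrightarrow> F f"
  using assms unfolding sigma_functional_def by blast+

lemma sigma_functional_plus [intro]:
  assumes F: "sigma_functional F" and G: "sigma_functional G"
  shows "sigma_functional (\<lambda>f. F f + G f)"
  unfolding sigma_functional_def
proof (intro conjI allI impI)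
  fix f g :: "real \<Rightarrow> real" assume "\<forall>t\<in>{0..1}. f t = g t"
  then show "F f + G f = F g + G g"
    using sigma_functional_cong[OF F, of f g] sigma_functional_cong[OF G, of f g] by simp
next
  fix u :: "nat \<Rightarrow> real \<Rightarrow> real" and f B
  assume "\<forall>n. u n \<in> borel_measurable borel" "\<forall>n t. \<bar>u n t\<bar> \<le> B" "\<forall>t. (\<lambda>n. u n t) \<longlonglongrightarrow> f t"
  then show "(\<lambda>n. F (u n) + G (u n)) \<longlonglongrightarrow> F f + G f"
    by (intro tendsto_add sigma_functional_lim[OF F, of u B f] sigma_functional_lim[OF G, of u B f]) blast+
qed (simp_all add: sigma_functional_add[OF F] sigma_functional_add[OF G]
    sigma_functional_cmult[OF F] sigma_functional_cmult[OF G] distrib_left)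

lemma sigma_functional_scale [intro]:
  assumes F: "sigma_functional F" shows "sigma_functional (\<lambda>f. c * F f)"
  unfolding sigma_functional_def
proof (intro conjI allI impI)
  fix f g :: "real \<Rightarrow> real" assume "\<forall>t\<in>{0..1}. f t = g t"
  then show "c * F f = c * F g"
    using sigma_functional_cong[OF F, of f g] by simp
next
  fix u :: "nat \<Rightarrow> real \<Rightarrow> real" and f B
  assume "\<forall>n. u n \<in> borel_measurable borel" "\<forall>n t. \<bar>u n t\<bar> \<le> B" "\<forall>t. (\<lambda>n. u n t) \<longlonglongrightarrow> f t"
  then show "(\<lambda>n. c * F (u n)) \<longlonglongrightarrow> c * F f"
    by (intro tendsto_mult tendsto_const sigma_functional_lim[OF F, of u B f]) blast+
qed (simp_all add: sigma_functional_add[OF F] sigma_functional_cmult[OF F] distrib_left)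

lemma sigma_functional_minus [intro]:
  assumes "sigma_functional F" "sigma_functional G" shows "sigma_functional (\<lambda>f. F f - G f)"
  using sigma_functional_plus[OF assms(1) sigma_functional_scale[OF assms(2), of "-1"]] by simp

lemma sigma_functional_mult [intro]:
  assumes F: "sigma_functional F" and g: "bounded_borel g"
  shows "sigma_functional (\<lambda>f. F (\<lambda>t. g t * f t))"
  unfolding sigma_functional_def
proof (intro conjI allI impI)
  fix f h :: "real \<Rightarrow> real" assume "bounded_borel f" "bounded_borel h"
  then show "F (\<lambda>t. g t * (f t + h t)) = F (\<lambda>t. g t * f t) + F (\<lambda>t. g t * h t)"
    using sigma_functional_add[OF F, of "\<lambda>t. g t * f t" "\<lambda>t. g t * h t"] g
    by (auto simp: distrib_left)
next
  fix c and f :: "real \<Rightarrow> real" assume "bounded_borel f"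
  then show "F (\<lambda>t. g t * (c * f t)) = c * F (\<lambda>t. g t * f t)"
    using sigma_functional_cmult[OF F, of "\<lambda>t. g t * f t" c] g by (auto simp: mult.left_commute)
next
  fix f h :: "real \<Rightarrow> real" assume "\<forall>t\<in>{0..1}. f t = h t"
  then show "F (\<lambda>t. g t * f t) = F (\<lambda>t. g t * h t)"
    by (intro sigma_functional_cong[OF F]) auto
next
  fix u :: "nat \<Rightarrow> real \<Rightarrow> real" and f B
  assume u: "\<forall>n. u n \<in> borel_measurable borel" "\<forall>n t. \<bar>u n t\<bar> \<le> B" "\<forall>t. (\<lambda>n. u n t) \<longlonglongrightarrow> f t"
  obtain C where C: "\<And>t. \<bar>g t\<bar> \<le> C" using g by (auto simp: bounded_borel_def)
  have [measurable]: "g \<in> borel_measurable borel" using g by (rule bounded_borel_measurable)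
  show "(\<lambda>n. F (\<lambda>t. g t * u n t)) \<longlonglongrightarrow> F (\<lambda>t. g t * f t)"
  proof (rule sigma_functional_lim[OF F, of _ "C * B"])
    show "(\<lambda>t. g t * u n t) \<in> borel_measurable borel" for n using u(1)[rule_format, of n] by measurable
    show "\<bar>g t * u n t\<bar> \<le> C * B" for n t
      unfolding abs_mult using u(2) C by (intro mult_mono) (auto intro: order_trans[OF abs_ge_zero])
    show "(\<lambda>n. g t * u n t) \<longlonglongrightarrow> g t * f t" for t
      using u(3) by (auto intro: tendsto_intros)
  qed
qed

lemma sigma_functional_measure:
  assumes "finite_measure M" "sets M = sets borel"
  shows "sigma_functional (\<lambda>f. \<integral>t. indicator {0..1} t * f t \<partial>M)"
proof -
  interpret finite_measure M by fact
  note [measurable_cong] = assms(2)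
  have int: "integrable M (\<lambda>t. indicator {0..1} t * f t)" if bf: "bounded_borel f" for f
  proof -
    obtain B where B: "\<And>t. \<bar>f t\<bar> \<le> B" using bf by (auto simp: bounded_borel_def)
    have [measurable]: "f \<in> borel_measurable borel" using bf by (rule bounded_borel_measurable)
    have "0 \<le> B" using B[of 0] by linarith
    with B show ?thesis
      by (intro integrable_const_bound[of _ B]) (auto simp: indicator_def)
  qed
  show ?thesis
    unfolding sigma_functional_def
  proof (intro conjI allI impI)
    fix f g :: "real \<Rightarrow> real" assume "bounded_borel f" "bounded_borel g"
    then show "(\<integral>t. indicator {0..1} t * (f t + g t) \<partial>M)
        = (\<integral>t. indicator {0..1} t * f t \<partial>M) + (\<integral>t. indicator {0..1} t * g t \<partial>M)"
      by (simp add: distrib_left int)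
  next
    fix c and f :: "real \<Rightarrow> real"
    show "(\<integral>t. indicator {0..1} t * (c * f t) \<partial>M) = c * (\<integral>t. indicator {0..1} t * f t \<partial>M)"
      by (simp add: mult.left_commute)
  next
    fix f g :: "real \<Rightarrow> real" assume "\<forall>t\<in>{0..1}. f t = g t"
    then show "(\<integral>t. indicator {0..1} t * f t \<partial>M) = (\<integral>t. indicator {0..1} t * g t \<partial>M)"
      by (intro Bochner_Integration.integral_cong refl) (auto simp: indicator_def)
  next
    fix u :: "nat \<Rightarrow> real \<Rightarrow> real" and f B
    assume u: "\<forall>n. u n \<in> borel_measurable borel" "\<forall>n t. \<bar>u n t\<bar> \<le> B" "\<forall>t. (\<lambda>n. u n t) \<longlonglongrightarrow> f t"
    have [measurable]: "u n \<in> borel_measurable borel" for n using u by blast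
    have [measurable]: "f \<in> borel_measurable borel"
      by (rule borel_measurable_LIMSEQ_real[where u = u]) (use u in auto)
    have B: "0 \<le> B" using u(2)[rule_format, of 0 0] by linarith
    show "(\<lambda>n. \<integral>t. indicator {0..1} t * u n t \<partial>M) \<longlonglongrightarrow> (\<integral>t. indicator {0..1} t * f t \<partial>M)"
      by (rule integral_dominated_convergence[where w = "\<lambda>_. B"])
        (use u B in \<open>auto simp: indicator_def\<close>)
  qed
qed

lemma sigma_functional_sum:
  assumes "sigma_functional F" "finite I" "\<And>i. i \<in> I \<Longrightarrow> bounded_borel (f i)"
  shows "F (\<lambda>t. \<Sum>i\<in>I. f i t) = (\<Sum>i\<in>I. F (f i)) \<and> bounded_borel (\<lambda>t. \<Sum>i\<in>I. f i t)"
  using assms(2,3)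
proof (induction I rule: finite_induct)
  case empty
  show ?case using sigma_functional_cmult[OF assms(1), of "\<lambda>_. 0" 0] by simp
next
  case (insert i I)
  then show ?case
    using sigma_functional_add[OF assms(1), of "f i" "\<lambda>t. \<Sum>i\<in>I. f i t"] by auto
qed

definition unit_monomial :: "nat \<Rightarrow> real \<Rightarrow> real" where
  "unit_monomial m t = indicator {0..1} t * t ^ m"

lemma bounded_borel_unit_monomial [intro, simp]: "bounded_borel (unit_monomial m)"
  by (rule bounded_borelI[of _ 1])
    (auto simp: unit_monomial_def[abs_def] indicator_def power_le_one)

text \<open>
  Vanishing spreads from the monomials to polynomials, by Weierstrass approximation to continuous
  functions, by pointwise limits to half-lines, and by Dynkin's argument to all Borel sets.
\<close>

proposition moments_determine_functional:
  assumes F: "sigma_functional F" and zero: "\<And>m. F (unit_monomial m) = 0" and A: "A \<in> sets borel"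
  shows "F (indicator A) = 0"
proof -
  have poly: "F (\<lambda>t. indicator {0..1} t * g t) = 0" if pg: "real_polynomial_function g" for g
  proof -
    obtain a n where "g = (\<lambda>x. \<Sum>i\<le>n. a i * x ^ i)"
      using pg unfolding real_polynomial_function_iff_sum by blast
    then have "(\<lambda>t. indicator {0..1} t * g t) = (\<lambda>t. \<Sum>i\<le>n. a i * unit_monomial i t)"
      by (auto simp: unit_monomial_def sum_distrib_left ac_simps)
    then show ?thesis
      using sigma_functional_sum[OF F, of "{..n}" "\<lambda>i t. a i * unit_monomial i t"]
      by (simp add: sigma_functional_cmult[OF F] zero bounded_borel_mult)
  qed
  have cont: "F f = 0" if f: "continuous_on UNIV f" for f
  proof -
    have "\<exists>g. real_polynomial_function g \<and> (\<forall>x\<in>{0..1}. \<bar>f x - g x\<bar> < 1 / real (Suc n))" for n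
      by (rule Stone_Weierstrass_real_polynomial_function[of "{0..1}" f "1 / real (Suc n)"])
        (use f continuous_on_subset in auto)
    then obtain g where g: "\<And>n. real_polynomial_function (g n)"
      "\<And>n x. x \<in> {0..1} \<Longrightarrow> \<bar>f x - g n x\<bar> < 1 / real (Suc n)"
      by metis
    have "compact (f ` {0..1})"
      using f by (intro compact_continuous_image) (auto intro: continuous_on_subset)
    then obtain B where B: "\<And>x. x \<in> {0..1} \<Longrightarrow> \<bar>f x\<bar> \<le> B"
      using compact_imp_bounded bounded_iff by (metis imageI real_norm_def)
    have "0 \<le> B" using B[of 0] by auto
    have gB: "\<bar>indicator {0..1} t * g n t\<bar> \<le> B + 1" for n t
    proof (cases "t \<in> {0..1}")
      case True
      have "1 / real (Suc n) \<le> 1" by simp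
      then have "\<bar>g n t\<bar> \<le> B + 1" using B[OF True] g(2)[OF True, of n] by argo
      then show ?thesis using True by simp
    qed (use \<open>0 \<le> B\<close> in auto)
    have "(\<lambda>n. g n t) \<longlonglongrightarrow> f t" if "t \<in> {0..1}" for t
    proof -
      have "(\<lambda>n. f t - g n t) \<longlonglongrightarrow> 0"
      proof (rule Lim_null_comparison)
        show "\<forall>\<^sub>F n in sequentially. norm (f t - g n t) \<le> 1 / real (Suc n)"
          using g(2)[OF that] by (intro always_eventually allI) (simp add: less_imp_le del: of_nat_Suc)
      qed (rule LIMSEQ_Suc[OF lim_1_over_n])
      then show ?thesis
        using tendsto_diff[OF tendsto_const, of _ 0 _ "f t"] by fastforce
    qed
    then have "(\<lambda>n. indicator {0..1} t * g n t) \<longlonglongrightarrow> indicator {0..1} t * f t" for t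
      by (cases "t \<in> {0..1}") auto
    then have "(\<lambda>n. F (\<lambda>t. indicator {0..1} t * g n t)) \<longlonglongrightarrow> F (\<lambda>t. indicator {0..1} t * f t)"
    proof (intro sigma_functional_lim[OF F, of _ "B + 1"] gB)
      have "g n \<in> borel_measurable borel" for n
        using continuous_real_polymonial_function[OF g(1)]
        by (intro borel_measurable_continuous_onI continuous_at_imp_continuous_on) auto
      then show "(\<lambda>t. indicator {0..1} t * g n t) \<in> borel_measurable borel" for n
        by measurable
    qed
    then have "F (\<lambda>t. indicator {0..1} t * f t) = 0"
      by (simp add: poly g(1) LIMSEQ_const_iff)
    then show ?thesis
      using sigma_functional_cong[OF F, of "\<lambda>t. indicator {0..1} t * f t" f] by simp
  qed
  have atMost: "F (indicator {..a}) = 0" for a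
  proof -
    define u where "u n t = max 0 (min 1 (1 - real n * (t - a)))" for n t
    have "(\<lambda>n. u n t) \<longlonglongrightarrow> indicator {..a} t" for t
    proof (cases "t \<le> a")
      case True
      then have "u n t = 1" for n by (auto simp: u_def max_def min_def mult_le_0_iff)
      with True show ?thesis by simp
    next
      case False
      then obtain N where N: "1 \<le> real N * (t - a)"
        using reals_Archimedean3[of "t - a"] by (metis diff_gt_0_iff_gt less_imp_le not_le)
      have "u n t = 0" if "N \<le> n" for n
      proof -
        have "real N * (t - a) \<le> real n * (t - a)"
          using False that by (intro mult_right_mono) auto
        with N show ?thesis by (auto simp: u_def max_def min_def)
      qed
      then have "\<forall>\<^sub>F n in sequentially. u n t = 0"
        by (auto simp: eventually_sequentially)
      with False show ?thesis by (auto intro: tendsto_eventually)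
    qed
    then have "(\<lambda>n. F (u n)) \<longlonglongrightarrow> F (indicator {..a})"
      by (intro sigma_functional_lim[OF F, of _ 1]) (auto simp: u_def[abs_def])
    moreover have "F (u n) = 0" for n
      unfolding u_def[abs_def] by (intro cont continuous_intros)
    ultimately show ?thesis by (simp add: LIMSEQ_const_iff)
  qed
  have sets: "sets borel = sigma_sets UNIV (range (\<lambda>a::real. {..a}))"
    by (subst borel_eq_atMost) simp
  have "Int_stable (range (\<lambda>a::real. {..a}))" "range (\<lambda>a::real. {..a}) \<subseteq> Pow UNIV"
    by (auto simp: Int_stable_def)
  then show ?thesis
    using A unfolding sets
  proof (induction A rule: sigma_sets_induct_disjoint)
    case (basic A)
    then show ?case using atMost by auto
  next
    case empty
    show ?case using cont[of "\<lambda>_. 0"] by (simp add: indicator_def[abs_def])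
  next
    case (compl A)
    then have "A \<in> sets borel" by (simp add: sets)
    have "F (\<lambda>t. 1 + - 1 * indicator A t) = F (\<lambda>t. 1) + F (\<lambda>t. - 1 * indicator A t)"
      using \<open>A \<in> sets borel\<close> by (intro sigma_functional_add[OF F]) auto
    also have "\<dots> = 0"
      using cont[of "\<lambda>_. 1"] sigma_functional_cmult[OF F bounded_borel_indicator[OF \<open>A \<in> sets borel\<close>], of "-1"] compl
      by simp
    also have "(\<lambda>t. 1 + - 1 * indicator A t :: real) = indicator (UNIV - A)"
      by (auto simp: indicator_def)
    finally show ?case .
  next
    case (union A)
    then have A: "A i \<in> sets borel" for i by (auto simp: sets)
    have sum_eq: "(\<Sum>i<n. indicator (A i) t) = (indicator (\<Union>i<n. A i) t :: real)" for n t
      using union(1) by (subst indicator_UN_disjoint) (auto simp: disjoint_family_on_def)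
    have "(\<lambda>n. F (\<lambda>t. \<Sum>i<n. indicator (A i) t)) \<longlonglongrightarrow> F (indicator (\<Union>i. A i))"
    proof (rule sigma_functional_lim[OF F, of _ 1])
      show "(\<lambda>t. \<Sum>i<n. indicator (A i) t :: real) \<in> borel_measurable borel" for n
        using A by measurable
      show "\<bar>\<Sum>i<n. indicator (A i) t\<bar> \<le> (1::real)" for n t
        unfolding sum_eq by (simp add: indicator_def)
      show "(\<lambda>n. \<Sum>i<n. indicator (A i) t) \<longlonglongrightarrow> (indicator (\<Union>i. A i) t :: real)" for t
        unfolding sum_eq by (rule LIMSEQ_indicator_UN)
    qed
    moreover have "F (\<lambda>t. \<Sum>i<n. indicator (A i) t) = 0" for n
      using sigma_functional_sum[OF F, of "{..<n}" "\<lambda>i. indicator (A i)"] A union(3) by auto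
    ultimately show ?case by (simp add: LIMSEQ_const_iff)
  qed
qed

section \<open>Bounded functional calculus of a projection-valued measure\<close>

lemma inner_eq_imp_eq:
  fixes u v :: "'a::real_inner"
  assumes "\<And>y. y \<bullet> u = y \<bullet> v" shows "u = v"
  using assms[of "u - v"] by (metis eq_iff_diff_eq_0 inner_diff_right inner_eq_zero_iff)

text \<open>
  Polarisation. Through this lemma, identities between operators reduce to identities between
  scalar integrals.
\<close>

lemma symmetric_diag_eq:
  fixes T U :: "'a::real_inner \<Rightarrow>\<^sub>L 'a"
  assumes T: "\<And>x y. T x \<bullet> y = x \<bullet> T y" and U: "\<And>x y. U x \<bullet> y = x \<bullet> U y"
    and diag: "\<And>x. x \<bullet> T x = x \<bullet> U x"
  shows "T = U"
proof (rule blinfun_eqI, rule inner_eq_imp_eq)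
  fix x y
  have "(y + x) \<bullet> T (y + x) = (y + x) \<bullet> U (y + x)" by (rule diag)
  then show "y \<bullet> T x = y \<bullet> U x"
    using diag[of x] diag[of y] T[of x y] U[of x y]
    by (simp add: inner_add_left inner_add_right blinfun.add_right inner_commute)
qed

lemma norm_blinfun_leI:
  fixes T :: "'a::real_normed_vector \<Rightarrow>\<^sub>L 'c::real_normed_vector"
  assumes "0 \<le> C" "\<And>x. norm (T x) \<le> C * norm x" shows "norm T \<le> C"
  using assms by (intro norm_blinfun_bound) (auto simp: mult.commute)

locale pvm =
  fixes E :: "real set \<Rightarrow> 'b::brane L2 \<Rightarrow>\<^sub>L 'b L2"
  assumes pvm: "projection_valued_measure E"
begin

lemma E_sym: "A \<in> sets borel \<Longrightarrow> E A x \<bullet> y = x \<bullet> E A y"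
  using pvm by (simp add: projection_valued_measure_def inner_L2_def)

lemma E_Int: "A \<in> sets borel \<Longrightarrow> B \<in> sets borel \<Longrightarrow> E A (E B x) = E (A \<inter> B) x"
  using pvm by (simp add: projection_valued_measure_def)

lemma E_empty [simp]: "E {} = 0" and E_UNIV [simp]: "E UNIV = id_blinfun"
  using pvm by (simp_all add: projection_valued_measure_def)

lemma E_sums:
  "range A \<subseteq> sets borel \<Longrightarrow> disjoint_family A \<Longrightarrow> (\<lambda>n::nat. E (A n) x) sums E (\<Union>n. A n) x"
  using pvm unfolding projection_valued_measure_def by blast

lemma E_inner: "A \<in> sets borel \<Longrightarrow> x \<bullet> E A x = (norm (E A x))\<^sup>2"
  using E_sym[of A x "E A x"] E_Int[of A A x] by (simp add: power2_norm_eq_inner)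

lemma E_Un:
  assumes "A \<in> sets borel" "B \<in> sets borel" "A \<inter> B = {}"
  shows "E (A \<union> B) x = E A x + E B x"
proof -
  define C where "C n = (if n = 0 then A else if n = 1 then B else {})" for n :: nat
  have un: "(\<Union>n. C n) = A \<union> B" by (auto simp: C_def split: if_splits)
  have "(\<lambda>n. E (C n) x) sums E (\<Union>n. C n) x"
    using assms by (intro E_sums) (auto simp: C_def disjoint_family_on_def)
  moreover have "(\<lambda>n. E (C n) x) sums (\<Sum>n\<in>{0,1}. E (C n) x)"
    by (rule sums_finite) (auto simp: C_def)
  ultimately have "E (\<Union>n. C n) x = (\<Sum>n\<in>{0,1}. E (C n) x)"
    by (rule sums_unique2)
  then show ?thesis by (simp add: un) (simp add: C_def)
qed

lemma E_UN:
  assumes "finite I" "\<And>i. i \<in> I \<Longrightarrow> A i \<in> sets borel" "disjoint_family_on A I"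
  shows "E (\<Union>i\<in>I. A i) x = (\<Sum>i\<in>I. E (A i) x)"
  using assms
proof (induction I rule: finite_induct)
  case (insert i I)
  then have "A i \<inter> (\<Union>i\<in>I. A i) = {}" by (auto simp: disjoint_family_on_def)
  moreover have "(\<Union>i\<in>I. A i) \<in> sets borel" using insert by auto
  ultimately have "E (A i \<union> (\<Union>i\<in>I. A i)) x = E (A i) x + E (\<Union>i\<in>I. A i) x"
    using insert by (intro E_Un) auto
  then show ?case
    using insert by (simp add: disjoint_family_on_def)
qed simp

abbreviation "W \<equiv> spectral_weight E"

lemma sets_W [simp, measurable_cong]: "sets (W x) = sets borel"
  by (simp add: spectral_weight_def sets_measure_of_conv)
    (metis sets.sigma_sets_eq space_borel)

lemma space_W [simp]: "space (W x) = UNIV"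
  by (simp add: spectral_weight_def space_measure_of_conv)

lemma emeasure_W: assumes A: "A \<in> sets borel" shows "emeasure (W x) A = ennreal (x \<bullet> E A x)"
proof -
  have "emeasure (W x) A = ennreal (Re (cinner x (E A x)))"
  proof (rule emeasure_measure_of[OF spectral_weight_def])
    show "positive (sets (W x)) (\<lambda>A. ennreal (Re (cinner x (E A x))))"
      by (simp add: positive_def inner_L2_def[symmetric])
    show "countably_additive (sets (W x)) (\<lambda>A. ennreal (Re (cinner x (E A x))))"
      unfolding inner_L2_def[symmetric]
    proof (rule countably_additiveI)
      fix A :: "nat \<Rightarrow> real set"
      assume "range A \<subseteq> sets (W x)" "disjoint_family A"
      then have A: "range A \<subseteq> sets borel" "disjoint_family A" by auto
      then show "(\<Sum>i. ennreal (x \<bullet> E (A i) x)) = ennreal (x \<bullet> E (\<Union>i. A i) x)"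
        using E_inner
        by (intro suminf_ennreal_eq bounded_linear.sums[OF bounded_linear_inner_right] E_sums)
          (auto simp: range_subsetD)
    qed
  qed (use A in auto)
  then show ?thesis by (simp add: inner_L2_def)
qed

lemma measure_W: "A \<in> sets borel \<Longrightarrow> measure (W x) A = x \<bullet> E A x"
  by (simp add: measure_def emeasure_W E_inner)

lemma finite_measure_W: "finite_measure (W x)"
  by (rule finite_measureI) (simp add: emeasure_W)

sublocale W: finite_measure "W x" for x by (rule finite_measure_W)

lemma measure_W_UNIV: "measure (W x) UNIV = (norm x)\<^sup>2"
  by (simp add: measure_W power2_norm_eq_inner)

lemma W_integrable: assumes f: "bounded_borel f" shows "integrable (W x) f"
proof -
  obtain B where "\<And>t. \<bar>f t\<bar> \<le> B" using f by (auto simp: bounded_borel_def)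
  then show ?thesis
    using bounded_borel_measurable[OF f] by (intro W.integrable_const_bound[of _ B]) auto
qed

subsection \<open>Simple functions\<close>

abbreviation "S \<equiv> simple_spectral_integral E"

lemma simple_borel_sets: assumes "simple_function borel h" shows "h -` {c} \<in> sets borel"
proof (cases "c \<in> range h")
  case False
  then have "h -` {c} = {}" by auto
  then show ?thesis by simp
qed (use assms in \<open>auto simp: simple_function_def\<close>)

lemma simple_bounded_borel:
  fixes h :: "real \<Rightarrow> real"
  assumes "simple_function borel h" shows "bounded_borel h"
proof -
  have "finite (range (\<lambda>t. \<bar>h t\<bar>))"
    using assms by (auto simp: simple_function_def dest: finite_imageI[of _ abs] simp: image_image)
  then have "\<bar>h t\<bar> \<le> Max (range (\<lambda>t. \<bar>h t\<bar>))" for t by simp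
  then show ?thesis
    using assms by (intro bounded_borelI borel_measurable_simple_function) auto
qed

text \<open>
  Refining the level sets of \<open>h\<close> to those of \<open>p\<close> lets several simple functions be handled over a
  common partition.
\<close>

lemma S_partition:
  assumes p: "simple_function borel p" and h: "\<And>t. h t = \<phi> (p t)"
  shows "S h x = (\<Sum>v\<in>range p. \<phi> v *\<^sub>R E (p -` {v}) x)"
proof -
  have fin: "finite (range p)" using p by (simp add: simple_function_def)
  have rng: "range h = \<phi> ` range p" by (auto simp: h)
  have "E (h -` {c}) x = (\<Sum>v\<in>{v\<in>range p. \<phi> v = c}. E (p -` {v}) x)" for c
  proof -
    have "h -` {c} = (\<Union>v\<in>{v\<in>range p. \<phi> v = c}. p -` {v})" by (auto simp: h)
    then show ?thesis
      using fin simple_borel_sets[OF p] by (simp only:) (rule E_UN, auto simp: disjoint_family_on_def)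
  qed
  then have "S h x = (\<Sum>c\<in>\<phi> ` range p. \<Sum>v\<in>{v\<in>range p. \<phi> v = c}. \<phi> v *\<^sub>R E (p -` {v}) x)"
    by (simp add: simple_spectral_integral_def rng scaleR_sum_right)
  also have "\<dots> = (\<Sum>v\<in>range p. \<phi> v *\<^sub>R E (p -` {v}) x)"
    using fin by (rule sum.image_gen[symmetric])
  finally show ?thesis .
qed

lemma
  assumes h: "simple_function borel h" and g: "simple_function borel g"
  shows S_diff: "S (\<lambda>t. h t - g t) x = S h x - S g x"
    and S_mult: "S h (S g x) = S (\<lambda>t. h t * g t) x"
proof -
  let ?p = "\<lambda>t. (h t, g t)"
  have p: "simple_function borel ?p" using h g by (rule simple_function_Pair)
  note part = S_partition[OF p]
  have hs: "S h x = (\<Sum>v\<in>range ?p. fst v *\<^sub>R E (?p -` {v}) x)" for x by (rule part) simp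
  have gs: "S g x = (\<Sum>v\<in>range ?p. snd v *\<^sub>R E (?p -` {v}) x)" for x by (rule part) simp
  have ds: "S (\<lambda>t. h t - g t) x = (\<Sum>v\<in>range ?p. (fst v - snd v) *\<^sub>R E (?p -` {v}) x)"
    by (rule part) simp
  have ms: "S (\<lambda>t. h t * g t) x = (\<Sum>v\<in>range ?p. (fst v * snd v) *\<^sub>R E (?p -` {v}) x)"
    by (rule part) simp
  show "S (\<lambda>t. h t - g t) x = S h x - S g x"
    by (simp add: hs gs ds scaleR_diff_left sum_subtractf)
  have fin: "finite (range ?p)" using p by (simp add: simple_function_def)
  have orth: "E (?p -` {v}) (E (?p -` {w}) x) = (if w = v then E (?p -` {v}) x else 0)" for v w
  proof -
    have "?p -` {v} \<inter> ?p -` {w} = (if w = v then ?p -` {v} else {})" by auto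
    then show ?thesis
      using E_Int[OF simple_borel_sets[OF p] simple_borel_sets[OF p], of v w x] by simp
  qed
  have "S h (S g x) = (\<Sum>v\<in>range ?p. fst v *\<^sub>R E (?p -` {v}) (S g x))" by (rule hs)
  also have "\<dots> = (\<Sum>v\<in>range ?p. \<Sum>w\<in>range ?p. fst v *\<^sub>R snd w *\<^sub>R E (?p -` {v}) (E (?p -` {w}) x))"
    by (simp only: gs blinfun.sum_right blinfun.scaleR_right scaleR_sum_right)
  also have "\<dots> = (\<Sum>v\<in>range ?p. \<Sum>w\<in>range ?p. if w = v then (fst v * snd v) *\<^sub>R E (?p -` {v}) x else 0)"
    unfolding orth by (intro sum.cong refl) auto
  also have "\<dots> = S (\<lambda>t. h t * g t) x"
    unfolding ms using fin by (intro sum.cong refl) simp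
  finally show "S h (S g x) = S (\<lambda>t. h t * g t) x" .
qed

lemma S_sym: "simple_function borel h \<Longrightarrow> S h x \<bullet> y = x \<bullet> S h y"
  by (simp add: simple_spectral_integral_def inner_sum_left inner_sum_right E_sym simple_borel_sets)

lemma S_inner:
  assumes h: "simple_function borel h"
  shows "x \<bullet> S h x = (\<integral>t. h t \<partial>W x)"
proof -
  have "simple_function (W x) h" using h by (simp add: simple_function_def)
  then have "Bochner_Integration.simple_bochner_integrable (W x) h"
    by (intro simple_bochner_integrable.intros) auto
  then have "(\<integral>t. h t \<partial>W x) = Bochner_Integration.simple_bochner_integral (W x) h"
    by (simp add: simple_bochner_integrable_eq_integral)
  also have "\<dots> = (\<Sum>c\<in>range h. c * measure (W x) (h -` {c}))"
    by (simp add: simple_bochner_integral_def vimage_def mult.commute)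
  also have "\<dots> = x \<bullet> S h x"
    by (simp add: simple_spectral_integral_def inner_sum_right measure_W simple_borel_sets[OF h])
  finally show ?thesis by simp
qed

lemma S_norm:
  assumes h: "simple_function borel h"
  shows "(norm (S h x))\<^sup>2 = (\<integral>t. (h t)\<^sup>2 \<partial>W x)"
proof -
  have "(norm (S h x))\<^sup>2 = x \<bullet> S (\<lambda>t. h t * h t) x"
    by (simp add: power2_norm_eq_inner S_sym[OF h] S_mult[OF h h])
  also have "\<dots> = (\<integral>t. h t * h t \<partial>W x)"
    using h by (intro S_inner simple_function_mult)
  finally show ?thesis by (simp add: power2_eq_square)
qed

lemma integral_W_le:
  assumes "bounded_borel f" "\<And>t. f t \<le> C"
  shows "(\<integral>t. f t \<partial>W x) \<le> C * (norm x)\<^sup>2"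
proof -
  have "(\<integral>t. f t \<partial>W x) \<le> (\<integral>t. C \<partial>W x)"
    using assms by (intro integral_mono W_integrable) auto
  then show ?thesis by (simp add: measure_W_UNIV mult.commute)
qed

lemma S_bound:
  assumes h: "simple_function borel h" and C: "0 \<le> C" "\<And>t. \<bar>h t\<bar> \<le> C"
  shows "norm (S h x) \<le> C * norm x"
proof -
  have "(h t)\<^sup>2 \<le> C\<^sup>2" for t
    using C(2)[of t] by (metis abs_ge_zero power2_abs power_mono)
  then have "(norm (S h x))\<^sup>2 \<le> C\<^sup>2 * (norm x)\<^sup>2"
    unfolding S_norm[OF h]
    using bounded_borel_mult[OF simple_bounded_borel[OF h] simple_bounded_borel[OF h]]
    by (intro integral_W_le) (auto simp: power2_eq_square)
  then have "(norm (S h x))\<^sup>2 \<le> (C * norm x)\<^sup>2" by (simp add: power_mult_distrib)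
  then show ?thesis by (rule power2_le_imp_le) (use C(1) in simp)
qed

lemma S_bounded_linear: "bounded_linear (S h)"
  unfolding simple_spectral_integral_def[abs_def]
  by (rule bounded_linear_sum,
      rule bounded_linear_compose[OF bounded_linear_scaleR_right blinfun.bounded_linear_right])

subsection \<open>Bounded Borel functions\<close>

text \<open>
  Rounding down to multiples of \<open>2\<^sup>-\<^sup>n\<close> approximates any function uniformly, and gives a simple
  function when the given one is bounded.
\<close>

definition dyadic :: "(real \<Rightarrow> real) \<Rightarrow> nat \<Rightarrow> real \<Rightarrow> real" where
  "dyadic f n t = of_int \<lfloor>2 ^ n * f t\<rfloor> / 2 ^ n"

lemma dyadic_close: "\<bar>f t - dyadic f n t\<bar> \<le> (1/2) ^ n"
proof -
  have "f t - dyadic f n t = (2 ^ n * f t - of_int \<lfloor>2 ^ n * f t\<rfloor>) / 2 ^ n"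
    by (simp add: dyadic_def diff_divide_distrib)
  moreover have "\<bar>2 ^ n * f t - of_int \<lfloor>2 ^ n * f t\<rfloor>\<bar> \<le> 1" by linarith
  ultimately show ?thesis by (simp add: abs_divide power_divide divide_right_mono)
qed

lemma dyadic_zero: "f t = 0 \<Longrightarrow> dyadic f n t = 0"
  by (simp add: dyadic_def)

lemma dyadic_simple:
  assumes "bounded_borel f" shows "simple_function borel (dyadic f n)"
proof (rule simple_function_borel_measurable)
  obtain B where B: "\<And>t. \<bar>f t\<bar> \<le> B" using assms by (auto simp: bounded_borel_def)
  have [measurable]: "f \<in> borel_measurable borel" using assms by (rule bounded_borel_measurable)
  show "dyadic f n \<in> borel_measurable borel" unfolding dyadic_def[abs_def] by measurable
  have "\<lfloor>2 ^ n * f t\<rfloor> \<in> {\<lfloor>- (2 ^ n * B)\<rfloor>..\<lfloor>2 ^ n * B\<rfloor>}" for t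
  proof -
    have "- B \<le> f t" "f t \<le> B" using B[of t] by linarith+
    then have "2 ^ n * f t \<le> 2 ^ n * B" "2 ^ n * - B \<le> 2 ^ n * f t"
      by (intro mult_left_mono; simp)+
    then show ?thesis by (auto intro: floor_mono)
  qed
  then have "range (dyadic f n) \<subseteq> (\<lambda>k. of_int k / 2 ^ n) ` {\<lfloor>- (2 ^ n * B)\<rfloor>..\<lfloor>2 ^ n * B\<rfloor>}"
    by (auto simp: dyadic_def[abs_def])
  then show "finite (dyadic f n ` space borel)"
    by (auto intro: finite_subset)
qed

lemma S_dyadic_Cauchy:
  assumes f: "bounded_borel f" and h: "simple_function borel h" and e: "0 \<le> e" "\<And>t. \<bar>f t - h t\<bar> \<le> e"
  shows "norm (S (dyadic f n) x - S h x) \<le> ((1/2) ^ n + e) * norm x"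
proof -
  note d = dyadic_simple[OF f, of n]
  have "norm (S (\<lambda>t. dyadic f n t - h t) x) \<le> ((1/2) ^ n + e) * norm x"
  proof (rule S_bound)
    show "simple_function borel (\<lambda>t. dyadic f n t - h t)" using d h by (rule simple_function_diff)
    show "\<bar>dyadic f n t - h t\<bar> \<le> (1/2) ^ n + e" for t
      using dyadic_close[of f t n] e(2)[of t] by linarith
  qed (use e in auto)
  then show ?thesis by (simp add: S_diff[OF d h])
qed

text \<open>
  \<open>Phi f\<close> is the bounded operator \<open>\<integral> f dE\<close>. The limit is uniform on the unit ball, because the
  dyadic roundings converge uniformly.
\<close>

definition Phi :: "(real \<Rightarrow> real) \<Rightarrow> 'b L2 \<Rightarrow>\<^sub>L 'b L2" where
  "Phi f = Blinfun (\<lambda>x. lim (\<lambda>n. S (dyadic f n) x))"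

lemma Phi_lim:
  assumes f: "bounded_borel f"
  shows "(\<lambda>n. S (dyadic f n) x) \<longlonglongrightarrow> Phi f x"
proof -
  have conv: "(\<lambda>n. S (dyadic f n) x) \<longlonglongrightarrow> lim (\<lambda>n. S (dyadic f n) x)" for x
  proof -
    have "Cauchy (\<lambda>n. S (dyadic f n) x)"
    proof (rule metric_CauchyI)
      fix e :: real assume "e > 0"
      obtain N where N: "(1/2) ^ N < e / (2 * (norm x + 1))"
        using real_arch_pow_inv[of "e / (2 * (norm x + 1))" "1/2"] \<open>e > 0\<close>
        by (auto simp: add_nonneg_pos)
      show "\<exists>M. \<forall>m\<ge>M. \<forall>n\<ge>M. dist (S (dyadic f m) x) (S (dyadic f n) x) < e"
      proof (intro exI allI impI)
        fix m n assume mn: "N \<le> m" "N \<le> n"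
        have "dist (S (dyadic f m) x) (S (dyadic f n) x) \<le> ((1/2) ^ m + (1/2) ^ n) * norm x"
          unfolding dist_norm
          using dyadic_close by (intro S_dyadic_Cauchy f dyadic_simple) auto
        also have "\<dots> \<le> ((1/2) ^ N + (1/2) ^ N) * (norm x + 1)"
          using mn by (intro mult_mono add_mono power_decreasing) auto
        also have "\<dots> < e"
        proof -
          have "0 < 2 * (norm x + 1)" by (simp add: add_nonneg_pos)
          then have "(1/2) ^ N * (2 * (norm x + 1)) < e" using N by (simp only: pos_less_divide_eq)
          then show ?thesis by argo
        qed
        finally show "dist (S (dyadic f m) x) (S (dyadic f n) x) < e" .
      qed
    qed
    then show ?thesis by (simp add: Cauchy_convergent_iff convergent_LIMSEQ_iff)
  qed
  have "bounded_linear (\<lambda>x. lim (\<lambda>n. S (dyadic f n) x))"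
  proof -
    obtain B where B: "\<And>t. \<bar>f t\<bar> \<le> B" using f by (auto simp: bounded_borel_def)
    have B0: "0 \<le> B" using B[of 0] by linarith
    have bl: "bounded_linear (S (dyadic f n))" for n by (rule S_bounded_linear)
    show ?thesis
    proof (rule bounded_linear_intro[where K = "B + 1"])
      fix x y
      show "lim (\<lambda>n. S (dyadic f n) (x + y)) = lim (\<lambda>n. S (dyadic f n) x) + lim (\<lambda>n. S (dyadic f n) y)"
        using tendsto_add[OF conv[of x] conv[of y]]
        by (intro limI) (simp add: bounded_linear.linear[OF bl] linear_add)
    next
      fix r x
      show "lim (\<lambda>n. S (dyadic f n) (r *\<^sub>R x)) = r *\<^sub>R lim (\<lambda>n. S (dyadic f n) x)"
        using tendsto_scaleR[OF tendsto_const conv[of x], of r]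
        by (intro limI) (simp add: bounded_linear.linear[OF bl] linear_scale)
    next
      fix x
      have "norm (S (dyadic f n) x) \<le> (B + 1) * norm x" for n
      proof (rule S_bound[OF dyadic_simple[OF f]])
        show "\<bar>dyadic f n t\<bar> \<le> B + 1" for t
          using dyadic_close[of f t n] B[of t] power_le_one[of "1/2::real" n] by linarith
      qed (use B0 in auto)
      then show "norm (lim (\<lambda>n. S (dyadic f n) x)) \<le> norm x * (B + 1)"
        using tendsto_norm[OF conv[of x]] by (intro LIMSEQ_le_const2) (auto simp: mult.commute)
    qed
  qed
  then show ?thesis
    unfolding Phi_def using conv by (simp add: bounded_linear_Blinfun_apply)
qed

lemma Phi_approx:
  assumes f: "bounded_borel f" and h: "simple_function borel h" and e: "0 \<le> e" "\<And>t. \<bar>f t - h t\<bar> \<le> e"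
  shows "norm (Phi f x - S h x) \<le> e * norm x"
proof (rule LIMSEQ_le)
  show "(\<lambda>n. norm (S (dyadic f n) x - S h x)) \<longlonglongrightarrow> norm (Phi f x - S h x)"
    by (intro tendsto_intros Phi_lim f)
  have "(\<lambda>n. ((1/2) ^ n + e) * norm x) \<longlonglongrightarrow> (0 + e) * norm x"
    by (intro tendsto_intros LIMSEQ_realpow_zero) auto
  then show "(\<lambda>n. ((1/2) ^ n + e) * norm x) \<longlonglongrightarrow> e * norm x" by simp
qed (use S_dyadic_Cauchy[OF assms] in auto)

lemma Phi_simple: "simple_function borel h \<Longrightarrow> Phi h x = S h x"
  using Phi_approx[of h h 0 x] simple_bounded_borel[of h] by simp

lemma Phi_sym: "bounded_borel f \<Longrightarrow> Phi f x \<bullet> y = x \<bullet> Phi f y"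
  by (rule LIMSEQ_unique[OF tendsto_inner[OF Phi_lim[of f x] tendsto_const[of y]]])
    (simp_all add: S_sym dyadic_simple tendsto_inner[OF tendsto_const Phi_lim])

lemma Phi_inner:
  assumes f: "bounded_borel f"
  shows "x \<bullet> Phi f x = (\<integral>t. f t \<partial>W x)"
proof -
  have [measurable]: "f \<in> borel_measurable borel" using f by (rule bounded_borel_measurable)
  obtain B where B: "\<And>t. \<bar>f t\<bar> \<le> B" using f by (auto simp: bounded_borel_def)
  have "(\<lambda>n. \<integral>t. dyadic f n t \<partial>W x) \<longlonglongrightarrow> (\<integral>t. f t \<partial>W x)"
  proof (rule integral_dominated_convergence[where w = "\<lambda>_. B + 1"])
    show "dyadic f n \<in> borel_measurable (W x)" for n
      using dyadic_simple[OF f, THEN borel_measurable_simple_function] by simp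
    show "AE t in W x. norm (dyadic f n t) \<le> B + 1" for n
    proof (intro AE_I2)
      fix t
      show "norm (dyadic f n t) \<le> B + 1"
        using dyadic_close[of f t n] B[of t] power_le_one[of "1/2::real" n] unfolding real_norm_def by linarith
    qed
    have "(\<lambda>n. dyadic f n t) \<longlonglongrightarrow> f t" for t
    proof (rule LIM_zero_cancel, rule Lim_null_comparison)
      show "\<forall>\<^sub>F n in sequentially. norm (dyadic f n t - f t) \<le> (1/2) ^ n"
        using dyadic_close[of f t] by (simp add: abs_minus_commute)
    qed (rule LIMSEQ_realpow_zero, auto)
    then show "AE t in W x. (\<lambda>n. dyadic f n t) \<longlonglongrightarrow> f t" by simp
  qed auto
  moreover have "(\<lambda>n. \<integral>t. dyadic f n t \<partial>W x) \<longlonglongrightarrow> x \<bullet> Phi f x"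
    using tendsto_inner[OF tendsto_const[of x] Phi_lim[OF f, of x]]
    by (simp add: S_inner[OF dyadic_simple[OF f]])
  ultimately show ?thesis by (rule LIMSEQ_unique[symmetric])
qed

lemma Phi_eqI:
  fixes T :: "'b L2 \<Rightarrow>\<^sub>L 'b L2"
  assumes f: "bounded_borel f" and T: "\<And>x y. T x \<bullet> y = x \<bullet> T y"
    and diag: "\<And>x. x \<bullet> T x = (\<integral>t. f t \<partial>W x)"
  shows "Phi f = T"
  by (rule symmetric_diag_eq) (simp_all add: Phi_sym[OF f] T diag Phi_inner[OF f])

lemma Phi_cong:
  assumes f: "bounded_borel f" and g: "bounded_borel g" and "\<And>x. AE t in W x. f t = g t"
  shows "Phi f = Phi g"
proof (rule Phi_eqI[OF f Phi_sym[OF g]])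
  show "x \<bullet> Phi g x = (\<integral>t. f t \<partial>W x)" for x
    unfolding Phi_inner[OF g]
    by (rule integral_cong_AE)
      (use assms(3)[of x] bounded_borel_measurable[OF f] bounded_borel_measurable[OF g] in
        \<open>auto elim: eventually_mono\<close>)
qed

lemma Phi_add:
  assumes f: "bounded_borel f" and g: "bounded_borel g"
  shows "Phi (\<lambda>t. f t + g t) = Phi f + Phi g"
  by (intro Phi_eqI bounded_borel_add f g)
    (simp_all add: blinfun.add_left inner_add_left inner_add_right Phi_sym f g Phi_inner W_integrable)

lemma Phi_scale:
  assumes f: "bounded_borel f"
  shows "Phi (\<lambda>t. c * f t) = c *\<^sub>R Phi f"
  by (intro Phi_eqI bounded_borel_mult f)
    (simp_all add: blinfun.scaleR_left Phi_sym f Phi_inner)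

lemma Phi_diff:
  assumes f: "bounded_borel f" and g: "bounded_borel g"
  shows "Phi (\<lambda>t. f t - g t) = Phi f - Phi g"
  by (intro Phi_eqI bounded_borel_diff f g)
    (simp_all add: blinfun.diff_left inner_diff_left inner_diff_right Phi_sym f g Phi_inner W_integrable)

lemma Phi_one [simp]: "Phi (\<lambda>t. 1) = id_blinfun"
  by (intro Phi_eqI) (simp_all add: measure_W_UNIV power2_norm_eq_inner)

lemma Phi_indicator:
  assumes "A \<in> sets borel" shows "Phi (indicator A) = E A"
  using assms by (intro Phi_eqI) (auto simp: E_sym measure_W)

text \<open>
  Multiplicativity holds for simple functions because disjoint sets have orthogonal projections;
  products of dyadic roundings still approximate the product uniformly.
\<close>

lemma Phi_mult:
  assumes f: "bounded_borel f" and g: "bounded_borel g"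
  shows "Phi f (Phi g x) = Phi (\<lambda>t. f t * g t) x"
proof (rule LIMSEQ_unique)
  obtain B where B: "\<And>t. \<bar>f t\<bar> \<le> B" using f by (auto simp: bounded_borel_def)
  obtain C where C: "\<And>t. \<bar>g t\<bar> \<le> C" using g by (auto simp: bounded_borel_def)
  have B0: "0 \<le> B" using B[of 0] by linarith
  have C0: "0 \<le> C" using C[of 0] by linarith
  have d0: "(\<lambda>n. (1/2) ^ n :: real) \<longlonglongrightarrow> 0" by (rule LIMSEQ_realpow_zero) auto
  have "(\<lambda>n. Phi f (S (dyadic g n) x)) \<longlonglongrightarrow> Phi f (Phi g x)"
    by (intro blinfun.tendsto tendsto_const Phi_lim g)
  moreover have "(\<lambda>n. S (dyadic f n) (S (dyadic g n) x) - Phi f (S (dyadic g n) x)) \<longlonglongrightarrow> 0"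
  proof (rule Lim_null_comparison)
    have "norm (S (dyadic f n) y - Phi f y) \<le> (1/2) ^ n * norm y" for n y
      using Phi_approx[OF f dyadic_simple[OF f], of "(1/2) ^ n" n y] dyadic_close
      by (simp add: norm_minus_commute)
    then show "\<forall>\<^sub>F n in sequentially. norm (S (dyadic f n) (S (dyadic g n) x) - Phi f (S (dyadic g n) x))
        \<le> (1/2) ^ n * norm (S (dyadic g n) x)"
      by simp
    show "(\<lambda>n. (1/2) ^ n * norm (S (dyadic g n) x)) \<longlonglongrightarrow> 0"
      using tendsto_mult[OF d0 tendsto_norm[OF Phi_lim[OF g, of x]]] by simp
  qed
  ultimately show "(\<lambda>n. S (dyadic f n) (S (dyadic g n) x)) \<longlonglongrightarrow> Phi f (Phi g x)"
    using tendsto_add by fastforce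
  have "(\<lambda>n. Phi (\<lambda>t. f t * g t) x - S (dyadic f n) (S (dyadic g n) x)) \<longlonglongrightarrow> 0"
  proof (rule Lim_null_comparison)
    show "\<forall>\<^sub>F n in sequentially. norm (Phi (\<lambda>t. f t * g t) x - S (dyadic f n) (S (dyadic g n) x))
        \<le> ((1/2) ^ n * (C + 1) + B * (1/2) ^ n) * norm x"
    proof (intro always_eventually allI)
      fix n
      have "norm (Phi (\<lambda>t. f t * g t) x - S (\<lambda>t. dyadic f n t * dyadic g n t) x)
          \<le> ((1/2) ^ n * (C + 1) + B * (1/2) ^ n) * norm x"
      proof (rule Phi_approx)
        show "simple_function borel (\<lambda>t. dyadic f n t * dyadic g n t)"
          by (intro simple_function_mult dyadic_simple f g)
        fix t
        have "\<bar>dyadic g n t\<bar> \<le> C + 1"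
          using dyadic_close[of g t n] C[of t] power_le_one[of "1/2::real" n] by linarith
        then have "\<bar>f t - dyadic f n t\<bar> * \<bar>dyadic g n t\<bar> + \<bar>f t\<bar> * \<bar>g t - dyadic g n t\<bar>
            \<le> (1/2) ^ n * (C + 1) + B * (1/2) ^ n"
          using dyadic_close[of f t n] dyadic_close[of g t n] B[of t] B0
          by (intro add_mono mult_mono) auto
        moreover have "f t * g t - dyadic f n t * dyadic g n t
            = (f t - dyadic f n t) * dyadic g n t + f t * (g t - dyadic g n t)"
          by (simp add: algebra_simps)
        ultimately show "\<bar>f t * g t - dyadic f n t * dyadic g n t\<bar> \<le> (1/2) ^ n * (C + 1) + B * (1/2) ^ n"
          using abs_triangle_ineq[of "(f t - dyadic f n t) * dyadic g n t" "f t * (g t - dyadic g n t)"]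
          by (simp add: abs_mult)
      qed (use B0 C0 f g in auto)
      then show "norm (Phi (\<lambda>t. f t * g t) x - S (dyadic f n) (S (dyadic g n) x))
          \<le> ((1/2) ^ n * (C + 1) + B * (1/2) ^ n) * norm x"
        by (simp add: S_mult dyadic_simple f g)
    qed
    have "(\<lambda>n. ((1/2) ^ n * (C + 1) + B * (1/2) ^ n) * norm x) \<longlonglongrightarrow> (0 * (C + 1) + B * 0) * norm x"
      by (intro tendsto_intros d0)
    then show "(\<lambda>n. ((1/2) ^ n * (C + 1) + B * (1/2) ^ n) * norm x) \<longlonglongrightarrow> 0" by simp
  qed
  from tendsto_diff[OF tendsto_const this, of "Phi (\<lambda>t. f t * g t) x"]
  show "(\<lambda>n. S (dyadic f n) (S (dyadic g n) x)) \<longlonglongrightarrow> Phi (\<lambda>t. f t * g t) x" by simp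
qed

lemma Phi_norm:
  assumes f: "bounded_borel f"
  shows "(norm (Phi f x))\<^sup>2 = (\<integral>t. (f t)\<^sup>2 \<partial>W x)"
  unfolding power2_norm_eq_inner Phi_sym[OF f] Phi_mult[OF f f] Phi_inner[OF bounded_borel_mult[OF f f]]
  by (simp add: power2_eq_square)

lemma Phi_norm_le:
  assumes f: "bounded_borel f" and C: "0 \<le> C" "\<And>t. \<bar>f t\<bar> \<le> C"
  shows "norm (Phi f) \<le> C"
proof (rule norm_blinfun_leI[OF C(1)])
  fix x
  have "(f t)\<^sup>2 \<le> C\<^sup>2" for t
    using C(2)[of t] by (metis abs_ge_zero power2_abs power_mono)
  then have "(norm (Phi f x))\<^sup>2 \<le> C\<^sup>2 * (norm x)\<^sup>2"
    unfolding Phi_norm[OF f] using bounded_borel_mult[OF f f]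
    by (intro integral_W_le) (auto simp: power2_eq_square)
  then have "(norm (Phi f x))\<^sup>2 \<le> (C * norm x)\<^sup>2" by (simp add: power_mult_distrib)
  then show "norm (Phi f x) \<le> C * norm x" by (rule power2_le_imp_le) (use C(1) in simp)
qed

text \<open>
  Integrability of an unbounded \<open>f\<close> at a vector \<open>Phi g x\<close> thus only depends on \<open>f * g\<close>.
\<close>

lemma W_Phi:
  assumes g: "bounded_borel g"
  shows "W (Phi g x) = density (W x) (\<lambda>t. ennreal ((g t)\<^sup>2))"
proof (rule measure_eqI)
  fix A assume "A \<in> sets (W (Phi g x))"
  then have A: "A \<in> sets borel" by simp
  have [measurable]: "g \<in> borel_measurable borel" using g by (rule bounded_borel_measurable)
  have ig: "bounded_borel (\<lambda>t. indicator A t * g t)" using A g by auto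
  have "E A (Phi g x) = Phi (\<lambda>t. indicator A t * g t) x"
    unfolding Phi_indicator[OF A, symmetric] by (rule Phi_mult[OF bounded_borel_indicator[OF A] g])
  then have "Phi g x \<bullet> E A (Phi g x) = (norm (Phi (\<lambda>t. indicator A t * g t) x))\<^sup>2"
    using E_inner[OF A, of "Phi g x"] by simp
  also have "\<dots> = (\<integral>t. (g t)\<^sup>2 * indicator A t \<partial>W x)"
    unfolding Phi_norm[OF ig]
    by (intro Bochner_Integration.integral_cong) (auto simp: indicator_def)
  finally have "emeasure (W (Phi g x)) A = ennreal (\<integral>t. (g t)\<^sup>2 * indicator A t \<partial>W x)"
    using A by (simp add: emeasure_W)
  also have "\<dots> = (\<integral>\<^sup>+t. ennreal ((g t)\<^sup>2 * indicator A t) \<partial>W x)"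
    using g A by (intro nn_integral_eq_integral[symmetric] W_integrable)
      (auto simp: power2_eq_square)
  also have "\<dots> = emeasure (density (W x) (\<lambda>t. ennreal ((g t)\<^sup>2))) A"
    using A by (subst emeasure_density) (auto intro!: nn_integral_cong simp: indicator_def)
  finally show "emeasure (W (Phi g x)) A = emeasure (density (W x) (\<lambda>t. ennreal ((g t)\<^sup>2))) A" .
qed simp

lemma nn_Phi_norm:
  assumes f: "bounded_borel f"
  shows "(\<integral>\<^sup>+t. ennreal ((f t)\<^sup>2) \<partial>W x) = ennreal ((norm (Phi f x))\<^sup>2)"
  unfolding Phi_norm[OF f] using bounded_borel_mult[OF f f]
  by (intro nn_integral_eq_integral W_integrable) (auto simp: power2_eq_square)

end

lemma tendsto_of_nn_norm_sq:
  fixes u :: "nat \<Rightarrow> 'a::real_normed_vector"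
  assumes "(\<lambda>n. ennreal ((norm (u n - y))\<^sup>2)) \<longlonglongrightarrow> 0"
  shows "u \<longlonglongrightarrow> y"
proof -
  have "(\<lambda>n. (norm (u n - y))\<^sup>2) \<longlonglongrightarrow> 0"
    using assms tendsto_ennreal_iff[of "\<lambda>n. (norm (u n - y))\<^sup>2" sequentially 0] by simp
  then have "(\<lambda>n. sqrt ((norm (u n - y))\<^sup>2)) \<longlonglongrightarrow> sqrt 0" by (rule tendsto_real_sqrt)
  then show ?thesis by (simp add: tendsto_norm_zero_iff LIM_zero_iff)
qed

subsection \<open>Unbounded spectral integrals\<close>

context pvm
begin

text \<open>
  Only values almost everywhere matter. This covers powers such as \<open>t powr - s\<close>, which are unbounded
  near \<open>0\<close> but bounded on a spectrum that stays away from it.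
\<close>

lemma spectral_integral_bounded:
  assumes f: "bounded_borel f" and eq: "\<And>x. AE t in W x. f' t = f t"
    and f': "f' \<in> borel_measurable borel"
  shows "spectral_integral E f' = op_graph (Phi f)"
proof -
  note [measurable] = f' bounded_borel_measurable[OF f]
  have dist: "(\<integral>\<^sup>+t. ennreal ((f' t - h t)\<^sup>2) \<partial>W x) = ennreal ((norm (S h x - Phi f x))\<^sup>2)"
    if h: "simple_function borel h" for h x
  proof -
    have "(\<integral>\<^sup>+t. ennreal ((f' t - h t)\<^sup>2) \<partial>W x) = (\<integral>\<^sup>+t. ennreal ((f t - h t)\<^sup>2) \<partial>W x)"
      using eq[of x] by (intro nn_integral_cong_AE) (auto elim: eventually_mono)
    also have "\<dots> = ennreal ((norm (Phi (\<lambda>t. f t - h t) x))\<^sup>2)"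
      by (intro nn_Phi_norm bounded_borel_diff f simple_bounded_borel h)
    finally show ?thesis
      by (simp add: Phi_diff f simple_bounded_borel h blinfun.diff_left Phi_simple norm_minus_commute)
  qed
  have fin: "(\<integral>\<^sup>+t. ennreal ((f' t)\<^sup>2) \<partial>W x) < \<infinity>" for x
  proof -
    have "(\<integral>\<^sup>+t. ennreal ((f' t)\<^sup>2) \<partial>W x) = (\<integral>\<^sup>+t. ennreal ((f t)\<^sup>2) \<partial>W x)"
      using eq[of x] by (intro nn_integral_cong_AE) (auto elim: eventually_mono)
    then show ?thesis by (simp add: nn_Phi_norm[OF f])
  qed
  have "(x, y) \<in> spectral_integral E f' \<longleftrightarrow> y = Phi f x" for x y
  proof
    assume "(x, y) \<in> spectral_integral E f'"
    then obtain h where h: "\<And>n::nat. simple_function borel (h n)"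
      "(\<lambda>n. \<integral>\<^sup>+t. ennreal ((f' t - h n t)\<^sup>2) \<partial>W x) \<longlonglongrightarrow> 0" "(\<lambda>n. S (h n) x) \<longlonglongrightarrow> y"
      by (auto simp: spectral_integral_def)
    have "(\<lambda>n. S (h n) x) \<longlonglongrightarrow> Phi f x"
      using h(2) unfolding dist[OF h(1)] by (rule tendsto_of_nn_norm_sq)
    with h(3) show "y = Phi f x" by (rule LIMSEQ_unique)
  next
    assume y: "y = Phi f x"
    have lim: "(\<lambda>n. S (dyadic f n) x) \<longlonglongrightarrow> Phi f x" by (rule Phi_lim[OF f])
    then have "(\<lambda>n. (norm (S (dyadic f n) x - Phi f x))\<^sup>2) \<longlonglongrightarrow> 0\<^sup>2"
      by (intro tendsto_power tendsto_norm_zero) (simp add: LIM_zero_iff)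
    then have "(\<lambda>n. ennreal ((norm (S (dyadic f n) x - Phi f x))\<^sup>2)) \<longlonglongrightarrow> ennreal 0"
      by (intro tendsto_ennrealI) simp
    then show "(x, y) \<in> spectral_integral E f'"
      using lim fin dyadic_simple[OF f] unfolding spectral_integral_def y
      by (auto intro!: exI[of _ "dyadic f"] simp: dist)
  qed
  then show ?thesis by (auto simp: op_graph_def)
qed

text \<open>
  Multiplying \<open>f\<close> by a bounded \<open>g\<close> that makes \<open>f * g\<close> bounded describes the unbounded \<open>\<integral> f dE\<close> in
  terms of bounded operators. This lemma produces elements of its graph, and the next one evaluates
  given ones. Truncating \<open>f\<close> at height \<open>n\<close> before rounding provides the simple functions: after
  multiplication by \<open>g\<close> the error is dominated by a constant.
\<close>

lemma spectral_integral_range: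
  assumes g: "bounded_borel g" and fg: "bounded_borel (\<lambda>t. f t * g t)" and f: "f \<in> borel_measurable borel"
  shows "(Phi g x, Phi (\<lambda>t. f t * g t) x) \<in> spectral_integral E f"
proof -
  note [measurable] = f bounded_borel_measurable[OF g]
  define h where "h n = dyadic (\<lambda>t. indicator {t. \<bar>f t\<bar> \<le> real n} t * f t) n" for n
  have bb: "bounded_borel (\<lambda>t. indicator {t. \<bar>f t\<bar> \<le> real n} t * f t)" for n
    by (rule bounded_borelI[of _ "real n"]) (auto simp: indicator_def)
  have h: "simple_function borel (h n)" for n unfolding h_def by (rule dyadic_simple[OF bb])
  note [measurable] = borel_measurable_simple_function[OF h]
  have near: "\<bar>f t - h n t\<bar> \<le> (1/2) ^ n" if "\<bar>f t\<bar> \<le> real n" for n t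
    using dyadic_close[of "\<lambda>t. indicator {t. \<bar>f t\<bar> \<le> real n} t * f t" t n] that by (simp add: h_def)
  have far: "h n t = 0" if "\<not> \<bar>f t\<bar> \<le> real n" for n t
    unfolding h_def using that by (intro dyadic_zero) simp
  have dens: "(\<integral>\<^sup>+t. ennreal ((u t)\<^sup>2) \<partial>W (Phi g x)) = (\<integral>\<^sup>+t. ennreal ((u t * g t)\<^sup>2) \<partial>W x)"
    if [measurable]: "u \<in> borel_measurable borel" for u
    unfolding W_Phi[OF g]
    by (subst nn_integral_density) (auto simp: ennreal_mult[symmetric] power_mult_distrib mult.commute)
  have S_h: "S (h n) (Phi g x) = Phi (\<lambda>t. h n t * g t) x" for n
    by (simp add: Phi_simple[OF h, symmetric] Phi_mult[OF simple_bounded_borel[OF h] g])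
  have dist: "(\<integral>\<^sup>+t. ennreal ((f t - h n t)\<^sup>2) \<partial>W (Phi g x))
      = ennreal ((norm (S (h n) (Phi g x) - Phi (\<lambda>t. f t * g t) x))\<^sup>2)" for n
  proof -
    have hg: "bounded_borel (\<lambda>t. h n t * g t)" using simple_bounded_borel[OF h] g by blast
    have "(\<integral>\<^sup>+t. ennreal ((f t - h n t)\<^sup>2) \<partial>W (Phi g x)) = (\<integral>\<^sup>+t. ennreal ((f t * g t - h n t * g t)\<^sup>2) \<partial>W x)"
      by (subst dens) (auto simp: left_diff_distrib)
    also have "\<dots> = ennreal ((norm (Phi (\<lambda>t. f t * g t - h n t * g t) x))\<^sup>2)"
      by (intro nn_Phi_norm bounded_borel_diff fg hg)
    finally show ?thesis
      by (simp add: Phi_diff[OF fg hg] S_h blinfun.diff_left norm_minus_commute)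
  qed
  obtain C where C: "\<And>t. \<bar>g t\<bar> \<le> C" using g by (auto simp: bounded_borel_def)
  obtain D where D: "\<And>t. \<bar>f t * g t\<bar> \<le> D" using fg by (auto simp: bounded_borel_def)
  have C0: "0 \<le> C" using C[of 0] by linarith
  have D0: "0 \<le> D" using D[of 0] by linarith
  have lim0: "(\<lambda>n. \<integral>\<^sup>+t. ennreal ((f t - h n t)\<^sup>2) \<partial>W (Phi g x)) \<longlonglongrightarrow> 0"
  proof -
    have "(\<lambda>n. \<integral>\<^sup>+t. ennreal (((f t - h n t) * g t)\<^sup>2) \<partial>W x) \<longlonglongrightarrow> (\<integral>\<^sup>+t. 0 \<partial>W x)"
    proof (rule nn_integral_dominated_convergence[where w = "\<lambda>_. ennreal ((C + D)\<^sup>2)"])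
      show "AE t in W x. ennreal (((f t - h n t) * g t)\<^sup>2) \<le> ennreal ((C + D)\<^sup>2)" for n
      proof (intro AE_I2 ennreal_leI)
        fix t
        have "\<bar>(f t - h n t) * g t\<bar> \<le> C + D"
        proof (cases "\<bar>f t\<bar> \<le> real n")
          case True
          have "\<bar>f t - h n t\<bar> * \<bar>g t\<bar> \<le> 1 * C"
            using near[OF True] power_le_one[of "1/2::real" n] C[of t] by (intro mult_mono) auto
          then show ?thesis using D0 by (simp add: abs_mult)
        next
          case False
          then show ?thesis using far[OF False] D[of t] C0 by simp
        qed
        then show "((f t - h n t) * g t)\<^sup>2 \<le> (C + D)\<^sup>2"
          by (metis abs_ge_zero power2_abs power_mono)
      qed
      have "(\<lambda>n. ennreal (((f t - h n t) * g t)\<^sup>2)) \<longlonglongrightarrow> ennreal ((0 * g t)\<^sup>2)" for t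
      proof (intro tendsto_ennrealI tendsto_power tendsto_mult tendsto_const, rule Lim_null_comparison)
        obtain N where "\<bar>f t\<bar> \<le> real N" using real_arch_simple by blast
        then show "\<forall>\<^sub>F n in sequentially. norm (f t - h n t) \<le> (1/2) ^ n"
          using near[of t] by (auto simp: eventually_sequentially intro!: exI[of _ N])
      qed (rule LIMSEQ_realpow_zero, auto)
      then show "AE t in W x. (\<lambda>n. ennreal (((f t - h n t) * g t)\<^sup>2)) \<longlonglongrightarrow> 0" by simp
    qed (auto simp: emeasure_W ennreal_mult_less_top)
    then show ?thesis by (simp add: dens)
  qed
  then have "(\<lambda>n. S (h n) (Phi g x)) \<longlonglongrightarrow> Phi (\<lambda>t. f t * g t) x"
    unfolding dist by (rule tendsto_of_nn_norm_sq)
  moreover have "(\<integral>\<^sup>+t. ennreal ((f t)\<^sup>2) \<partial>W (Phi g x)) < \<infinity>"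
    by (simp add: dens nn_Phi_norm[OF fg])
  ultimately show ?thesis
    unfolding spectral_integral_def using h lim0 by auto
qed

lemma spectral_integral_value:
  assumes g: "bounded_borel g" and fg: "bounded_borel (\<lambda>t. f t * g t)"
    and yz: "(y, z) \<in> spectral_integral E f" and f: "f \<in> borel_measurable borel"
  shows "Phi g z = Phi (\<lambda>t. f t * g t) y"
proof -
  note [measurable] = f bounded_borel_measurable[OF g]
  obtain h where h: "\<And>n::nat. simple_function borel (h n)"
    "(\<lambda>n. \<integral>\<^sup>+t. ennreal ((f t - h n t)\<^sup>2) \<partial>W y) \<longlonglongrightarrow> 0" "(\<lambda>n. S (h n) y) \<longlonglongrightarrow> z"
    using yz by (auto simp: spectral_integral_def)
  note [measurable] = borel_measurable_simple_function[OF h(1)]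
  obtain C where C: "\<And>t. \<bar>g t\<bar> \<le> C" using g by (auto simp: bounded_borel_def)
  have C0: "0 \<le> C" using C[of 0] by linarith
  have gh: "bounded_borel (\<lambda>t. g t * h n t)" for n using simple_bounded_borel[OF h(1)] g by blast
  have bound: "ennreal ((norm (Phi g (S (h n) y) - Phi (\<lambda>t. f t * g t) y))\<^sup>2)
      \<le> ennreal (C\<^sup>2) * (\<integral>\<^sup>+t. ennreal ((f t - h n t)\<^sup>2) \<partial>W y)" for n
  proof -
    have "Phi g (S (h n) y) - Phi (\<lambda>t. f t * g t) y = Phi (\<lambda>t. g t * h n t - f t * g t) y"
      by (simp add: Phi_diff[OF gh fg] blinfun.diff_left Phi_simple[OF h(1), symmetric]
          Phi_mult[OF g simple_bounded_borel[OF h(1)]])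
    then have "ennreal ((norm (Phi g (S (h n) y) - Phi (\<lambda>t. f t * g t) y))\<^sup>2)
        = (\<integral>\<^sup>+t. ennreal ((g t * h n t - f t * g t)\<^sup>2) \<partial>W y)"
      by (simp add: nn_Phi_norm bounded_borel_diff gh fg)
    also have "\<dots> \<le> (\<integral>\<^sup>+t. ennreal (C\<^sup>2) * ennreal ((f t - h n t)\<^sup>2) \<partial>W y)"
    proof (rule nn_integral_mono)
      fix t
      have "(g t)\<^sup>2 \<le> C\<^sup>2" using C[of t] by (metis abs_ge_zero power2_abs power_mono)
      then have "(g t)\<^sup>2 * (f t - h n t)\<^sup>2 \<le> C\<^sup>2 * (f t - h n t)\<^sup>2" by (rule mult_right_mono) simp
      moreover have "(g t * h n t - f t * g t)\<^sup>2 = (g t)\<^sup>2 * (f t - h n t)\<^sup>2"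
        by (simp add: power2_eq_square algebra_simps)
      ultimately show "ennreal ((g t * h n t - f t * g t)\<^sup>2) \<le> ennreal (C\<^sup>2) * ennreal ((f t - h n t)\<^sup>2)"
        by (simp add: ennreal_mult[symmetric] ennreal_leI)
    qed
    also have "\<dots> = ennreal (C\<^sup>2) * (\<integral>\<^sup>+t. ennreal ((f t - h n t)\<^sup>2) \<partial>W y)"
      by (rule nn_integral_cmult) measurable
    finally show ?thesis .
  qed
  have lim: "(\<lambda>n. ennreal (C\<^sup>2) * (\<integral>\<^sup>+t. ennreal ((f t - h n t)\<^sup>2) \<partial>W y)) \<longlonglongrightarrow> ennreal (C\<^sup>2) * 0"
    by (intro ennreal_tendsto_cmult h(2)) simp
  have "(\<lambda>n. ennreal ((norm (Phi g (S (h n) y) - Phi (\<lambda>t. f t * g t) y))\<^sup>2)) \<longlonglongrightarrow> 0"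
  proof (rule tendsto_sandwich[OF _ _ tendsto_const])
    show "(\<lambda>n. ennreal (C\<^sup>2) * (\<integral>\<^sup>+t. ennreal ((f t - h n t)\<^sup>2) \<partial>W y)) \<longlonglongrightarrow> 0"
      using lim by simp
  qed (use bound in simp_all)
  then have "(\<lambda>n. Phi g (S (h n) y)) \<longlonglongrightarrow> Phi (\<lambda>t. f t * g t) y"
    by (rule tendsto_of_nn_norm_sq)
  moreover have "(\<lambda>n. Phi g (S (h n) y)) \<longlonglongrightarrow> Phi g z"
    by (intro blinfun.tendsto tendsto_const h(3))
  ultimately show ?thesis by (rule LIMSEQ_unique[symmetric])
qed

end

section \<open>Resolvents and negative powers\<close>

text \<open>
  The resolvent function \<open>1 / (t + c)\<close>, cut off below the lower bound \<open>l\<close> of the spectrum so that it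
  is bounded.
\<close>

definition shifted_inverse :: "real \<Rightarrow> real \<Rightarrow> real \<Rightarrow> real" where
  "shifted_inverse l c t = indicator {l..} t / (t + c)"

lemma shifted_inverse_bounds:
  assumes "l > 0" "c \<ge> 0"
  shows "0 \<le> shifted_inverse l c t" "shifted_inverse l c t \<le> 1 / l"
  using assms by (auto simp: shifted_inverse_def indicator_def intro!: frac_le)

lemma bounded_borel_shifted_inverse:
  assumes "l > 0" "c \<ge> 0" shows "bounded_borel (shifted_inverse l c)"
proof (rule bounded_borelI[of _ "1 / l"])
  show "shifted_inverse l c \<in> borel_measurable borel" unfolding shifted_inverse_def[abs_def] by measurable
  show "\<bar>shifted_inverse l c t\<bar> \<le> 1 / l" for t
    using shifted_inverse_bounds[OF assms, of t] by simp
qed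

lemma op_shift_zero [simp]: "op_shift T 0 = T"
  by (auto simp: op_shift_def)

context pvm
begin

lemma norm_E_measure: "A \<in> sets borel \<Longrightarrow> (norm (E A x))\<^sup>2 = measure (W x) A"
  by (simp add: E_inner measure_W)

text \<open>
  A vector in the range of \<open>E {- n..<l}\<close> lies in the domain, and its quadratic form is an average of
  numbers below \<open>l\<close>. The lower bound leaves only the zero vector.
\<close>

lemma form_ge_imp_support:
  assumes ge: "form_ge (spectral_integral E (\<lambda>t. t)) l"
  shows "E {..<l} = 0"
proof -
  have null: "emeasure (W v) {- real n..<l} = 0" for n v
  proof -
    define A where "A = {- real n..<l}"
    have A [measurable]: "A \<in> sets borel" by (simp add: A_def)
    have iA: "bounded_borel (indicator A)" using A by blast
    have tA: "bounded_borel (\<lambda>t. t * indicator A t)"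
      by (rule bounded_borelI[of _ "max (real n) \<bar>l\<bar>"]) (auto simp: A_def indicator_def)
    have "(Phi (indicator A) v, Phi (\<lambda>t. t * indicator A t) v) \<in> spectral_integral E (\<lambda>t. t)"
      by (rule spectral_integral_range[OF iA tA]) simp
    then have "l * (norm (Phi (indicator A) v))\<^sup>2 \<le> Phi (indicator A) v \<bullet> Phi (\<lambda>t. t * indicator A t) v"
      using ge by (auto simp: form_ge_def inner_L2_def)
    also have "\<dots> = (\<integral>t. indicator A t * (t * indicator A t) \<partial>W v)"
      unfolding Phi_sym[OF iA] Phi_mult[OF iA tA] by (rule Phi_inner[OF bounded_borel_mult[OF iA tA]])
    also have "\<dots> = (\<integral>t. t * indicator A t \<partial>W v)"
      by (intro Bochner_Integration.integral_cong) (auto simp: indicator_def)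
    also have "(norm (Phi (indicator A) v))\<^sup>2 = (\<integral>t. indicator A t \<partial>W v)"
      unfolding Phi_norm[OF iA] by (intro Bochner_Integration.integral_cong) (auto simp: indicator_def)
    finally have "(\<integral>t. l * indicator A t - t * indicator A t \<partial>W v) \<le> 0"
      using W_integrable[OF iA, of v] W_integrable[OF tA, of v] by simp
    moreover have pos: "0 \<le> l * indicator A t - t * indicator A t" for t
      by (auto simp: A_def indicator_def)
    ultimately have "(\<integral>t. l * indicator A t - t * indicator A t \<partial>W v) = 0"
      by (intro antisym integral_nonneg_AE) auto
    then have "AE t in W v. l * indicator A t - t * indicator A t = 0"
      using W_integrable[OF iA, of v] W_integrable[OF tA, of v] pos
      by (subst (asm) integral_nonneg_eq_0_iff_AE) auto
    then have "AE t in W v. t \<notin> A"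
      by (auto elim!: eventually_mono simp: A_def indicator_def split: if_splits)
    then show "emeasure (W v) A = 0"
      using A by (subst (asm) AE_iff_measurable[of A]) auto
  qed
  show ?thesis
  proof (rule blinfun_eqI)
    fix v
    have "{..<l} = (\<Union>n. {- real n..<l})"
    proof safe
      fix t :: real assume "t < l"
      obtain n where "- t \<le> real n" using real_arch_simple by blast
      then show "t \<in> (\<Union>n. {- real n..<l})" using \<open>t < l\<close> by (auto intro!: exI[of _ n])
    qed auto
    then have "emeasure (W v) {..<l} = 0"
      using null by (simp only:) (rule emeasure_UN_eq_0, auto)
    then have "(norm (E {..<l} v))\<^sup>2 = 0"
      by (simp add: norm_E_measure measure_def)
    then show "E {..<l} v = (0 :: 'b L2 \<Rightarrow>\<^sub>L 'b L2) v" by simp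
  qed
qed

lemma AE_support:
  assumes "E {..<l} = 0" shows "AE t in W x. l \<le> t"
  using assms by (subst AE_iff_measurable[of "{..<l}"]) (auto simp: emeasure_W)

text \<open>
  The operator \<open>\<integral> t dE + c\<close> has the inverse \<open>Phi (shifted_inverse l c)\<close>, because
  \<open>(t + c) * shifted_inverse l c t = 1\<close> almost everywhere.
\<close>

lemma op_shift_spectral_integral_iff:
  assumes supp: "E {..<l} = 0" and l: "l > 0" and c: "c \<ge> 0"
  shows "(y, z) \<in> op_shift (spectral_integral E (\<lambda>t. t)) c \<longleftrightarrow> y = Phi (shifted_inverse l c) z"
proof -
  let ?g = "shifted_inverse l c"
  have g: "bounded_borel ?g" using l c by (rule bounded_borel_shifted_inverse)
  have tg: "bounded_borel (\<lambda>t. t * ?g t)"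
  proof (rule bounded_borelI[of _ 1])
    show "(\<lambda>t. t * ?g t) \<in> borel_measurable borel"
      using bounded_borel_measurable[OF g] by measurable
  qed (use l c in \<open>auto simp: shifted_inverse_def indicator_def divide_le_eq\<close>)
  have cg: "bounded_borel (\<lambda>t. c * ?g t)" by (rule bounded_borel_mult[OF bounded_borel_const g])
  have "Phi (\<lambda>t. t * ?g t + c * ?g t) = Phi (\<lambda>t. 1)"
  proof (rule Phi_cong)
    show "AE t in W x. t * ?g t + c * ?g t = 1" for x
      using AE_support[OF supp, of x]
    proof eventually_elim
      case (elim t)
      with l c have "t * ?g t + c * ?g t = (t + c) / (t + c)" "t + c \<noteq> 0"
        by (simp_all only: shifted_inverse_def add_divide_distrib) auto
      then show ?case by simp
    qed
  qed (use tg cg in auto)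
  then have "Phi (\<lambda>t. t * ?g t) + c *\<^sub>R Phi ?g = id_blinfun"
    by (simp add: Phi_add[OF tg cg] Phi_scale[OF g])
  then have "(Phi (\<lambda>t. t * ?g t) + c *\<^sub>R Phi ?g) u = u" for u by simp
  then have sum: "Phi (\<lambda>t. t * ?g t) u + c *\<^sub>R Phi ?g u = u" for u
    by (simp add: blinfun.add_left blinfun.scaleR_left)
  show ?thesis
  proof
    assume "(y, z) \<in> op_shift (spectral_integral E (\<lambda>t. t)) c"
    then obtain w where w: "z = w + c *\<^sub>R y" "(y, w) \<in> spectral_integral E (\<lambda>t. t)"
      by (auto simp: op_shift_def)
    have "Phi ?g w = Phi (\<lambda>t. t * ?g t) y"
      by (rule spectral_integral_value[OF g tg w(2)]) simp
    then show "y = Phi ?g z"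
      using sum[of y] by (simp add: w(1) blinfun.add_right blinfun.scaleR_right)
  next
    assume y: "y = Phi ?g z"
    have "(Phi ?g z, Phi (\<lambda>t. t * ?g t) z) \<in> spectral_integral E (\<lambda>t. t)"
      by (rule spectral_integral_range[OF g tg]) simp
    then show "(y, z) \<in> op_shift (spectral_integral E (\<lambda>t. t)) c"
      using sum[of z] unfolding op_shift_def y by force
  qed
qed

end

text \<open>
  Two spectral measures, one of an operator and one of its shift by \<open>c\<close>, are compared without
  translating one into the other: they give the same resolvent, hence the same polynomials in the
  resolvent, and \<open>u powr s\<close> is a uniform limit of polynomials on \<open>[0, 1 / l]\<close>.
\<close>

lemma Phi_powr_shift:
  fixes E F :: "real set \<Rightarrow> 'b::brane L2 \<Rightarrow>\<^sub>L 'b L2"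
  assumes "pvm E" "pvm F" and supp: "E {..<l} = 0" "F {..<l} = 0" and l: "l > 0" and c: "c \<ge> 0"
    and shift: "op_shift (spectral_integral E (\<lambda>t. t)) c = spectral_integral F (\<lambda>t. t)" and s: "s > 0"
  shows "pvm.Phi F (\<lambda>t. indicator {l..} t * t powr (- s))
    = pvm.Phi E (\<lambda>t. indicator {l..} t * (t + c) powr (- s))"
proof -
  interpret E: pvm E by fact
  interpret F: pvm F by fact
  define g where "g = shifted_inverse l c"
  define h where "h = shifted_inverse l 0"
  have g: "bounded_borel g" and h: "bounded_borel h"
    using l c by (simp_all add: g_def h_def bounded_borel_shifted_inverse)
  note [measurable] = bounded_borel_measurable[OF g] bounded_borel_measurable[OF h]
  have g01: "g t \<in> {0..1/l}" and h01: "h t \<in> {0..1/l}" for t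
    using l c shifted_inverse_bounds by (simp_all add: g_def h_def)
  have gh: "E.Phi g = F.Phi h"
  proof (rule blinfun_eqI)
    fix z
    show "E.Phi g z = F.Phi h z"
      using E.op_shift_spectral_integral_iff[OF supp(1) l c, of "E.Phi g z" z]
        F.op_shift_spectral_integral_iff[OF supp(2) l order_refl, of "E.Phi g z" z]
      by (simp add: shift g_def h_def)
  qed
  have pow_bb: "bounded_borel (\<lambda>t. f t ^ n)" if "bounded_borel f" for f n
    using that by (induction n) auto
  have pow: "E.Phi (\<lambda>t. g t ^ n) = F.Phi (\<lambda>t. h t ^ n)" for n
  proof (induction n)
    case (Suc n)
    show ?case
    proof (rule blinfun_eqI)
      fix x
      have "E.Phi (\<lambda>t. g t ^ Suc n) x = E.Phi g (E.Phi (\<lambda>t. g t ^ n) x)"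
        using E.Phi_mult[OF g pow_bb[OF g]] by simp
      also have "\<dots> = F.Phi (\<lambda>t. h t ^ Suc n) x"
        unfolding gh Suc using F.Phi_mult[OF h pow_bb[OF h]] by simp
      finally show "E.Phi (\<lambda>t. g t ^ Suc n) x = F.Phi (\<lambda>t. h t ^ Suc n) x" .
    qed
  qed simp
  have poly_bb: "bounded_borel (\<lambda>t. \<Sum>i\<le>n. a i * f t ^ i)" if "bounded_borel f" for f a and n :: nat
    using that by (induction n) (auto intro!: bounded_borel_add bounded_borel_mult pow_bb)
  have poly: "E.Phi (\<lambda>t. \<Sum>i\<le>n. a i * g t ^ i) = F.Phi (\<lambda>t. \<Sum>i\<le>n. a i * h t ^ i)" for a n
  proof (induction n)
    case 0
    then show ?case using E.Phi_scale[OF pow_bb[OF g, of 0], of "a 0"] F.Phi_scale[OF pow_bb[OF h, of 0], of "a 0"]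
      by simp
  next
    case (Suc n)
    have "bounded_borel (\<lambda>t. a (Suc n) * g t ^ Suc n)" "bounded_borel (\<lambda>t. a (Suc n) * h t ^ Suc n)"
      by (rule bounded_borel_mult[OF bounded_borel_const pow_bb[OF g]],
          rule bounded_borel_mult[OF bounded_borel_const pow_bb[OF h]])
    then show ?case
      using Suc pow[of "Suc n"] E.Phi_scale[OF pow_bb[OF g, of "Suc n"]] F.Phi_scale[OF pow_bb[OF h, of "Suc n"]]
      by (simp add: E.Phi_add[OF poly_bb[OF g]] F.Phi_add[OF poly_bb[OF h]] del: power_Suc)
  qed
  have gs: "bounded_borel (\<lambda>t. g t powr s)" and hs: "bounded_borel (\<lambda>t. h t powr s)"
    using g01 h01 s by (auto intro!: bounded_borelI[of _ "(1/l) powr s"] powr_mono2)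
  have "norm (E.Phi (\<lambda>t. g t powr s) - F.Phi (\<lambda>t. h t powr s)) \<le> 2 * e" if "e > 0" for e
  proof -
    have "continuous_on {0..1/l} (\<lambda>u. u powr s)"
      using s by (intro continuous_on_powr' continuous_intros) auto
    then obtain p where p: "real_polynomial_function p" "\<And>u. u \<in> {0..1/l} \<Longrightarrow> \<bar>u powr s - p u\<bar> < e"
      using Stone_Weierstrass_real_polynomial_function[of "{0..1/l}" "\<lambda>u. u powr s" e] \<open>e > 0\<close>
      by auto
    obtain a n where a: "p = (\<lambda>x. \<Sum>i\<le>n. a i * x ^ i)"
      using p(1) real_polynomial_function_iff_sum by blast
    have pg: "bounded_borel (\<lambda>t. p (g t))" and ph: "bounded_borel (\<lambda>t. p (h t))"
      unfolding a by (intro poly_bb g h)+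
    have "norm (E.Phi (\<lambda>t. g t powr s - p (g t))) \<le> e" "norm (F.Phi (\<lambda>t. h t powr s - p (h t))) \<le> e"
      using p(2)[OF g01] p(2)[OF h01] \<open>e > 0\<close>
      by (simp_all add: E.Phi_norm_le F.Phi_norm_le bounded_borel_diff gs hs pg ph less_imp_le)
    moreover have "E.Phi (\<lambda>t. g t powr s) - F.Phi (\<lambda>t. h t powr s)
        = E.Phi (\<lambda>t. g t powr s - p (g t)) - F.Phi (\<lambda>t. h t powr s - p (h t))"
      using poly[of a n] unfolding E.Phi_diff[OF gs pg] F.Phi_diff[OF hs ph] by (simp add: a)
    ultimately show ?thesis
      using norm_triangle_ineq4[of "E.Phi (\<lambda>t. g t powr s - p (g t))" "F.Phi (\<lambda>t. h t powr s - p (h t))"]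
      by simp
  qed
  then have "norm (E.Phi (\<lambda>t. g t powr s) - F.Phi (\<lambda>t. h t powr s)) \<le> 0 + e" if "e > 0" for e
    using that by (metis add_0 half_gt_zero mult.commute nonzero_eq_divide_eq zero_neq_numeral)
  then have "norm (E.Phi (\<lambda>t. g t powr s) - F.Phi (\<lambda>t. h t powr s)) \<le> 0"
    by (rule field_le_epsilon)
  moreover have "g t powr s = indicator {l..} t * (t + c) powr (- s)" for t
    using l c by (auto simp: g_def shifted_inverse_def indicator_def powr_divide powr_minus_divide)
  moreover have "h t powr s = indicator {l..} t * t powr (- s)" for t
    using l by (auto simp: h_def shifted_inverse_def indicator_def powr_divide powr_minus_divide)
  ultimately show ?thesis by simp
qed

section \<open>The inverse of a self-adjoint operator with positive lower bound\<close>

lemma cinner_zero_left [simp]: "cinner 0 x = 0"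
  using cinner_add_left[of 0 0 x] by simp

lemma cinner_zero_right [simp]: "cinner x 0 = 0"
  using cinner_add_right[of x 0 0] by simp

lemma tendsto_cinner_left [tendsto_intros]:
  "(u \<longlongrightarrow> a) F \<Longrightarrow> ((\<lambda>n. cinner (u n) (x :: 'b::brane L2)) \<longlongrightarrow> cinner a x) F"
  unfolding cinner_eq_inner by (intro tendsto_intros)

lemma closed_op_adjoint: "closed (op_adjoint T)"
  unfolding closed_sequential_limits
proof (intro allI impI, elim conjE)
  fix u :: "nat \<Rightarrow> 'a L2 \<times> 'a L2" and p
  assume u: "\<forall>n. u n \<in> op_adjoint T" and lim: "u \<longlonglongrightarrow> p"
  have "cinner (fst p) y = cinner (snd p) x" if "(x, y) \<in> T" for x y
  proof (rule LIMSEQ_unique)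
    show "(\<lambda>n. cinner (fst (u n)) y) \<longlonglongrightarrow> cinner (fst p) y"
      by (intro tendsto_intros lim)
    have "cinner (fst (u n)) y = cinner (snd (u n)) x" for n
      using u[rule_format, of n] that by (auto simp: op_adjoint_def)
    then show "(\<lambda>n. cinner (fst (u n)) y) \<longlonglongrightarrow> cinner (snd p) x"
      by (simp only:) (intro tendsto_intros lim)
  qed
  then show "p \<in> op_adjoint T" by (cases p) (auto simp: op_adjoint_def)
qed

text \<open>
  The lower bound makes \<open>L\<close> injective with closed range. A vector orthogonal to the range is
  annihilated by the adjoint of \<open>L\<close>, which is \<open>L\<close> itself, so it is zero and the range is everything.
\<close>

proposition self_adjoint_inverse:
  fixes L :: "'b::brane L2 rel"
  assumes sa: "self_adjoint L" and l: "l > 0" and ge: "form_ge L l"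
  obtains R :: "'b L2 \<Rightarrow>\<^sub>L 'b L2" where
    "\<And>y z. (y, z) \<in> L \<longleftrightarrow> y = R z" "\<And>x y. R x \<bullet> y = x \<bullet> R y" "\<And>c x. R (c *\<^sub>C x) = c *\<^sub>C R x"
    "\<And>x. 0 \<le> x \<bullet> R x" "\<And>x. l * (x \<bullet> R x) \<le> x \<bullet> x"
proof -
  have lin: "linear_operator L" and adj: "op_adjoint L = L"
    using sa by (auto simp: self_adjoint_def)
  have L0: "(0, 0) \<in> L" and Ladd: "\<And>x y x' y'. (x, y) \<in> L \<Longrightarrow> (x', y') \<in> L \<Longrightarrow> (x + x', y + y') \<in> L"
    and LscaleC: "\<And>c x y. (x, y) \<in> L \<Longrightarrow> (c *\<^sub>C x, c *\<^sub>C y) \<in> L"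
    using lin unfolding linear_operator_def by blast+
  have Lscale: "(r *\<^sub>R x, r *\<^sub>R y) \<in> L" if "(x, y) \<in> L" for r x y
    using LscaleC[OF that, of "complex_of_real r"] by (simp add: scaleC_of_real)
  have Ldiff: "(x - x', y - y') \<in> L" if "(x, y) \<in> L" "(x', y') \<in> L" for x y x' y'
    using Ladd[OF that(1) Lscale[OF that(2), of "-1"]] by simp
  have low: "l * norm y \<le> norm z" if "(y, z) \<in> L" for y z
  proof -
    have "l * (norm y)\<^sup>2 \<le> y \<bullet> z" using ge that by (auto simp: form_ge_def inner_L2_def)
    also have "\<dots> \<le> norm y * norm z" by (rule norm_cauchy_schwarz)
    finally show ?thesis by (cases "norm y = 0") (auto simp: power2_eq_square)
  qed
  define W where "W = Range L"
  have "subspace W"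
    unfolding W_def subspace_def using L0 Ladd Lscale by (blast intro: RangeI)
  moreover have "closed W"
    unfolding closed_sequential_limits
  proof (intro allI impI, elim conjE)
    fix z :: "nat \<Rightarrow> 'b L2" and z0
    assume "\<forall>n. z n \<in> W" and z: "z \<longlonglongrightarrow> z0"
    then have "\<forall>n. \<exists>y. (y, z n) \<in> L" by (auto simp: W_def)
    then obtain y where y: "\<And>n. (y n, z n) \<in> L" by metis
    have "Cauchy y"
    proof (rule metric_CauchyI)
      fix e :: real assume "e > 0"
      then obtain M where M: "\<And>m n. m \<ge> M \<Longrightarrow> n \<ge> M \<Longrightarrow> dist (z m) (z n) < l * e"
        using metric_CauchyD[OF LIMSEQ_imp_Cauchy[OF z], of "l * e"] l by auto
      have "dist (y m) (y n) < e" if "m \<ge> M" "n \<ge> M" for m n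
      proof -
        have "l * dist (y m) (y n) < l * e"
          using low[OF Ldiff[OF y y], of m n] M[OF that] by (simp add: dist_norm)
        then show ?thesis using l by simp
      qed
      then show "\<exists>M. \<forall>m\<ge>M. \<forall>n\<ge>M. dist (y m) (y n) < e" by blast
    qed
    then obtain y0 where "y \<longlonglongrightarrow> y0" by (auto simp: Cauchy_convergent_iff convergent_def)
    then have "(\<lambda>n. (y n, z n)) \<longlonglongrightarrow> (y0, z0)" using z by (rule tendsto_Pair)
    moreover have "closed L" using closed_op_adjoint[of L] by (simp add: adj)
    ultimately have "(y0, z0) \<in> L"
      using y closed_sequentially[of L "\<lambda>n. (y n, z n)"] by blast
    then show "z0 \<in> W" by (auto simp: W_def)
  qed
  ultimately have riesz: "\<exists>v\<in>W. \<forall>w\<in>W. z \<bullet> w = v \<bullet> w" for z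
    by (intro riesz_on_closed_subspace bounded_linear_inner_right)
  have range: "z \<in> W" for z
  proof -
    obtain v where v: "v \<in> W" "\<And>w. w \<in> W \<Longrightarrow> z \<bullet> w = v \<bullet> w" using riesz by blast
    have "cinner (z - v) y = 0" if "(x, y) \<in> L" for x y
    proof -
      have "y \<in> W" "cnj \<i> *\<^sub>C y \<in> W"
        using that LscaleC[OF that, of "cnj \<i>"] by (auto simp: W_def)
      then show ?thesis
        using v(2) by (simp add: cinner_eq_inner inner_scaleC_left inner_diff_left complex_eq_iff)
    qed
    then have "(z - v, 0) \<in> op_adjoint L" by (auto simp: op_adjoint_def)
    then have "l * norm (z - v) \<le> 0" using low[of "z - v" 0] adj by simp
    then show ?thesis using l v(1) by (simp add: mult_le_0_iff)
  qed
  then have "\<forall>z. \<exists>y. (y, z) \<in> L" by (auto simp: W_def)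
  then obtain r where r: "\<And>z. (r z, z) \<in> L" by metis
  have uniq: "y = r z" if "(y, z) \<in> L" for y z
  proof -
    have "l * norm (y - r z) \<le> 0" using low[OF Ldiff[OF that r[of z]]] by simp
    then show ?thesis using l by (simp add: mult_le_0_iff)
  qed
  have r_add: "r (x + y) = r x + r y" for x y by (rule uniq[symmetric, OF Ladd[OF r r]])
  have r_scaleC: "r (c *\<^sub>C x) = c *\<^sub>C r x" for c x by (rule uniq[symmetric, OF LscaleC[OF r]])
  have r_scale: "r (c *\<^sub>R x) = c *\<^sub>R r x" for c x by (rule uniq[symmetric, OF Lscale[OF r]])
  have r_norm: "norm (r x) \<le> norm x * (1 / l)" for x
    using low[OF r[of x]] l by (simp add: pos_le_divide_eq mult.commute)
  have "bounded_linear r"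
    by (rule bounded_linear_intro[where K = "1 / l"]) (use r_add r_scale r_norm in auto)
  then have R: "blinfun_apply (Blinfun r) = r" by (rule bounded_linear_Blinfun_apply)
  show thesis
  proof
    show "(y, z) \<in> L \<longleftrightarrow> y = Blinfun r z" for y z unfolding R using r uniq by auto
    show "Blinfun r x \<bullet> y = x \<bullet> Blinfun r y" for x y
    proof -
      have "(r x, x) \<in> op_adjoint L" using r by (simp add: adj)
      then have "cinner (r x) y = cinner x (r y)" using r[of y] by (auto simp: op_adjoint_def)
      then show ?thesis unfolding R by (simp add: inner_L2_def)
    qed
    show "Blinfun r (c *\<^sub>C x) = c *\<^sub>C Blinfun r x" for c x unfolding R by (rule r_scaleC)
    have ge_r: "l * (norm (r x))\<^sup>2 \<le> r x \<bullet> x" for x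
      using ge r[of x] by (auto simp: form_ge_def inner_L2_def)
    show "0 \<le> x \<bullet> Blinfun r x" for x
      unfolding R using ge_r[of x] l zero_le_power2[of "norm (r x)"]
      by (metis inner_commute less_imp_le mult_nonneg_nonneg order_trans)
    show "l * (x \<bullet> Blinfun r x) \<le> x \<bullet> x" for x
    proof -
      have "l * (x \<bullet> r x) \<le> l * (norm x * norm (r x))"
        using l by (intro mult_left_mono norm_cauchy_schwarz) auto
      also have "\<dots> \<le> norm x * norm x"
        using low[OF r[of x]] mult_left_mono[of "l * norm (r x)" "norm x" "norm x"] by (simp add: ac_simps)
      finally show ?thesis unfolding R by (simp add: norm_eq_sqrt_inner)
    qed
  qed
qed

section \<open>The spectral theorem for positive contractions\<close>

locale positive_contraction =
  fixes A :: "'b::brane L2 \<Rightarrow>\<^sub>L 'b L2"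
  assumes sym: "A x \<bullet> y = x \<bullet> A y" and complex_linear: "A (c *\<^sub>C x) = c *\<^sub>C A x"
    and pos: "0 \<le> x \<bullet> A x" and contr: "x \<bullet> A x \<le> x \<bullet> x"
begin

definition P :: "nat \<Rightarrow> 'b L2 \<Rightarrow> 'b L2" where "P k = (blinfun_apply A ^^ k)"

definition Q :: "nat \<Rightarrow> 'b L2 \<Rightarrow> 'b L2" where "Q j = ((\<lambda>x. x - A x) ^^ j)"

lemma P_simps [simp]: "P 0 x = x" "P (Suc k) x = A (P k x)"
  and Q_simps [simp]: "Q 0 x = x" "Q (Suc k) x = Q k x - A (Q k x)"
  by (simp_all add: P_def Q_def)

lemma P_A: "P k (A x) = A (P k x)" by (induction k) simp_all

lemma P_add: "P k (x + y) = P k x + P k y" by (induction k) (simp_all add: blinfun.add_right)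

lemma P_diff: "P k (x - y) = P k x - P k y" by (induction k) (simp_all add: blinfun.diff_right)

lemma P_scaleR: "P k (r *\<^sub>R x) = r *\<^sub>R P k x" by (induction k) (simp_all add: blinfun.scaleR_right)

lemma P_scaleC: "P k (c *\<^sub>C x) = c *\<^sub>C P k x" by (induction k) (simp_all add: complex_linear)

lemma P_P: "P k (P m x) = P (k + m) x" by (induction k) simp_all

lemma P_sym: "P k x \<bullet> y = x \<bullet> P k y"
  by (induction k arbitrary: x y) (simp_all add: sym P_A)

lemma Q_A: "Q j (A x) = A (Q j x)" by (induction j) (simp_all add: blinfun.diff_right)

lemma Q_diff: "Q j (x - y) = Q j x - Q j y"
  by (induction j) (simp_all add: blinfun.diff_right)

text \<open>
  Two equal factors can be moved to opposite sides of the inner product by symmetry. This leaves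
  the exponents \<open>0\<close> and \<open>1\<close>.
\<close>

lemma P_Q_nonneg: "0 \<le> x \<bullet> P k (Q j x)"
proof (induction "k + j" arbitrary: k j x rule: less_induct)
  case less
  have shift: "x \<bullet> P (Suc (Suc k)) (Q j x) = A x \<bullet> P k (Q j (A x))" for k j
    by (simp add: sym Q_A P_A)
  have shift': "x \<bullet> P k (Q (Suc (Suc j)) x) = (x - A x) \<bullet> P k (Q j (x - A x))" for k j
    by (simp add: inner_diff_left inner_diff_right sym P_diff Q_diff Q_A P_A blinfun.diff_right)
  consider (P) k' where "k = Suc (Suc k')" | (Q) j' where "j = Suc (Suc j')"
    | "k = 0" "j = 0" | "k = 1" "j = 0" | "k = 0" "j = 1" | "k = 1" "j = 1"
    by (cases k rule: nat.exhaust; cases j rule: nat.exhaust) (metis One_nat_def not0_implies_Suc)+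
  then show ?case
  proof cases
    case P
    then show ?thesis using less[of k' j "A x"] shift by simp
  next
    case Q
    then show ?thesis using less[of k j' "x - A x"] shift' by simp
  next
    case 6
    \<comment> \<open>\<open>A (1 - A) = A (1 - A) A + (1 - A) A (1 - A)\<close>\<close>
    have "x \<bullet> A (x - A x) = (A x \<bullet> A x - A x \<bullet> A (A x)) + (x - A x) \<bullet> A (x - A x)"
      by (simp add: inner_diff_left inner_diff_right sym blinfun.diff_right)
    moreover have "0 \<le> A x \<bullet> A x - A x \<bullet> A (A x)" using contr[of "A x"] by simp
    ultimately show ?thesis using 6 pos[of "x - A x"] by simp
  qed (use pos[of x] contr[of x] in \<open>auto simp: inner_diff_right\<close>)
qed

text \<open>
  The array \<open>x \<bullet> P k (Q j x)\<close> satisfies the hypotheses of the Hausdorff moment theorem, since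
  \<open>A + (1 - A) = 1\<close>.
\<close>

lemma vector_measure_exists:
  "\<exists>M. finite_measure M \<and> sets M = sets borel \<and> (AE t in M. t \<in> {0..1}) \<and> (\<forall>m. (\<integral>t. t ^ m \<partial>M) = x \<bullet> P m x)"
proof (cases "x = 0")
  case True
  have "P m (0 :: 'b L2) = 0" for m using P_scaleR[of m 0 0] by simp
  then show ?thesis
    using True by (intro exI[of _ "null_measure borel"])
      (auto intro!: finite_measureI AE_I'[of UNIV] simp: null_sets_def)
next
  case False
  define u where "u = (1 / norm x) *\<^sub>R x"
  have x: "x = norm x *\<^sub>R u" using False by (simp add: u_def)
  have "\<exists>M. real_distribution M \<and> (AE t in M. t \<in> {0..1}) \<and> (\<forall>m. (\<integral>t. t ^ m \<partial>M) = u \<bullet> P m (Q 0 u))"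
  proof (rule hausdorff_moment[of "\<lambda>k j. u \<bullet> P k (Q j u)"])
    show "u \<bullet> P k (Q j u) = u \<bullet> P (Suc k) (Q j u) + u \<bullet> P k (Q (Suc j) u)" for k j
      by (simp add: P_diff P_A inner_diff_right)
    show "u \<bullet> P 0 (Q 0 u) = 1" using False by (simp add: u_def power2_norm_eq_inner[symmetric] power2_eq_square[symmetric] power_divide)
  qed (rule P_Q_nonneg)
  then obtain M where M: "real_distribution M" "AE t in M. t \<in> {0..1}" "\<And>m. (\<integral>t. t ^ m \<partial>M) = u \<bullet> P m u"
    by auto
  interpret real_distribution M by (rule M(1))
  let ?N = "density M (\<lambda>_. ennreal ((norm x)\<^sup>2))"
  have "finite_measure ?N"
    by (rule finite_measureI) (simp add: emeasure_density nn_integral_const emeasure_space_1 ennreal_mult_eq_top_iff)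
  moreover have "(\<integral>t. t ^ m \<partial>?N) = x \<bullet> P m x" for m
  proof -
    have "(\<integral>t. t ^ m \<partial>?N) = (norm x)\<^sup>2 * (u \<bullet> P m u)"
      by (subst integral_density) (auto simp: M(3))
    also have "\<dots> = (norm x *\<^sub>R u) \<bullet> P m (norm x *\<^sub>R u)"
      unfolding P_scaleR by (simp add: power2_eq_square)
    finally show ?thesis using x by simp
  qed
  moreover have "AE t in ?N. t \<in> {0..1}"
    using M(2) by (subst AE_density) (auto elim: eventually_mono)
  ultimately show ?thesis by (intro exI[of _ ?N]) auto
qed

definition vector_measure :: "'b L2 \<Rightarrow> real measure" where
  "vector_measure x = (SOME M. finite_measure M \<and> sets M = sets borel \<and> (AE t in M. t \<in> {0..1}) \<and> (\<forall>m. (\<integral>t. t ^ m \<partial>M) = x \<bullet> P m x))"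

lemma vector_measure: "finite_measure (vector_measure x)" "sets (vector_measure x) = sets borel" "AE t in vector_measure x. t \<in> {0..1}"
  "(\<integral>t. t ^ m \<partial>vector_measure x) = x \<bullet> P m x"
  using someI_ex[OF vector_measure_exists[of x]] unfolding vector_measure_def by auto

definition I :: "'b L2 \<Rightarrow> (real \<Rightarrow> real) \<Rightarrow> real" where
  "I x f = (\<integral>t. indicator {0..1} t * f t \<partial>vector_measure x)"

lemma sigma_functional_I: "sigma_functional (I x)"
  unfolding I_def by (rule sigma_functional_measure[OF vector_measure(1,2)])

lemma I_monomial: "I x (unit_monomial m) = x \<bullet> P m x"
proof -
  note [measurable_cong] = vector_measure(2)
  have "I x (unit_monomial m) = (\<integral>t. t ^ m \<partial>vector_measure x)"
    unfolding I_def
    by (rule integral_cong_AE)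
      (use vector_measure(3)[of x] in \<open>auto simp: unit_monomial_def[abs_def] elim: eventually_mono\<close>)
  then show ?thesis by (simp add: vector_measure(4))
qed

text \<open>
  The polarisation of the measures at single vectors: integration against the real part of the
  complex measure \<open>B \<mapsto> \<langle>x, E B y\<rangle>\<close>, before the projections \<open>E B\<close> are available.
\<close>

definition \<Lambda> :: "'b L2 \<Rightarrow> 'b L2 \<Rightarrow> (real \<Rightarrow> real) \<Rightarrow> real" where
  "\<Lambda> x y f = (1/4) * (I (x + y) f - I (x - y) f)"

lemma sigma_functional_\<Lambda> [intro]: "sigma_functional (\<Lambda> x y)"
  unfolding \<Lambda>_def[abs_def] by (intro sigma_functional_scale sigma_functional_minus sigma_functional_I)

lemma \<Lambda>_monomial: "\<Lambda> x y (unit_monomial m) = x \<bullet> P m y"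
  using P_sym[of m y x]
  by (simp add: \<Lambda>_def I_monomial P_add P_diff inner_add_left inner_add_right inner_diff_left inner_diff_right
      inner_commute)

lemma functional_eqI:
  assumes "sigma_functional F" "sigma_functional G" "\<And>m. F (unit_monomial m) = G (unit_monomial m)"
    and "B \<in> sets borel"
  shows "F (indicator B) = G (indicator B)"
  using moments_determine_functional[OF sigma_functional_minus[OF assms(1,2)] _ assms(4)] assms(3) by simp

text \<open>
  In each case both sides are functionals with the same moments, by the algebra of the powers
  of \<open>A\<close>.
\<close>

lemma \<Lambda>_indicator:
  assumes B: "B \<in> sets borel"
  shows "\<Lambda> x (y + z) (indicator B) = \<Lambda> x y (indicator B) + \<Lambda> x z (indicator B)"
    and "\<Lambda> x (r *\<^sub>R y) (indicator B) = r * \<Lambda> x y (indicator B)"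
    and "\<Lambda> x y (indicator B) = \<Lambda> y x (indicator B)"
    and "\<Lambda> x (c *\<^sub>C y) (indicator B) = \<Lambda> (cnj c *\<^sub>C x) y (indicator B)"
    and "\<Lambda> x x (indicator B) = I x (indicator B)"
proof -
  show "\<Lambda> x (y + z) (indicator B) = \<Lambda> x y (indicator B) + \<Lambda> x z (indicator B)"
    by (rule functional_eqI[OF _ sigma_functional_plus _ B])
      (auto simp: \<Lambda>_monomial P_add inner_add_right)
  show "\<Lambda> x (r *\<^sub>R y) (indicator B) = r * \<Lambda> x y (indicator B)"
    by (rule functional_eqI[OF _ sigma_functional_scale _ B])
      (auto simp: \<Lambda>_monomial P_scaleR)
  show "\<Lambda> x y (indicator B) = \<Lambda> y x (indicator B)"
    by (rule functional_eqI[OF sigma_functional_\<Lambda> sigma_functional_\<Lambda> _ B], unfold \<Lambda>_monomial)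
      (metis P_sym inner_commute)
  show "\<Lambda> x (c *\<^sub>C y) (indicator B) = \<Lambda> (cnj c *\<^sub>C x) y (indicator B)"
    by (rule functional_eqI[OF _ _ _ B]) (auto simp: \<Lambda>_monomial P_scaleC inner_scaleC_left)
  show "\<Lambda> x x (indicator B) = I x (indicator B)"
    by (rule functional_eqI[OF _ sigma_functional_I _ B]) (auto simp: \<Lambda>_monomial I_monomial)
qed

lemma I_indicator:
  assumes B: "B \<in> sets borel" shows "I x (indicator B) = measure (vector_measure x) B" "I x (indicator B) \<le> (norm x)\<^sup>2"
proof -
  interpret finite_measure "vector_measure x" by (rule vector_measure(1))
  note [measurable_cong] = vector_measure(2)
  have sp: "space (vector_measure x) = UNIV" using sets_eq_imp_space_eq[OF vector_measure(2)] by simp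
  have "I x (indicator B) = (\<integral>t. indicator B t \<partial>vector_measure x)"
    unfolding I_def using B
    by (intro integral_cong_AE) (use vector_measure(3)[of x] in \<open>auto elim: eventually_mono\<close>)
  then show eq: "I x (indicator B) = measure (vector_measure x) B" using B by (simp add: vector_measure(2) sp)
  have "measure (vector_measure x) B \<le> measure (vector_measure x) (space (vector_measure x))" by (rule bounded_measure)
  also have "\<dots> = (norm x)\<^sup>2" using vector_measure(4)[of x 0] by (simp add: power2_norm_eq_inner)
  finally show "I x (indicator B) \<le> (norm x)\<^sup>2" by (simp add: eq)
qed

lemma \<Lambda>_bound:
  assumes B: "B \<in> sets borel" shows "\<bar>\<Lambda> x y (indicator B)\<bar> \<le> norm x * norm y"
proof -
  have unit: "\<bar>\<Lambda> u v (indicator B)\<bar> \<le> 1" if "norm u = 1" "norm v = 1" for u v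
  proof -
    have "(norm (u + v))\<^sup>2 + (norm (u - v))\<^sup>2 = 4"
      using that by (simp add: power2_norm_eq_inner inner_add_left inner_add_right inner_diff_left
          inner_diff_right norm_eq_1)
    moreover have "0 \<le> I z (indicator B)" for z using I_indicator(1)[OF B] by simp
    ultimately show ?thesis
      using I_indicator(2)[OF B, of "u + v"] I_indicator(2)[OF B, of "u - v"]
      by (simp add: \<Lambda>_def abs_le_iff) (smt (verit))
  qed
  have scale: "\<Lambda> (norm x *\<^sub>R u) (norm y *\<^sub>R v) (indicator B) = norm x * norm y * \<Lambda> u v (indicator B)" for u v
    using \<Lambda>_indicator(2,3)[OF B] by (metis mult.assoc mult.commute)
  show ?thesis
  proof (cases "x = 0 \<or> y = 0")
    case True
    have "\<Lambda> x y (indicator B) = 0" using scale[of x y] True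
      by (metis \<Lambda>_indicator(2,3)[OF B] mult_zero_left scaleR_zero_left)
    then show ?thesis by simp
  next
    case False
    then have "x = norm x *\<^sub>R sgn x" "y = norm y *\<^sub>R sgn y" by (simp_all add: sgn_div_norm)
    then have "\<Lambda> x y (indicator B) = norm x * norm y * \<Lambda> (sgn x) (sgn y) (indicator B)"
      using scale by metis
    then show ?thesis
      using unit[of "sgn x" "sgn y"] False by (simp add: abs_mult norm_sgn mult_left_le)
  qed
qed

lemma spectral_operator_exists:
  assumes B: "B \<in> sets borel"
  shows "\<exists>T :: 'b L2 \<Rightarrow>\<^sub>L 'b L2. \<forall>x y. x \<bullet> T y = \<Lambda> x y (indicator B)"
proof -
  have "\<exists>v. \<forall>x. \<Lambda> x y (indicator B) = v \<bullet> x" for y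
  proof -
    have "bounded_linear (\<lambda>x. \<Lambda> x y (indicator B))"
    proof (rule bounded_linear_intro[where K = "norm y"])
      fix x z r
      show "\<Lambda> (x + z) y (indicator B) = \<Lambda> x y (indicator B) + \<Lambda> z y (indicator B)"
        using \<Lambda>_indicator(1,3)[OF B] by metis
      show "\<Lambda> (r *\<^sub>R x) y (indicator B) = r *\<^sub>R \<Lambda> x y (indicator B)"
        using \<Lambda>_indicator(2,3)[OF B] by (metis real_scaleR_def)
      show "norm (\<Lambda> x y (indicator B)) \<le> norm x * norm y"
        using \<Lambda>_bound[OF B] by simp
    qed
    then show ?thesis
      using riesz_on_closed_subspace[OF subspace_UNIV closed_UNIV] by blast
  qed
  then obtain t where t: "\<And>x y. \<Lambda> x y (indicator B) = t y \<bullet> x" by metis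
  have "bounded_linear t"
  proof (rule bounded_linear_intro[where K = 1])
    fix x y r
    show "t (x + y) = t x + t y"
      by (rule inner_eq_imp_eq) (simp add: inner_add_right inner_commute[of _ "t _"] t[symmetric] \<Lambda>_indicator(1)[OF B])
    show "t (r *\<^sub>R x) = r *\<^sub>R t x"
      by (rule inner_eq_imp_eq) (simp add: inner_commute[of _ "t _"] t[symmetric] \<Lambda>_indicator(2)[OF B])
    have "t x \<bullet> t x \<le> norm (t x) * norm x"
      using \<Lambda>_bound[OF B, of "t x" x] by (simp add: t)
    then have "norm (t x) * norm (t x) \<le> norm (t x) * norm x"
      by (simp add: power2_norm_eq_inner[symmetric] power2_eq_square)
    then show "norm (t x) \<le> norm x * 1"
      by (cases "norm (t x) = 0") auto
  qed
  then show ?thesis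
    by (intro exI[of _ "Blinfun t"]) (simp add: bounded_linear_Blinfun_apply t inner_commute)
qed

definition E :: "real set \<Rightarrow> 'b L2 \<Rightarrow>\<^sub>L 'b L2" where
  "E B = (SOME T. \<forall>x y. x \<bullet> blinfun_apply T y = \<Lambda> x y (indicator B))"

lemma E: "B \<in> sets borel \<Longrightarrow> x \<bullet> E B y = \<Lambda> x y (indicator B)"
  using someI_ex[OF spectral_operator_exists[of B]] unfolding E_def by blast

lemma E_symm: "B \<in> sets borel \<Longrightarrow> E B x \<bullet> y = x \<bullet> E B y"
  using E \<Lambda>_indicator(3) by (metis inner_commute)

text \<open>
  Multiplicativity comes in two steps. Moving \<open>A\<^sup>n\<close> into the vector multiplies the signed measure by
  \<open>t\<^sup>n\<close>; this computes the moments that show, in the next lemma, that moving \<open>E B\<close> into the vector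
  restricts the measure to \<open>B\<close>.
\<close>

lemma E_mult_monomial:
  assumes B: "B \<in> sets borel"
  shows "x \<bullet> E B (P n y) = \<Lambda> x y (\<lambda>t. unit_monomial n t * indicator B t)"
proof -
  have "\<Lambda> x (P n y) (indicator B) = \<Lambda> x y (\<lambda>t. unit_monomial n t * indicator B t)"
  proof (rule functional_eqI[OF _ sigma_functional_mult _ B])
    fix m
    have "(\<lambda>t. unit_monomial n t * unit_monomial m t) = unit_monomial (m + n)"
      by (auto simp: unit_monomial_def indicator_def power_add)
    then show "\<Lambda> x (P n y) (unit_monomial m) = \<Lambda> x y (\<lambda>t. unit_monomial n t * unit_monomial m t)"
      by (simp add: \<Lambda>_monomial P_P)
  qed auto
  then show ?thesis by (simp add: E[OF B])
qed

lemma E_mult: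
  assumes B: "B \<in> sets borel" and C: "C \<in> sets borel"
  shows "E B (E C y) = E (B \<inter> C) y"
proof (rule inner_eq_imp_eq)
  fix x
  have "x \<bullet> E B (E C y) = \<Lambda> (E B x) y (indicator C)"
    by (simp add: E_symm[OF B, symmetric] E[OF C])
  also have "\<dots> = \<Lambda> x y (\<lambda>t. indicator B t * indicator C t)"
  proof (rule functional_eqI[OF _ sigma_functional_mult _ C])
    fix m
    show "\<Lambda> (E B x) y (unit_monomial m) = \<Lambda> x y (\<lambda>t. indicator B t * unit_monomial m t)"
      using E_mult_monomial[OF B, of x m y] by (simp add: \<Lambda>_monomial E_symm[OF B] mult.commute)
  qed (use B in auto)
  also have "(\<lambda>t. indicator B t * indicator C t) = (indicator (B \<inter> C) :: real \<Rightarrow> real)"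
    by (auto simp: indicator_def)
  finally show "x \<bullet> E B (E C y) = x \<bullet> E (B \<inter> C) y" using B C by (simp add: E)
qed

lemma E_scaleC: assumes B: "B \<in> sets borel" shows "E B (c *\<^sub>C x) = c *\<^sub>C E B x"
proof (rule inner_eq_imp_eq)
  fix y
  show "y \<bullet> E B (c *\<^sub>C x) = y \<bullet> c *\<^sub>C E B x"
    using inner_scaleC_left[of "cnj c" y "E B x"] by (simp add: E[OF B] \<Lambda>_indicator(4)[OF B])
qed

lemma norm_E: assumes B: "B \<in> sets borel" shows "(norm (E B x))\<^sup>2 = I x (indicator B)"
proof -
  have "(norm (E B x))\<^sup>2 = x \<bullet> E B x"
    by (simp add: power2_norm_eq_inner E_symm[OF B] E_mult[OF B B])
  then show ?thesis by (simp add: E[OF B] \<Lambda>_indicator(5)[OF B])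
qed

lemma pvm_E: "pvm E"
proof
  show "projection_valued_measure E"
    unfolding projection_valued_measure_def
  proof (intro conjI ballI allI impI)
    fix B :: "real set" and x y assume B: "B \<in> sets borel"
    show "cinner (E B x) y = cinner x (E B y)"
      by (simp add: cinner_eq_inner E_symm[OF B] E_scaleC[OF B, symmetric])
  next
    fix B C :: "real set" and x assume "B \<in> sets borel" "C \<in> sets borel"
    then show "E (B \<inter> C) x = E B (E C x)" by (simp add: E_mult)
  next
    show "E {} = 0"
    proof (rule blinfun_eqI)
      fix x
      have "I x (indicator {}) = 0" by (simp add: I_def)
      then show "E {} x = (0 :: 'b L2 \<Rightarrow>\<^sub>L 'b L2) x" using norm_E[of "{}" x] by simp
    qed
  next
    show "E UNIV = id_blinfun"
    proof (rule blinfun_eqI, rule inner_eq_imp_eq)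
      fix x y
      have "\<Lambda> y x (indicator UNIV) = \<Lambda> y x (unit_monomial 0)"
        by (rule sigma_functional_cong[OF sigma_functional_\<Lambda>]) (simp add: unit_monomial_def)
      then show "y \<bullet> E UNIV x = y \<bullet> id_blinfun x" by (simp add: E \<Lambda>_monomial)
    qed
  next
    fix B :: "nat \<Rightarrow> real set" and x
    assume "range B \<subseteq> sets borel" and disj: "disjoint_family B"
    then have B: "B i \<in> sets borel" for i by auto
    \<comment> \<open>The squared norm of the remainder is the measure of the remaining set, so additivity is strong.\<close>
    define R where "R n = (\<Union>i. B i) - (\<Union>i<n. B i)" for n :: nat
    have R: "R n \<in> sets borel" for n using B by (auto simp: R_def)
    have diff: "E (\<Union>i. B i) x - (\<Sum>i<n. E (B i) x) = E (R n) x" for n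
    proof (rule inner_eq_imp_eq)
      fix y
      have "\<Lambda> y x (indicator (\<Union>i. B i)) = \<Lambda> y x (\<lambda>t. indicator (R n) t + (\<Sum>i<n. indicator (B i) t))"
      proof (rule arg_cong[of _ _ "\<Lambda> y x"], rule ext)
        fix t
        have "(\<Sum>i<n. indicator (B i) t) = (indicator (\<Union>i<n. B i) t :: real)"
          using disj by (subst indicator_UN_disjoint) (auto simp: disjoint_family_on_def)
        then show "indicator (\<Union>i. B i) t = indicator (R n) t + (\<Sum>i<n. indicator (B i) t :: real)"
          by (auto simp: R_def indicator_def)
      qed
      also have "\<dots> = \<Lambda> y x (indicator (R n)) + (\<Sum>i<n. \<Lambda> y x (indicator (B i)))"
        using sigma_functional_sum[OF sigma_functional_\<Lambda>, of "{..<n}" "\<lambda>i. indicator (B i)" y x] B R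
        by (subst sigma_functional_add[OF sigma_functional_\<Lambda>]) auto
      finally show "y \<bullet> (E (\<Union>i. B i) x - (\<Sum>i<n. E (B i) x)) = y \<bullet> E (R n) x"
        using B R by (simp add: inner_diff_right inner_sum_right E)
    qed
    have "(\<lambda>n. I x (indicator (R n))) \<longlonglongrightarrow> I x (\<lambda>_. 0)"
    proof (rule sigma_functional_lim[OF sigma_functional_I, of _ 1])
      fix t
      show "(\<lambda>n. indicator (R n) t :: real) \<longlonglongrightarrow> 0"
      proof (cases "t \<in> (\<Union>i. B i)")
        case True
        then obtain i where "t \<in> B i" by blast
        then have "t \<notin> R n" if "Suc i \<le> n" for n
          using that unfolding R_def by (blast intro: lessThan_iff[THEN iffD2] Suc_le_lessD)
        then have "\<forall>\<^sub>F n in sequentially. indicator (R n) t = (0::real)"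
          by (auto simp: eventually_sequentially intro!: exI[of _ "Suc i"])
        then show ?thesis by (rule tendsto_eventually)
      qed (simp add: R_def)
    qed (use R in \<open>auto simp: indicator_def\<close>)
    then have "(\<lambda>n. sqrt ((norm (E (R n) x))\<^sup>2)) \<longlonglongrightarrow> sqrt 0"
      unfolding norm_E[OF R] by (intro tendsto_real_sqrt) (simp add: I_def)
    then have "(\<lambda>n. E (\<Union>i. B i) x - (\<Sum>i<n. E (B i) x)) \<longlonglongrightarrow> 0"
      by (simp add: diff tendsto_norm_zero_iff)
    from tendsto_diff[OF tendsto_const this, of "E (\<Union>i. B i) x"]
    show "(\<lambda>n. E (B n) x) sums E (\<Union>n. B n) x" by (simp add: sums_def)
  qed
qed

sublocale E: pvm E by (rule pvm_E)

lemma W_eq_vector_measure: "E.W x = vector_measure x"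
proof (rule measure_eqI)
  interpret finite_measure "vector_measure x" by (rule vector_measure(1))
  fix B assume "B \<in> sets (E.W x)"
  then have B: "B \<in> sets borel" by simp
  then show "emeasure (E.W x) B = emeasure (vector_measure x) B"
    by (simp add: E.emeasure_W E \<Lambda>_indicator(5) I_indicator(1) emeasure_eq_measure)
qed (simp add: vector_measure(2))

end

section \<open>Existence of the spectral measure\<close>

lemma borel_vimage: "g \<in> borel_measurable borel \<Longrightarrow> B \<in> sets borel \<Longrightarrow> g -` B \<in> sets (borel :: real measure)"
  using measurable_sets[of g borel borel B] by simp

lemma pvm_vimage:
  assumes "pvm E" and g: "g \<in> borel_measurable borel"
  shows "pvm (\<lambda>B. E (g -` B))"
    and "spectral_weight (\<lambda>B. E (g -` B)) x = distr (spectral_weight E x) borel g"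
proof -
  interpret pvm E by fact
  note [measurable] = g
  show "pvm (\<lambda>B. E (g -` B))"
  proof
    show "projection_valued_measure (\<lambda>B. E (g -` B))"
      unfolding projection_valued_measure_def
    proof (intro conjI ballI allI impI)
      fix B :: "real set" and x y :: "'a L2" assume "B \<in> sets borel"
      then show "cinner (E (g -` B) x) y = cinner x (E (g -` B) y)"
        using pvm borel_vimage[OF g] by (simp add: projection_valued_measure_def)
    next
      fix B C :: "real set" and x assume "B \<in> sets borel" "C \<in> sets borel"
      then show "E (g -` (B \<inter> C)) x = E (g -` B) (E (g -` C) x)"
        by (simp add: E_Int borel_vimage[OF g] vimage_Int)
    next
      fix B :: "nat \<Rightarrow> real set" and x assume B: "range B \<subseteq> sets borel" "disjoint_family B"
      have "(\<lambda>n. E (g -` B n) x) sums E (\<Union>n. g -` B n) x"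
        using B borel_vimage[OF g] by (intro E_sums) (auto simp: disjoint_family_on_def)
      then show "(\<lambda>n. E (g -` B n) x) sums E (g -` (\<Union>n. B n)) x" by (simp add: vimage_UN)
    qed simp_all
  qed
  then interpret E': pvm "\<lambda>B. E (g -` B)" .
  show "spectral_weight (\<lambda>B. E (g -` B)) x = distr (W x) borel g"
    by (rule measure_eqI) (simp_all add: E'.emeasure_W emeasure_distr emeasure_W borel_vimage[OF g])
qed

text \<open>
  The contraction \<open>l *\<^sub>R L\<inverse>\<close> has a spectral measure on \<open>[0, 1]\<close>, with no mass at \<open>0\<close> because the
  contraction is injective. Its image under \<open>u \<mapsto> l / u\<close> lives on \<open>[l, \<infinity>)\<close> and has the inverse of
  \<open>L\<close> as its resolvent at \<open>0\<close>, which identifies its spectral integral with \<open>L\<close>.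
\<close>

theorem spectral_measure_exists:
  fixes L :: "'b::brane L2 rel"
  assumes sa: "self_adjoint L" and l: "l > 0" and ge: "form_ge L l"
  shows "\<exists>E. projection_valued_measure E \<and> spectral_integral E (\<lambda>t. t) = L"
proof -
  obtain R :: "'b L2 \<Rightarrow>\<^sub>L 'b L2" where R: "\<And>y z. (y, z) \<in> L \<longleftrightarrow> y = R z"
    "\<And>x y. R x \<bullet> y = x \<bullet> R y" "\<And>c x. R (c *\<^sub>C x) = c *\<^sub>C R x"
    "\<And>x. 0 \<le> x \<bullet> R x" "\<And>x. l * (x \<bullet> R x) \<le> x \<bullet> x"
    using self_adjoint_inverse[OF assms] by blast
  interpret A: positive_contraction "l *\<^sub>R R"
    by unfold_locales (use R l in \<open>auto simp: blinfun.scaleR_left scaleC_scaleR\<close>)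
  have PhiA: "A.E.Phi (unit_monomial 1) = l *\<^sub>R R"
  proof (rule A.E.Phi_eqI[OF _ A.sym])
    fix x
    note [measurable_cong] = A.vector_measure(2)
    have "(\<integral>t. unit_monomial 1 t \<partial>A.vector_measure x) = (\<integral>t. t ^ 1 \<partial>A.vector_measure x)"
      by (rule integral_cong_AE)
        (use A.vector_measure(3)[of x] in \<open>auto simp: unit_monomial_def[abs_def] elim: eventually_mono\<close>)
    then show "x \<bullet> (l *\<^sub>R R) x = (\<integral>t. unit_monomial 1 t \<partial>A.E.W x)"
      by (simp only: A.W_eq_vector_measure A.vector_measure(4)) simp
  qed simp
  have E0: "A.E {0} = 0"
  proof (rule blinfun_eqI)
    fix x
    have "(\<lambda>t. unit_monomial 1 t * indicator {0} t) = (\<lambda>t. 0 * 1 :: real)"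
      by (auto simp: unit_monomial_def indicator_def)
    then have "(l *\<^sub>R R) (A.E {0} x) = A.E.Phi (\<lambda>t. 0 * 1) x"
      using A.E.Phi_mult[of "unit_monomial 1" "indicator {0}" x]
      by (simp add: PhiA A.E.Phi_indicator bounded_borel_indicator del: One_nat_def)
    also have "\<dots> = 0" using A.E.Phi_scale[of "\<lambda>_. 1" 0] by simp
    finally have "R (A.E {0} x) = 0" using l by (simp add: blinfun.scaleR_left)
    then have "(0, A.E {0} x) \<in> L" "(0, 0) \<in> L" by (simp_all add: R(1))
    then show "A.E {0} x = (0 :: 'b L2 \<Rightarrow>\<^sub>L 'b L2) x"
      using sa by (auto simp: self_adjoint_def linear_operator_def single_valued_def)
  qed
  have AE01: "AE t in A.E.W x. t \<in> {0<..1}" for x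
  proof -
    have "AE t in A.E.W x. t \<in> {0..1}" unfolding A.W_eq_vector_measure by (rule A.vector_measure(3))
    moreover have "AE t in A.E.W x. t \<notin> {0}"
      by (subst AE_iff_measurable[of "{0}"]) (auto simp: A.E.emeasure_W E0)
    ultimately show ?thesis by eventually_elim auto
  qed
  define g :: "real \<Rightarrow> real" where "g u = l / u" for u
  have g [measurable]: "g \<in> borel_measurable borel" unfolding g_def by measurable
  define F where "F B = A.E (g -` B)" for B
  interpret F: pvm F unfolding F_def by (rule pvm_vimage(1)[OF A.pvm_E g])
  have W: "F.W x = distr (A.E.W x) borel g" for x
    unfolding F_def by (rule pvm_vimage(2)[OF A.pvm_E g])
  have supp: "F {..<l} = 0"
  proof (rule blinfun_eqI)
    fix x
    have "AE t in A.E.W x. t \<notin> g -` {..<l}"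
      using AE01[of x] by eventually_elim (use l in \<open>auto simp: g_def field_simps\<close>)
    then have "emeasure (A.E.W x) (g -` {..<l}) = 0"
      by (subst (asm) AE_iff_measurable[of "g -` {..<l}"]) (auto simp: borel_vimage[OF g])
    then have "(norm (F {..<l} x))\<^sup>2 = 0"
      by (simp add: F.norm_E_measure W measure_def emeasure_distr)
    then show "F {..<l} x = (0 :: 'b L2 \<Rightarrow>\<^sub>L 'b L2) x" by simp
  qed
  have si: "bounded_borel (shifted_inverse l 0)" using l by (intro bounded_borel_shifted_inverse) auto
  note [measurable] = bounded_borel_measurable[OF si]
  have "F.Phi (shifted_inverse l 0) = R"
  proof (rule F.Phi_eqI[OF si R(2)])
    fix x
    have "(\<integral>t. shifted_inverse l 0 t \<partial>F.W x) = (\<integral>u. shifted_inverse l 0 (g u) \<partial>A.E.W x)"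
      unfolding W by (rule integral_distr) auto
    also have "\<dots> = (\<integral>u. (1 / l) * unit_monomial 1 u \<partial>A.E.W x)"
    proof (rule integral_cong_AE)
      show "AE u in A.E.W x. shifted_inverse l 0 (g u) = (1 / l) * unit_monomial 1 u"
        using AE01[of x]
        by eventually_elim (use l in \<open>auto simp: shifted_inverse_def g_def unit_monomial_def indicator_def field_simps\<close>)
    qed (use bounded_borel_measurable[OF bounded_borel_unit_monomial] in auto)
    also have "\<dots> = x \<bullet> R x"
      using A.E.Phi_inner[of "unit_monomial 1" x] l by (simp add: PhiA blinfun.scaleR_left divide_eq_eq mult.commute del: One_nat_def)
    finally show "x \<bullet> R x = (\<integral>t. shifted_inverse l 0 t \<partial>F.W x)" by simp
  qed
  then have "(y, z) \<in> spectral_integral F (\<lambda>t. t) \<longleftrightarrow> (y, z) \<in> L" for y z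
    using F.op_shift_spectral_integral_iff[OF supp l order_refl, of y z] by (simp add: R(1))
  then have "spectral_integral F (\<lambda>t. t) = L" by auto
  with F.pvm show ?thesis by blast
qed

section \<open>The momentum integral\<close>

lemma nn_integral_gaussian:
  assumes u: "u > 0"
  shows "(\<integral>\<^sup>+x. ennreal (exp (- u * x\<^sup>2)) \<partial>lborel) = ennreal (sqrt (pi / u))"
proof -
  define \<sigma> where "\<sigma> = sqrt (1 / (2 * u))"
  have \<sigma>: "\<sigma> > 0" "\<sigma>\<^sup>2 = 1 / (2 * u)" using u by (simp_all add: \<sigma>_def)
  have "exp (- u * x\<^sup>2) = sqrt (pi / u) * normal_density 0 \<sigma> x" for x
    using u by (simp add: normal_density_def \<sigma>(2))
  then have "(\<integral>\<^sup>+x. ennreal (exp (- u * x\<^sup>2)) \<partial>lborel)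
      = (\<integral>\<^sup>+x. ennreal (sqrt (pi / u)) * ennreal (normal_density 0 \<sigma> x) \<partial>lborel)"
    using u by (simp add: ennreal_mult)
  also have "\<dots> = ennreal (sqrt (pi / u)) * (\<integral>\<^sup>+x. ennreal (normal_density 0 \<sigma> x) \<partial>lborel)"
    by (rule nn_integral_cmult) measurable
  also have "(\<integral>\<^sup>+x. ennreal (normal_density 0 \<sigma> x) \<partial>lborel) = ennreal 1"
    using \<sigma>(1) by (subst nn_integral_eq_integral) auto
  finally show ?thesis by simp
qed

lemma nn_integral_gaussian_R3:
  assumes u: "u > 0"
  shows "(\<integral>\<^sup>+q. ennreal (exp (- u * (norm (q::real^3))\<^sup>2)) \<partial>lborel) = ennreal ((pi / u) powr (3/2))"
proof -
  have "ennreal (exp (- u * (norm q)\<^sup>2)) = (\<Prod>b\<in>Basis. ennreal (exp (- u * (q \<bullet> b)\<^sup>2)))" for q :: "real^3"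
  proof -
    have "(norm q)\<^sup>2 = (\<Sum>b\<in>Basis. (q \<bullet> b)\<^sup>2)"
      unfolding power2_norm_eq_inner by (subst euclidean_inner) (simp add: power2_eq_square)
    then show ?thesis
      by (simp add: sum_distrib_left exp_sum prod_ennreal sum_negf[symmetric])
  qed
  then have "(\<integral>\<^sup>+q. ennreal (exp (- u * (norm (q::real^3))\<^sup>2)) \<partial>lborel)
      = (\<Prod>b\<in>(Basis :: (real^3) set). \<integral>\<^sup>+x. ennreal (exp (- u * x\<^sup>2)) \<partial>lborel)"
    by (simp only:) (rule nn_integral_lborel_prod, auto)
  also have "\<dots> = ennreal (sqrt (pi / u) ^ 3)"
    unfolding nn_integral_gaussian[OF u] using u by (simp add: ennreal_power)
  also have "sqrt (pi / u) ^ 3 = (pi / u) powr (3/2)"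
    using u by (simp add: powr_half_sqrt[symmetric] powr_realpow[symmetric] powr_powr)
  finally show ?thesis .
qed

lemma nn_integral_Gamma_scaled:
  assumes a: "a > 0" and t: "t > 0"
  shows "(\<integral>\<^sup>+v. ennreal (indicator {0<..} v * (v powr (a - 1) * exp (- v * t))) \<partial>lborel)
    = ennreal (Gamma a * t powr (- a))"
proof -
  have "ennreal (Gamma a) = (\<integral>\<^sup>+v. ennreal (indicator {0..} v * v powr (a - 1) / exp v) \<partial>lborel)"
    by (rule Gamma_conv_nn_integral_real[OF a])
  also have "\<dots> = ennreal t * (\<integral>\<^sup>+v. ennreal (indicator {0..} (0 + t * v) * (0 + t * v) powr (a - 1) / exp (0 + t * v)) \<partial>lborel)"
    using t by (subst nn_integral_real_affine[where c = t and t = 0]) auto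
  also have "(\<integral>\<^sup>+v. ennreal (indicator {0..} (0 + t * v) * (0 + t * v) powr (a - 1) / exp (0 + t * v)) \<partial>lborel)
      = (\<integral>\<^sup>+v. ennreal (t powr (a - 1)) * ennreal (indicator {0<..} v * (v powr (a - 1) * exp (- v * t))) \<partial>lborel)"
  proof (rule nn_integral_cong)
    fix v
    show "ennreal (indicator {0..} (0 + t * v) * (0 + t * v) powr (a - 1) / exp (0 + t * v))
        = ennreal (t powr (a - 1)) * ennreal (indicator {0<..} v * (v powr (a - 1) * exp (- v * t)))"
    proof (cases "v > 0")
      case True
      then show ?thesis
        using t by (simp add: ennreal_mult[symmetric] powr_mult exp_minus divide_inverse mult.commute[of v t] mult.assoc)
    next
      case False
      then have "indicator {0..} (t * v) * (t * v) powr (a - 1) = 0"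
        using t by (auto simp: indicator_def zero_le_mult_iff)
      then show ?thesis using False by simp
    qed
  qed
  also have "\<dots> = ennreal (t powr (a - 1)) * (\<integral>\<^sup>+v. ennreal (indicator {0<..} v * (v powr (a - 1) * exp (- v * t))) \<partial>lborel)"
    by (rule nn_integral_cmult) measurable
  finally have "ennreal (Gamma a) = ennreal (t powr a) * (\<integral>\<^sup>+v. ennreal (indicator {0<..} v * (v powr (a - 1) * exp (- v * t))) \<partial>lborel)"
    using t powr_add[of t 1 "a - 1"] by (simp add: mult.assoc[symmetric] ennreal_mult[symmetric])
  then have "ennreal (t powr (- a)) * ennreal (Gamma a)
      = (ennreal (t powr (- a)) * ennreal (t powr a)) * (\<integral>\<^sup>+v. ennreal (indicator {0<..} v * (v powr (a - 1) * exp (- v * t))) \<partial>lborel)"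
    by (simp add: mult.assoc)
  also have "ennreal (t powr (- a)) * ennreal (t powr a) = 1"
    using t by (simp add: ennreal_mult[symmetric] powr_add[symmetric])
  finally show ?thesis
    using Gamma_real_pos[OF a] by (simp add: ennreal_mult mult.commute)
qed

lemma nn_integral_momentum_power:
  assumes t: "t > 0" and s: "s > 3/2"
  shows "(\<integral>\<^sup>+q. ennreal ((t + (norm (q::real^3))\<^sup>2) powr (- s)) \<partial>lborel)
    = ennreal ((2 * pi) ^ 3 * (C3 s * t powr (3/2 - s)))"
proof -
  let ?I = "\<integral>\<^sup>+q. ennreal ((t + (norm (q::real^3))\<^sup>2) powr (- s)) \<partial>lborel"
  have G: "Gamma s > 0" using s by (intro Gamma_real_pos) simp
  have "ennreal (Gamma s) * ?I = (\<integral>\<^sup>+q. ennreal (Gamma s * (t + (norm (q::real^3))\<^sup>2) powr (- s)) \<partial>lborel)"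
    using G by (simp add: ennreal_mult nn_integral_cmult)
  \<comment> \<open>Schwinger's parametrisation turns the power into Gaussians in \<open>q\<close>.\<close>
  also have "\<dots> = (\<integral>\<^sup>+q. \<integral>\<^sup>+v. ennreal (indicator {0<..} v * (v powr (s - 1) * exp (- v * (t + (norm (q::real^3))\<^sup>2)))) \<partial>lborel \<partial>lborel)"
    using s t by (intro nn_integral_cong nn_integral_Gamma_scaled[symmetric]) (auto simp: add_pos_nonneg)
  also have "\<dots> = (\<integral>\<^sup>+v. \<integral>\<^sup>+q. ennreal (indicator {0<..} v * (v powr (s - 1) * exp (- v * (t + (norm (q::real^3))\<^sup>2)))) \<partial>lborel \<partial>lborel)"
    by (rule lborel_pair.Fubini'[symmetric]) measurable
  also have "\<dots> = (\<integral>\<^sup>+v. ennreal (pi powr (3/2)) * ennreal (indicator {0<..} v * (v powr ((s - 3/2) - 1) * exp (- v * t))) \<partial>lborel)"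
  proof (rule nn_integral_cong)
    fix v :: real
    show "(\<integral>\<^sup>+q. ennreal (indicator {0<..} v * (v powr (s - 1) * exp (- v * (t + (norm (q::real^3))\<^sup>2)))) \<partial>lborel)
      = ennreal (pi powr (3/2)) * ennreal (indicator {0<..} v * (v powr ((s - 3/2) - 1) * exp (- v * t)))"
    proof (cases "v > 0")
      case True
      have "(\<integral>\<^sup>+q. ennreal (indicator {0<..} v * (v powr (s - 1) * exp (- v * (t + (norm (q::real^3))\<^sup>2)))) \<partial>lborel)
          = (\<integral>\<^sup>+q. ennreal (v powr (s - 1) * exp (- v * t)) * ennreal (exp (- v * (norm (q::real^3))\<^sup>2)) \<partial>lborel)"
        using True by (intro nn_integral_cong) (simp add: ennreal_mult[symmetric] distrib_left exp_add[symmetric])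
      also have "\<dots> = ennreal (v powr (s - 1) * exp (- v * t)) * ennreal ((pi / v) powr (3/2))"
        by (simp only: nn_integral_gaussian_R3[OF True, symmetric]) (rule nn_integral_cmult, measurable)
      also have "\<dots> = ennreal (pi powr (3/2)) * ennreal (v powr (s - 1) * v powr (- (3/2)) * exp (- v * t))"
        using True by (simp add: ennreal_mult[symmetric] powr_divide powr_minus_divide)
      also have "v powr (s - 1) * v powr (- (3/2)) = v powr ((s - 3/2) - 1)"
        by (simp add: powr_add[symmetric])
      finally show ?thesis using True by simp
    qed simp
  qed
  also have "\<dots> = ennreal (pi powr (3/2)) * (\<integral>\<^sup>+v. ennreal (indicator {0<..} v * (v powr ((s - 3/2) - 1) * exp (- v * t))) \<partial>lborel)"
    by (rule nn_integral_cmult) measurable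
  also have "\<dots> = ennreal (pi powr (3/2)) * ennreal (Gamma (s - 3/2) * t powr (- (s - 3/2)))"
    using s t by (subst nn_integral_Gamma_scaled) auto
  finally have eq: "ennreal (Gamma s) * ?I = ennreal (pi powr (3/2) * (Gamma (s - 3/2) * t powr (3/2 - s)))"
    using s Gamma_real_pos[of "s - 3/2"] by (simp add: ennreal_mult)
  have "?I = ennreal (inverse (Gamma s)) * (ennreal (Gamma s) * ?I)"
    using G by (simp add: mult.assoc[symmetric] ennreal_mult[symmetric])
  also have "\<dots> = ennreal (inverse (Gamma s) * (pi powr (3/2) * (Gamma (s - 3/2) * t powr (3/2 - s))))"
    unfolding eq using G by (intro ennreal_mult'[symmetric]) simp
  finally have I: "?I = ennreal (inverse (Gamma s) * (pi powr (3/2) * (Gamma (s - 3/2) * t powr (3/2 - s))))" .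
  have "inverse (Gamma s) * (pi powr (3/2) * (Gamma (s - 3/2) * t powr (3/2 - s)))
      = (2 * pi) ^ 3 * (C3 s * t powr (3/2 - s))"
  proof -
    have "(2 * pi) ^ 3 = (4 * pi\<^sup>2) powr (3/2)"
    proof -
      have "4 * pi\<^sup>2 = (2 * pi) powr 2" by (simp add: power_mult_distrib)
      then have "(4 * pi\<^sup>2) powr (3/2) = ((2 * pi) powr 2) powr (3/2)" by (simp only:)
      also have "\<dots> = (2 * pi) powr 3" by (subst powr_powr) simp
      also have "\<dots> = (2 * pi) ^ 3" by (rule powr_numeral) simp
      finally show ?thesis by (rule sym)
    qed
    also have "\<dots> = ((4 * pi) * pi) powr (3/2)" by (simp only: power2_eq_square mult.assoc)
    also have "\<dots> = (4 * pi) powr (3/2) * pi powr (3/2)" by (rule powr_mult)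
    finally have ratio: "(2 * pi) ^ 3 / (4 * pi) powr (3/2) = pi powr (3/2)" by simp
    have "(2 * pi) ^ 3 * C3 s = ((2 * pi) ^ 3 / (4 * pi) powr (3/2)) * (Gamma (s - 3/2) / Gamma s)"
      by (simp add: C3_def)
    also have "\<dots> = pi powr (3/2) * (Gamma (s - 3/2) / Gamma s)"
      by (simp only: ratio)
    finally have C3: "(2 * pi) ^ 3 * C3 s = pi powr (3/2) * (Gamma (s - 3/2) / Gamma s)" .
    have "(2 * pi) ^ 3 * (C3 s * t powr (3/2 - s)) = ((2 * pi) ^ 3 * C3 s) * t powr (3/2 - s)"
      by (rule mult.assoc[symmetric])
    then show ?thesis by (simp only: C3) (simp only: divide_inverse ac_simps)
  qed
  with I show ?thesis by (simp only:)
qed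

lemma C3_five_halves: "C3 (5/2) = 1 / (6 * pi\<^sup>2)"
proof -
  have "Gamma (5/2 :: real) = (3/2) * Gamma (3/2)"
    using Gamma_plus1[of "3/2 :: real"] nonpos_Ints_nonpos[of "3/2 :: real"] by auto
  also have "Gamma (3/2 :: real) = (1/2) * Gamma (1/2)"
    using Gamma_plus1[of "1/2 :: real"] nonpos_Ints_nonpos[of "1/2 :: real"] by auto
  finally have "Gamma (5/2 :: real) = (3/4) * sqrt pi" by (simp add: Gamma_one_half_real)
  moreover have "(4 * pi) powr (3/2) = 8 * pi * sqrt pi"
  proof -
    have "(4 * pi) powr (3/2) = (4 * pi) powr 1 * (4 * pi) powr (1/2)"
      unfolding powr_add[symmetric] by simp
    then show ?thesis by (simp add: powr_half_sqrt real_sqrt_mult)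
  qed
  ultimately have "C3 (5/2) = 1 / (8 * pi * sqrt pi) * (1 / (3/4 * sqrt pi))"
    unfolding C3_def by (simp only:) simp
  also have "\<dots> = 1 / (6 * pi * (sqrt pi * sqrt pi))" by (simp add: field_simps)
  also have "sqrt pi * sqrt pi = pi" by simp
  finally show ?thesis by (simp add: power2_eq_square mult.assoc)
qed

section \<open>Bochner integrals in the operator norm\<close>

text \<open>
  Continuous functionals reduce norm-valued integrals to scalar ones. They also show that the
  integral is unique.
\<close>

lemma has_norm_bochner_integral_bounded_linear:
  fixes T :: "'e::real_normed_vector \<Rightarrow> real"
  assumes I: "has_norm_bochner_integral M f I" and T: "bounded_linear T"
    and [measurable]: "(\<lambda>x. T (f x)) \<in> borel_measurable M"
  shows "has_bochner_integral M (\<lambda>x. T (f x)) (T I)"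
proof -
  interpret T: bounded_linear T by fact
  obtain h where h: "\<And>n::nat. Bochner_Integration.simple_bochner_integrable M (h n)"
    "(\<lambda>n. \<integral>\<^sup>+x. ennreal (norm (f x - h n x)) \<partial>M) \<longlonglongrightarrow> 0"
    "(\<lambda>n. Bochner_Integration.simple_bochner_integral M (h n)) \<longlonglongrightarrow> I"
    using I unfolding has_norm_bochner_integral_def by blast
  obtain K where K: "K > 0" "\<And>x. norm (T x) \<le> norm x * K" using T.pos_bounded by blast
  have Th: "Bochner_Integration.simple_bochner_integrable M (\<lambda>x. T (h n x))" for n
    using h(1)[of n] by (intro simple_bochner_integrable_compose2[of "\<lambda>x y. T x" M "h n" "h n"]) (simp_all add: T.zero)
  show ?thesis
  proof (rule has_bochner_integral.intros[where s = "\<lambda>n x. T (h n x)"])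
    have lim: "(\<lambda>n. ennreal K * (\<integral>\<^sup>+x. ennreal (norm (f x - h n x)) \<partial>M)) \<longlonglongrightarrow> 0"
      using ennreal_tendsto_cmult[OF _ h(2), of "ennreal K"] by simp
    have le: "(\<integral>\<^sup>+x. ennreal (norm (T (f x) - T (h n x))) \<partial>M)
        \<le> ennreal K * (\<integral>\<^sup>+x. ennreal (norm (f x - h n x)) \<partial>M)" for n
    proof -
      have [measurable]: "(\<lambda>x. T (h n x)) \<in> borel_measurable M"
        using Th[of n] by (auto elim!: simple_bochner_integrable.cases intro: borel_measurable_simple_function)
      have "(\<integral>\<^sup>+x. ennreal (norm (T (f x) - T (h n x))) \<partial>M)
          = ennreal K * (\<integral>\<^sup>+x. ennreal (1 / K) * ennreal (norm (T (f x) - T (h n x))) \<partial>M)"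
        using K(1) by (subst nn_integral_cmult) (auto simp: mult.assoc[symmetric] ennreal_mult[symmetric])
      also have "\<dots> \<le> ennreal K * (\<integral>\<^sup>+x. ennreal (norm (f x - h n x)) \<partial>M)"
      proof (intro mult_left_mono nn_integral_mono)
        fix x
        have "1 / K * norm (T (f x) - T (h n x)) \<le> norm (f x - h n x)"
          using K(2)[of "f x - h n x"] K(1) by (simp add: T.diff divide_le_eq)
        then show "ennreal (1 / K) * ennreal (norm (T (f x) - T (h n x))) \<le> ennreal (norm (f x - h n x))"
          using K(1) by (simp add: ennreal_mult[symmetric] ennreal_leI)
      qed simp
      finally show ?thesis .
    qed
    show "(\<lambda>n. \<integral>\<^sup>+x. ennreal (norm (T (f x) - T (h n x))) \<partial>M) \<longlonglongrightarrow> 0"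
      by (rule tendsto_sandwich[OF _ _ tendsto_const lim]) (use le in simp_all)
    have "(\<lambda>n. T (Bochner_Integration.simple_bochner_integral M (h n))) \<longlonglongrightarrow> T I"
      using h(3) by (rule T.tendsto)
    then show "(\<lambda>n. Bochner_Integration.simple_bochner_integral M (\<lambda>x. T (h n x))) \<longlonglongrightarrow> T I"
      by (simp add: simple_bochner_integral_linear[OF T.linear_axioms h(1)])
  qed (use Th in auto)
qed

text \<open>
  Since the integrand depends on a single real parameter, rounding this parameter down gives simple
  functions. The rounded parameter lies at most \<open>1\<close> below the true one, so the hypothesis on \<open>w\<close> dominates all approximants at once.
\<close>

lemma norm_bochner_integrable_radial:
  fixes K :: "real \<Rightarrow> 'e::banach"
  assumes \<rho> [measurable]: "\<rho> \<in> borel_measurable M" and \<rho>0: "\<And>x. 0 \<le> \<rho> x"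
    and K: "continuous_on {0..} K" and w [measurable]: "w \<in> borel_measurable borel"
    and bound: "\<And>r r'. 0 \<le> r \<Longrightarrow> r \<le> r' \<Longrightarrow> r' \<le> r + 1 \<Longrightarrow> norm (K r) \<le> w r'"
    and fin: "(\<integral>\<^sup>+x. ennreal (w (\<rho> x)) \<partial>M) < \<infinity>"
  shows "norm_bochner_integrable M (\<lambda>x. K (\<rho> x))"
proof -
  \<comment> \<open>The index \<open>- 1\<close> marks the points beyond the cut-off at \<open>n\<close>, where the approximant is zero.\<close>
  define d where "d n x = (if \<rho> x < real n then \<lfloor>2 ^ n * \<rho> x\<rfloor> else - 1)" for n :: nat and x
  define v where "v n i = (if i < 0 then 0 else K (of_int i / 2 ^ n))" for n :: nat and i :: int
  define h where "h n x = v n (d n x)" for n x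
  have [measurable]: "d n \<in> measurable M (count_space UNIV)" for n
    unfolding d_def[abs_def] by measurable
  have d_simple: "simple_function M (d n)" for n
  proof -
    have "d n x \<in> insert (- 1) {0..\<lfloor>2 ^ n * real n\<rfloor>}" for x
      using \<rho>0[of x] by (auto simp: d_def intro!: floor_mono)
    then have "d n ` space M \<subseteq> insert (- 1) {0..\<lfloor>2 ^ n * real n\<rfloor>}" by blast
    then have "finite (d n ` space M)" by (rule finite_subset) simp
    then show ?thesis by (simp add: simple_function_eq_measurable)
  qed
  have h_simple: "simple_function M (h n)" for n
    unfolding h_def[abs_def] using d_simple by (rule simple_function_compose1)
  have round: "0 \<le> of_int \<lfloor>2 ^ n * \<rho> x\<rfloor> / (2 ^ n :: real)" "of_int \<lfloor>2 ^ n * \<rho> x\<rfloor> / 2 ^ n \<le> \<rho> x"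
    "\<rho> x - of_int \<lfloor>2 ^ n * \<rho> x\<rfloor> / 2 ^ n \<le> (1/2) ^ n" for n x
  proof -
    show "0 \<le> of_int \<lfloor>2 ^ n * \<rho> x\<rfloor> / (2 ^ n :: real)" using \<rho>0[of x] by simp
    have eq: "\<rho> x - of_int \<lfloor>2 ^ n * \<rho> x\<rfloor> / 2 ^ n = (2 ^ n * \<rho> x - of_int \<lfloor>2 ^ n * \<rho> x\<rfloor>) / 2 ^ n"
      by (simp add: diff_divide_distrib)
    have "0 \<le> 2 ^ n * \<rho> x - of_int \<lfloor>2 ^ n * \<rho> x\<rfloor>" "2 ^ n * \<rho> x - of_int \<lfloor>2 ^ n * \<rho> x\<rfloor> \<le> 1"
      by linarith+
    then have "0 \<le> \<rho> x - of_int \<lfloor>2 ^ n * \<rho> x\<rfloor> / 2 ^ n"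
      "\<rho> x - of_int \<lfloor>2 ^ n * \<rho> x\<rfloor> / 2 ^ n \<le> 1 / 2 ^ n"
      unfolding eq by (simp_all add: divide_right_mono)
    then show "of_int \<lfloor>2 ^ n * \<rho> x\<rfloor> / 2 ^ n \<le> \<rho> x" "\<rho> x - of_int \<lfloor>2 ^ n * \<rho> x\<rfloor> / 2 ^ n \<le> (1/2) ^ n"
      by (simp_all add: power_divide)
  qed
  have h_eq: "h n x = (if \<rho> x < real n then K (of_int \<lfloor>2 ^ n * \<rho> x\<rfloor> / 2 ^ n) else 0)" for n x
  proof -
    have "\<not> 2 ^ n * \<rho> x < 0" using \<rho>0[of x] by (simp add: not_less)
    then show ?thesis by (simp add: h_def v_def d_def)
  qed
  have w0: "0 \<le> w (\<rho> x)" for x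
    by (rule order_trans[OF norm_ge_zero bound[OF \<rho>0[of x] order_refl]]) simp
  have h_le: "norm (h n x) \<le> w (\<rho> x)" for n x
  proof -
    have "\<rho> x \<le> of_int \<lfloor>2 ^ n * \<rho> x\<rfloor> / 2 ^ n + 1"
      using round(3)[of x n] power_le_one[of "1/2::real" n] by linarith
    then show ?thesis
      using bound[OF round(1,2)] w0 by (simp add: h_eq)
  qed
  have K_le: "norm (K (\<rho> x)) \<le> w (\<rho> x)" for x using bound[OF \<rho>0 order_refl] by simp
  have h_int: "Bochner_Integration.simple_bochner_integrable M (h n)" for n
  proof (rule simple_bochner_integrableI_bounded[OF h_simple])
    have "(\<integral>\<^sup>+x. ennreal (norm (h n x)) \<partial>M) \<le> (\<integral>\<^sup>+x. ennreal (w (\<rho> x)) \<partial>M)"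
      using h_le by (intro nn_integral_mono ennreal_leI)
    then show "(\<integral>\<^sup>+x. ennreal (norm (h n x)) \<partial>M) < \<infinity>" using fin by (rule le_less_trans)
  qed
  have conv: "(\<lambda>n. h n x) \<longlonglongrightarrow> K (\<rho> x)" for x
  proof -
    have r: "(\<lambda>n. of_int \<lfloor>2 ^ n * \<rho> x\<rfloor> / 2 ^ n) \<longlonglongrightarrow> \<rho> x"
    proof (rule LIM_zero_cancel, rule Lim_null_comparison)
      show "\<forall>\<^sub>F n in sequentially. norm (of_int \<lfloor>2 ^ n * \<rho> x\<rfloor> / 2 ^ n - \<rho> x) \<le> (1/2) ^ n"
        using round(2,3)[where x = x] by (intro always_eventually allI) (simp add: abs_le_iff)
    qed (rule LIMSEQ_realpow_zero, auto)
    have "(\<lambda>n. K (of_int \<lfloor>2 ^ n * \<rho> x\<rfloor> / 2 ^ n)) \<longlonglongrightarrow> K (\<rho> x)"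
      using \<rho>0[of x] round(1) by (intro continuous_on_tendsto_compose[OF K r]) auto
    moreover have "\<forall>\<^sub>F n in sequentially. K (of_int \<lfloor>2 ^ n * \<rho> x\<rfloor> / 2 ^ n) = h n x"
    proof -
      obtain N where "\<rho> x < real N" using reals_Archimedean2 by blast
      then show ?thesis by (auto simp: eventually_sequentially h_eq intro!: exI[of _ N])
    qed
    ultimately show ?thesis by (rule Lim_transform_eventually)
  qed
  have dist_meas [measurable]: "(\<lambda>x. norm (K (\<rho> x) - h n x)) \<in> borel_measurable M" for n
  proof -
    have "continuous_on UNIV (\<lambda>r. K (max 0 r))"
      by (rule continuous_on_compose2[OF K]) (auto intro!: continuous_intros)
    then have "continuous_on UNIV (\<lambda>r. norm (K (max 0 r) - v n i))" for i
      by (intro continuous_intros)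
    from borel_measurable_continuous_onI[OF this]
    have [measurable]: "(\<lambda>r. norm (K (max 0 r) - v n i)) \<in> borel_measurable borel" for i .
    have "(\<lambda>x. (\<lambda>i x. norm (K (max 0 (\<rho> x)) - v n i)) (d n x) x) \<in> borel_measurable M"
      by (rule measurable_compose_countable) measurable
    then show ?thesis using \<rho>0 by (simp add: h_def max_absorb2)
  qed
  have lim: "(\<lambda>n. \<integral>\<^sup>+x. ennreal (norm (K (\<rho> x) - h n x)) \<partial>M) \<longlonglongrightarrow> 0"
  proof -
    have "(\<lambda>n. \<integral>\<^sup>+x. ennreal (norm (K (\<rho> x) - h n x)) \<partial>M) \<longlonglongrightarrow> (\<integral>\<^sup>+x. 0 \<partial>M)"
    proof (rule nn_integral_dominated_convergence[where w = "\<lambda>x. 2 * ennreal (w (\<rho> x))"])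
      show "AE x in M. ennreal (norm (K (\<rho> x) - h n x)) \<le> 2 * ennreal (w (\<rho> x))" for n
      proof (intro AE_I2)
        fix x
        have "norm (K (\<rho> x) - h n x) \<le> 2 * w (\<rho> x)"
          using norm_triangle_ineq4[of "K (\<rho> x)" "h n x"] K_le[of x] h_le[of n x] by linarith
        then have "ennreal (norm (K (\<rho> x) - h n x)) \<le> ennreal (2 * w (\<rho> x))" by (rule ennreal_leI)
        then show "ennreal (norm (K (\<rho> x) - h n x)) \<le> 2 * ennreal (w (\<rho> x))" by (simp add: ennreal_mult w0)
      qed
      have "(\<lambda>n. ennreal (norm (K (\<rho> x) - h n x))) \<longlonglongrightarrow> ennreal (norm (K (\<rho> x) - K (\<rho> x)))" for x
        by (intro tendsto_ennrealI tendsto_norm tendsto_diff tendsto_const conv)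
      then show "AE x in M. (\<lambda>n. ennreal (norm (K (\<rho> x) - h n x))) \<longlonglongrightarrow> 0" by simp
      show "(\<integral>\<^sup>+x. 2 * ennreal (w (\<rho> x)) \<partial>M) < \<infinity>"
        using fin by (simp add: nn_integral_cmult ennreal_mult_less_top)
    qed measurable
    then show ?thesis by simp
  qed
  define J where "J n = Bochner_Integration.simple_bochner_integral M (h n)" for n
  have J_dist: "ennreal (norm (J m - J n))
      \<le> (\<integral>\<^sup>+x. ennreal (norm (K (\<rho> x) - h m x)) \<partial>M) + (\<integral>\<^sup>+x. ennreal (norm (K (\<rho> x) - h n x)) \<partial>M)" for m n
  proof -
    have diff: "Bochner_Integration.simple_bochner_integrable M (\<lambda>x. h m x - h n x)"
      by (rule simple_bochner_integrable_compose2[OF _ h_int h_int]) simp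
    have ndiff: "Bochner_Integration.simple_bochner_integrable M (\<lambda>x. norm (h m x - h n x))"
      by (rule simple_bochner_integrable_compose2[where p = "\<lambda>a b. norm (a - b)", OF _ h_int h_int]) simp
    have "norm (J m - J n) \<le> Bochner_Integration.simple_bochner_integral M (\<lambda>x. norm (h m x - h n x))"
      unfolding J_def simple_bochner_integral_diff[OF h_int h_int, symmetric]
      by (rule simple_bochner_integral_norm_bound[OF diff])
    then have "ennreal (norm (J m - J n)) \<le> (\<integral>\<^sup>+x. ennreal (norm (h m x - h n x)) \<partial>M)"
      using simple_bochner_integral_eq_nn_integral[OF ndiff] by (metis ennreal_leI norm_ge_zero)
    also have "\<dots> \<le> (\<integral>\<^sup>+x. ennreal (norm (K (\<rho> x) - h m x)) + ennreal (norm (K (\<rho> x) - h n x)) \<partial>M)"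
    proof (rule nn_integral_mono)
      fix x
      have "norm (h m x - h n x) \<le> norm (K (\<rho> x) - h m x) + norm (K (\<rho> x) - h n x)"
        using norm_triangle_ineq4[of "K (\<rho> x) - h n x" "K (\<rho> x) - h m x"] by simp
      then show "ennreal (norm (h m x - h n x)) \<le> ennreal (norm (K (\<rho> x) - h m x)) + ennreal (norm (K (\<rho> x) - h n x))"
        by (simp add: ennreal_leI flip: ennreal_plus)
    qed
    also have "\<dots> = (\<integral>\<^sup>+x. ennreal (norm (K (\<rho> x) - h m x)) \<partial>M) + (\<integral>\<^sup>+x. ennreal (norm (K (\<rho> x) - h n x)) \<partial>M)"
      by (rule nn_integral_add) measurable
    finally show ?thesis .
  qed
  have "Cauchy J"
  proof (rule metric_CauchyI)
    fix e :: real assume "e > 0"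
    then have "\<forall>\<^sub>F n in sequentially. (\<integral>\<^sup>+x. ennreal (norm (K (\<rho> x) - h n x)) \<partial>M) < ennreal (e / 2)"
      by (intro order_tendstoD(2)[OF lim]) simp
    then obtain N where N: "\<And>n. n \<ge> N \<Longrightarrow> (\<integral>\<^sup>+x. ennreal (norm (K (\<rho> x) - h n x)) \<partial>M) < ennreal (e / 2)"
      by (auto simp: eventually_sequentially)
    have "dist (J m) (J n) < e" if "m \<ge> N" "n \<ge> N" for m n
    proof -
      have "ennreal (norm (J m - J n)) < ennreal (e / 2) + ennreal (e / 2)"
        using J_dist[of m n] N[OF that(1)] N[OF that(2)] by (meson add_strict_mono le_less_trans)
      also have "\<dots> = ennreal e" using \<open>e > 0\<close> by (simp flip: ennreal_plus)
      finally show ?thesis using \<open>e > 0\<close> by (simp add: dist_norm ennreal_less_iff)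
    qed
    then show "\<exists>N. \<forall>m\<ge>N. \<forall>n\<ge>N. dist (J m) (J n) < e" by blast
  qed
  then obtain I where "J \<longlonglongrightarrow> I" by (auto simp: Cauchy_convergent_iff convergent_def)
  then have "has_norm_bochner_integral M (\<lambda>x. K (\<rho> x)) I"
    unfolding has_norm_bochner_integral_def J_def using h_int conv lim by (intro exI[of _ h]) auto
  then show ?thesis by (auto simp: norm_bochner_integrable_def)
qed

section \<open>The momentum integral of the shifted negative powers\<close>

lemma powr_neg_lipschitz:
  fixes l s x y :: real
  assumes l: "l > 0" and s: "s > 0" and x: "l \<le> x" and y: "l \<le> y"
  shows "\<bar>x powr (- s) - y powr (- s)\<bar> \<le> s * l powr (- s - 1) * \<bar>x - y\<bar>"
proof -
  have "norm (x powr (- s) - y powr (- s)) \<le> s * l powr (- s - 1) * norm (x - y)"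
  proof (rule field_differentiable_bound[where S = "{l..}"])
    fix z assume z: "z \<in> {l..}"
    then have "z > 0" using l by simp
    then show "((\<lambda>u. u powr (- s)) has_field_derivative - s * z powr (- s - 1)) (at z within {l..})"
      by (rule has_field_derivative_at_within[OF has_real_derivative_powr])
    have "z powr (- s - 1) \<le> l powr (- s - 1)"
      using z l s by (intro powr_mono2') auto
    then show "norm (- s * z powr (- s - 1)) \<le> s * l powr (- s - 1)"
      using s by (simp add: abs_mult mult_left_mono)
  qed (use x y in auto)
  then show ?thesis by simp
qed

text \<open>
  The function \<open>(t + r) powr - s\<close>, bounded by being cut off below the lower bound \<open>l\<close> of the spectrum.
\<close>

definition cut_power :: "real \<Rightarrow> real \<Rightarrow> real \<Rightarrow> real \<Rightarrow> real" where
  "cut_power l s r t = indicator {l..} t * (t + r) powr (- s)"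

lemma cut_power_bounds:
  assumes "l > 0" "s > 0" "r \<ge> 0"
  shows "0 \<le> cut_power l s r t" "cut_power l s r t \<le> (l + r) powr (- s)"
  using assms by (auto simp: cut_power_def indicator_def intro!: powr_mono2')

lemma bounded_borel_cut_power:
  assumes "l > 0" "s > 0" "r \<ge> 0" shows "bounded_borel (cut_power l s r)"
proof (rule bounded_borelI[of _ "(l + r) powr (- s)"])
  show "cut_power l s r \<in> borel_measurable borel" unfolding cut_power_def[abs_def] by measurable
  show "\<bar>cut_power l s r t\<bar> \<le> (l + r) powr (- s)" for t
    using cut_power_bounds[OF assms, of t] by simp
qed

context pvm
begin

lemma continuous_on_Phi_cut_power:
  assumes l: "l > 0" and s: "s > 0"
  shows "continuous_on {0..} (\<lambda>r. Phi (cut_power l s r))"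
proof (rule lipschitz_on_continuous_on, rule lipschitz_onI)
  fix r r' :: real assume r: "r \<in> {0..}" "r' \<in> {0..}"
  have "norm (Phi (\<lambda>t. cut_power l s r t - cut_power l s r' t)) \<le> s * l powr (- s - 1) * \<bar>r - r'\<bar>"
  proof (rule Phi_norm_le)
    show "bounded_borel (\<lambda>t. cut_power l s r t - cut_power l s r' t)"
      using r by (intro bounded_borel_diff bounded_borel_cut_power l s) auto
    show "\<bar>cut_power l s r t - cut_power l s r' t\<bar> \<le> s * l powr (- s - 1) * \<bar>r - r'\<bar>" for t
      using powr_neg_lipschitz[OF l s, of "t + r" "t + r'"] r s
      by (auto simp: cut_power_def indicator_def)
  qed (use s in auto)
  then show "dist (Phi (cut_power l s r)) (Phi (cut_power l s r')) \<le> s * l powr (- s - 1) * dist r r'"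
    using r by (simp add: dist_norm Phi_diff bounded_borel_cut_power l s)
qed (use s in auto)

definition momentum_operator :: "real \<Rightarrow> real \<Rightarrow> real^3 \<Rightarrow> 'b L2 \<Rightarrow>\<^sub>L 'b L2" where
  "momentum_operator l s q = (1 / (2 * pi) ^ 3) *\<^sub>R Phi (cut_power l s ((norm q)\<^sup>2))"

lemma momentum_operator_integrable:
  assumes l: "l > 0" and s: "s > 3/2"
  shows "norm_bochner_integrable lborel (momentum_operator l s)"
proof -
  have s0: "s > 0" using s by simp
  define a where "a = (1 + 1 / l) powr s / (2 * pi) ^ 3"
  have a0: "0 \<le> a" by (simp add: a_def)
  have "norm_bochner_integrable lborel (\<lambda>q::real^3. (\<lambda>r. (1 / (2 * pi) ^ 3) *\<^sub>R Phi (cut_power l s r)) ((norm q)\<^sup>2))"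
  proof (rule norm_bochner_integrable_radial[where \<rho> = "\<lambda>q::real^3. (norm q)\<^sup>2"
        and K = "\<lambda>r. (1 / (2 * pi) ^ 3) *\<^sub>R Phi (cut_power l s r)" and w = "\<lambda>r. a * (l + r) powr (- s)"])
    show "continuous_on {0..} (\<lambda>r. (1 / (2 * pi) ^ 3) *\<^sub>R Phi (cut_power l s r))"
      by (intro continuous_intros continuous_on_Phi_cut_power l s0)
    fix r r' :: real assume r: "0 \<le> r" "r \<le> r'" "r' \<le> r + 1"
    have "norm (Phi (cut_power l s r)) \<le> (l + r) powr (- s)"
      using cut_power_bounds[OF l s0 r(1)]
      by (intro Phi_norm_le bounded_borel_cut_power l s0 r(1)) auto
    also have "\<dots> \<le> ((l + r') / (1 + 1 / l)) powr (- s)"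
    proof (rule powr_mono2')
      have "0 \<le> r / l" using r l by simp
      moreover have "(l + r) / l = 1 + r / l" using l by (simp add: add_divide_distrib)
      ultimately have "l + r' \<le> (l + r) + (l + r) / l" using r by linarith
      also have "\<dots> = (l + r) * (1 + 1 / l)" by (simp add: distrib_left)
      finally show "(l + r') / (1 + 1 / l) \<le> l + r" using l by (simp add: divide_le_eq add_pos_pos)
    qed (use l r s0 in \<open>auto intro!: divide_pos_pos add_pos_pos add_pos_nonneg\<close>)
    also have "\<dots> = (1 + 1 / l) powr s * (l + r') powr (- s)"
    proof -
      have "(u / k) powr (- s) = k powr s * u powr (- s)" for u k :: real
        by (subst powr_divide) (simp add: powr_minus divide_inverse)
      then show ?thesis .
    qed
    finally show "norm ((1 / (2 * pi) ^ 3) *\<^sub>R Phi (cut_power l s r)) \<le> a * (l + r') powr (- s)"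
      by (simp add: a_def divide_right_mono)
  next
    have "(\<integral>\<^sup>+q. ennreal (a * (l + (norm (q::real^3))\<^sup>2) powr (- s)) \<partial>lborel)
        = ennreal a * (\<integral>\<^sup>+q. ennreal ((l + (norm (q::real^3))\<^sup>2) powr (- s)) \<partial>lborel)"
      by (subst nn_integral_cmult[symmetric]) (simp_all add: ennreal_mult a0)
    then show "(\<integral>\<^sup>+q. ennreal (a * (l + (norm (q::real^3))\<^sup>2) powr (- s)) \<partial>lborel) < \<infinity>"
      by (simp only: nn_integral_momentum_power[OF l s]) (simp add: ennreal_mult_less_top)
  qed auto
  then show ?thesis by (simp add: momentum_operator_def[abs_def])
qed

lemma momentum_operator_measurable:
  fixes T :: "('b L2 \<Rightarrow>\<^sub>L 'b L2) \<Rightarrow> real"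
  assumes l: "l > 0" and s: "s > 0" and T: "bounded_linear T"
  shows "(\<lambda>q. T (momentum_operator l s q)) \<in> borel_measurable lborel"
proof -
  have "continuous_on UNIV (\<lambda>q::real^3. Phi (cut_power l s ((norm q)\<^sup>2)))"
    by (rule continuous_on_compose2[OF continuous_on_Phi_cut_power[OF l s]])
      (auto intro!: continuous_intros)
  then have "continuous_on UNIV (\<lambda>q. T (momentum_operator l s q))"
    unfolding momentum_operator_def
    by (intro bounded_linear.continuous_on[OF T] continuous_on_scaleR continuous_on_const)
  then show ?thesis by (simp add: borel_measurable_continuous_onI)
qed

lemma C3_nonneg: "s > 3/2 \<Longrightarrow> 0 \<le> C3 s"
  using Gamma_real_pos[of "s - 3/2"] Gamma_real_pos[of s] by (simp add: C3_def)

text \<open>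
  Tonelli's theorem exchanges the integrals over the momentum and over the spectrum; on the spectrum
  the inner one is the scalar momentum integral.
\<close>

lemma momentum_operator_form:
  assumes l: "l > 0" and s: "s > 3/2"
  shows "(\<integral>\<^sup>+q. ennreal (x \<bullet> momentum_operator l s q x) \<partial>lborel)
    = ennreal (\<integral>t. C3 s * cut_power l (s - 3/2) 0 t \<partial>W x)"
proof -
  have s0: "s > 0" using s by simp
  interpret PW: pair_sigma_finite "W x" "lborel :: (real^3) measure"
    by (intro pair_sigma_finite.intro W.sigma_finite_measure_axioms lborel.sigma_finite_measure_axioms)
  let ?c = "1 / (2 * pi) ^ 3"
  have "ennreal (x \<bullet> momentum_operator l s q x) = (\<integral>\<^sup>+t. ennreal (?c * cut_power l s ((norm q)\<^sup>2) t) \<partial>W x)" for q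
  proof -
    have b: "bounded_borel (cut_power l s ((norm q)\<^sup>2))" using l s0 by (intro bounded_borel_cut_power) auto
    have "x \<bullet> momentum_operator l s q x = (\<integral>t. ?c * cut_power l s ((norm q)\<^sup>2) t \<partial>W x)"
      by (simp add: momentum_operator_def blinfun.scaleR_left Phi_inner[OF b])
    also have "ennreal \<dots> = (\<integral>\<^sup>+t. ennreal (?c * cut_power l s ((norm q)\<^sup>2) t) \<partial>W x)"
      using cut_power_bounds(1)[OF l s0, of "(norm q)\<^sup>2"]
      by (intro nn_integral_eq_integral[symmetric] W_integrable bounded_borel_mult[OF bounded_borel_const b]) auto
    finally show ?thesis .
  qed
  then have "(\<integral>\<^sup>+q. ennreal (x \<bullet> momentum_operator l s q x) \<partial>lborel)
      = (\<integral>\<^sup>+q. \<integral>\<^sup>+t. ennreal (?c * cut_power l s ((norm (q::real^3))\<^sup>2) t) \<partial>W x \<partial>lborel)"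
    by simp
  also have "\<dots> = (\<integral>\<^sup>+t. \<integral>\<^sup>+q. ennreal (?c * cut_power l s ((norm (q::real^3))\<^sup>2) t) \<partial>lborel \<partial>W x)"
    unfolding cut_power_def by (rule PW.Fubini') measurable
  also have "\<dots> = (\<integral>\<^sup>+t. ennreal (C3 s * cut_power l (s - 3/2) 0 t) \<partial>W x)"
  proof (rule nn_integral_cong)
    fix t
    show "(\<integral>\<^sup>+q. ennreal (?c * cut_power l s ((norm (q::real^3))\<^sup>2) t) \<partial>lborel)
        = ennreal (C3 s * cut_power l (s - 3/2) 0 t)"
    proof (cases "l \<le> t")
      case True
      then have t: "t > 0" using l by simp
      have "(\<integral>\<^sup>+q. ennreal (?c * cut_power l s ((norm (q::real^3))\<^sup>2) t) \<partial>lborel)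
          = (\<integral>\<^sup>+q. ennreal ?c * ennreal ((t + (norm (q::real^3))\<^sup>2) powr (- s)) \<partial>lborel)"
        using True by (intro nn_integral_cong) (simp add: cut_power_def ennreal_mult'[symmetric])
      also have "\<dots> = ennreal ?c * ennreal ((2 * pi) ^ 3 * (C3 s * t powr (3/2 - s)))"
        by (simp only: nn_integral_momentum_power[OF t s, symmetric]) (rule nn_integral_cmult, measurable)
      also have "\<dots> = ennreal (?c * ((2 * pi) ^ 3 * (C3 s * t powr (3/2 - s))))"
        by (rule ennreal_mult'[symmetric]) simp
      also have "?c * ((2 * pi) ^ 3 * (C3 s * t powr (3/2 - s))) = C3 s * cut_power l (s - 3/2) 0 t"
        using True by (simp add: cut_power_def)
      finally show ?thesis .
    qed (simp add: cut_power_def)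
  qed
  also have "\<dots> = ennreal (\<integral>t. C3 s * cut_power l (s - 3/2) 0 t \<partial>W x)"
    using C3_nonneg[OF s] cut_power_bounds(1)[of l "s - 3/2" 0] l s
    by (intro nn_integral_eq_integral W_integrable bounded_borel_mult bounded_borel_cut_power) auto
  finally show ?thesis .
qed

text \<open>
  An integral \<open>J\<close> is tested by the functionals \<open>T \<mapsto> x \<bullet> T y\<close>: they show that \<open>J\<close> is symmetric and
  compute its quadratic form, which together determine it.
\<close>

proposition momentum_operator_integral:
  assumes l: "l > 0" and s: "s > 3/2"
  shows "norm_bochner_integral lborel (momentum_operator l s) = C3 s *\<^sub>R Phi (cut_power l (s - 3/2) 0)"
proof -
  have s0: "s > 0" using s by simp
  have b: "bounded_borel (cut_power l (s - 3/2) 0)" using l s by (intro bounded_borel_cut_power) auto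
  have val: "J = C3 s *\<^sub>R Phi (cut_power l (s - 3/2) 0)"
    if J: "has_norm_bochner_integral lborel (momentum_operator l s) J" for J
  proof -
    have push: "has_bochner_integral lborel (\<lambda>q. T (momentum_operator l s q)) (T J)"
      if "bounded_linear T" for T :: "('b L2 \<Rightarrow>\<^sub>L 'b L2) \<Rightarrow> real"
      by (rule has_norm_bochner_integral_bounded_linear[OF J that momentum_operator_measurable[OF l s0 that]])
    have bl: "bounded_linear (\<lambda>B :: 'b L2 \<Rightarrow>\<^sub>L 'b L2. x \<bullet> B y)" for x y
      by (rule bounded_linear_compose[OF bounded_linear_inner_right blinfun.bounded_linear_left])
    have sym: "momentum_operator l s q x \<bullet> y = x \<bullet> momentum_operator l s q y" for q x y
      using l s0 by (simp add: momentum_operator_def blinfun.scaleR_left Phi_sym bounded_borel_cut_power)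
    have nonneg: "0 \<le> x \<bullet> momentum_operator l s q x" for q x
      using cut_power_bounds(1)[OF l s0, of "(norm q)\<^sup>2"] l s0
      by (simp add: momentum_operator_def blinfun.scaleR_left Phi_inner bounded_borel_cut_power)
    have "Phi (\<lambda>t. C3 s * cut_power l (s - 3/2) 0 t) = J"
    proof (rule Phi_eqI)
      show "bounded_borel (\<lambda>t. C3 s * cut_power l (s - 3/2) 0 t)"
        by (intro bounded_borel_mult bounded_borel_const b)
      show "J x \<bullet> y = x \<bullet> J y" for x y
      proof -
        have "(\<lambda>q. x \<bullet> momentum_operator l s q y) = (\<lambda>q. y \<bullet> momentum_operator l s q x)"
          by (rule ext) (metis sym inner_commute)
        then have "has_bochner_integral lborel (\<lambda>q. x \<bullet> momentum_operator l s q y) (y \<bullet> J x)"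
          using push[OF bl, of y x] by (simp only:)
        with push[OF bl, of x y] have "x \<bullet> J y = y \<bullet> J x" by (rule has_bochner_integral_eq)
        then show ?thesis by (simp only: inner_commute)
      qed
      show "x \<bullet> J x = (\<integral>t. C3 s * cut_power l (s - 3/2) 0 t \<partial>W x)" for x
      proof -
        note T = push[OF bl, of x x]
        have "ennreal (x \<bullet> J x) = (\<integral>\<^sup>+q. ennreal (x \<bullet> momentum_operator l s q x) \<partial>lborel)"
          using T nonneg by (subst nn_integral_eq_integral) (auto simp: has_bochner_integral_iff)
        also have "\<dots> = ennreal (\<integral>t. C3 s * cut_power l (s - 3/2) 0 t \<partial>W x)"
          by (rule momentum_operator_form[OF l s])
        finally have "ennreal (x \<bullet> J x) = ennreal (\<integral>t. C3 s * cut_power l (s - 3/2) 0 t \<partial>W x)" .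
        moreover have "0 \<le> x \<bullet> J x"
          unfolding has_bochner_integral_integral_eq[OF T, symmetric]
          by (intro integral_nonneg_AE AE_I2 nonneg)
        moreover have "0 \<le> (\<integral>t. C3 s * cut_power l (s - 3/2) 0 t \<partial>W x)"
          using C3_nonneg[OF s] cut_power_bounds(1)[of l "s - 3/2" 0] l s
          by (intro integral_nonneg_AE AE_I2 mult_nonneg_nonneg) auto
        ultimately show ?thesis by simp
      qed
    qed
    then show ?thesis by (simp add: Phi_scale[OF b])
  qed
  obtain J where "has_norm_bochner_integral lborel (momentum_operator l s) J"
    using momentum_operator_integrable[OF l s] by (auto simp: norm_bochner_integrable_def)
  then show ?thesis
    unfolding norm_bochner_integral_def using val by (metis (mono_tags, lifting) the_equality)
qed

end

section \<open>The brane mediator\<close>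

lemma self_adjoint_op_shift:
  fixes L :: "'b::brane L2 rel"
  assumes "self_adjoint L" shows "self_adjoint (op_shift L c)"
proof -
  have lin: "linear_operator L" and dense: "closure (Domain L) = UNIV" and adj: "op_adjoint L = L"
    using assms by (auto simp: self_adjoint_def)
  have iff: "(x, y) \<in> op_shift L c \<longleftrightarrow> (x, y - c *\<^sub>R x) \<in> L" for x y
    by (auto simp: op_shift_def intro!: exI[of _ "y - c *\<^sub>R x"])
  have "linear_operator (op_shift L c)"
    unfolding linear_operator_def
  proof (intro conjI allI impI)
    show "single_valued (op_shift L c)"
      using lin by (auto simp: linear_operator_def single_valued_def op_shift_def)
    show "(0, 0) \<in> op_shift L c" using lin by (simp add: iff linear_operator_def)
  next
    fix x y x' y' assume "(x, y) \<in> op_shift L c" "(x', y') \<in> op_shift L c"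
    then have "(x + x', (y - c *\<^sub>R x) + (y' - c *\<^sub>R x')) \<in> L"
      using lin by (auto simp: iff linear_operator_def)
    then show "(x + x', y + y') \<in> op_shift L c" by (simp add: iff algebra_simps)
  next
    fix a x y assume "(x, y) \<in> op_shift L c"
    then have "(a *\<^sub>C x, a *\<^sub>C (y - c *\<^sub>R x)) \<in> L" using lin by (auto simp: iff linear_operator_def)
    then show "(a *\<^sub>C x, a *\<^sub>C y) \<in> op_shift L c" by (simp add: iff scaleC_diff scaleC_scaleR)
  qed
  moreover have "Domain (op_shift L c) = Domain L" by (auto simp: op_shift_def)
  moreover have "op_adjoint (op_shift L c) = op_shift L c"
  proof -
    have real: "cinner u (c *\<^sub>R x) = cinner (c *\<^sub>R u) x" for u x :: "'b L2"
      by (simp add: scaleC_of_real[symmetric] cinner_scaleC_left cinner_scaleC_right)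
    have minus: "cinner (a - b) x = cinner a x - cinner b x" for a b x :: "'b L2"
      using cinner_add_left[of "a - b" b x] by simp
    have "(u, v) \<in> op_adjoint (op_shift L c) \<longleftrightarrow> (u, v - c *\<^sub>R u) \<in> op_adjoint L" for u v
    proof -
      have "(u, v) \<in> op_adjoint (op_shift L c) \<longleftrightarrow> (\<forall>(x, y)\<in>L. cinner u (y + c *\<^sub>R x) = cinner v x)"
        by (auto simp: op_adjoint_def op_shift_def)
      also have "\<dots> \<longleftrightarrow> (\<forall>(x, y)\<in>L. cinner u y = cinner (v - c *\<^sub>R u) x)"
        by (simp add: cinner_add_right real minus eq_diff_eq)
      finally show ?thesis by (simp add: op_adjoint_def)
    qed
    then show ?thesis by (auto simp: adj iff)
  qed
  ultimately show ?thesis using dense by (simp add: self_adjoint_def)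
qed

lemma form_ge_op_shift:
  assumes "form_ge L l" "c \<ge> 0" shows "form_ge (op_shift L c) l"
proof -
  have "l * (norm x)\<^sup>2 \<le> Re (cinner x (y + c *\<^sub>R x))" if "(x, y) \<in> L" for x y
  proof -
    have "l * (norm x)\<^sup>2 \<le> x \<bullet> y" using assms(1) that by (auto simp: form_ge_def inner_L2_def)
    also have "\<dots> \<le> x \<bullet> (y + c *\<^sub>R x)" using assms(2) by (simp add: inner_add_right)
    finally show ?thesis by (simp add: inner_L2_def)
  qed
  then show ?thesis by (auto simp: form_ge_def op_shift_def)
qed

lemma spectral_measure_properties:
  fixes L :: "'b::brane L2 rel"
  assumes "self_adjoint L" "l > 0" "form_ge L l"
  shows "pvm (spectral_measure L)" "spectral_integral (spectral_measure L) (\<lambda>t. t) = L"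
    "spectral_measure L {..<l} = 0"
proof -
  have E: "projection_valued_measure (spectral_measure L) \<and> spectral_integral (spectral_measure L) (\<lambda>t. t) = L"
    unfolding spectral_measure_def by (rule someI_ex[OF spectral_measure_exists[OF assms]])
  then show "pvm (spectral_measure L)" and L: "spectral_integral (spectral_measure L) (\<lambda>t. t) = L"
    by (auto simp: pvm_def)
  then show "spectral_measure L {..<l} = 0"
    using pvm.form_ge_imp_support[of "spectral_measure L" l] assms(3) by simp
qed

lemma op_powr_negative:
  fixes L :: "'b::brane L2 rel"
  assumes L: "self_adjoint L" "l > 0" "form_ge L l" and s: "s > 0"
  shows "L op_powr (- s) = op_graph (pvm.Phi (spectral_measure L) (cut_power l s 0))"
proof -
  interpret pvm "spectral_measure L" by (rule spectral_measure_properties(1)[OF L])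
  show ?thesis
    unfolding op_powr_def
  proof (rule spectral_integral_bounded)
    show "AE t in W x. t powr - s = cut_power l s 0 t" for x
      using AE_support[OF spectral_measure_properties(3)[OF L], of x]
      by eventually_elim (simp add: cut_power_def)
  qed (use L(2) s in \<open>auto intro: bounded_borel_cut_power\<close>)
qed

lemma shifted_op_powr_negative:
  fixes L :: "'b::brane L2 rel"
  assumes L: "self_adjoint L" "l > 0" "form_ge L l" and c: "c \<ge> 0" and s: "s > 0"
  shows "op_shift L c op_powr (- s) = op_graph (pvm.Phi (spectral_measure L) (cut_power l s c))"
proof -
  have Lc: "self_adjoint (op_shift L c)" "form_ge (op_shift L c) l"
    using L c by (auto intro: self_adjoint_op_shift form_ge_op_shift)
  note E = spectral_measure_properties[OF L]
  note F = spectral_measure_properties[OF Lc(1) L(2) Lc(2)]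
  have "pvm.Phi (spectral_measure (op_shift L c)) (cut_power l s 0)
      = pvm.Phi (spectral_measure L) (cut_power l s c)"
    using Phi_powr_shift[OF E(1) F(1) E(3) F(3) L(2) c _ s] E(2) F(2)
    by (simp add: cut_power_def[abs_def])
  then show ?thesis using op_powr_negative[OF Lc(1) L(2) Lc(2) s] by simp
qed

lemma op_graph_inj: "op_graph T = op_graph U \<Longrightarrow> T = U"
  by (rule blinfun_eqI) (auto simp: op_graph_def set_eq_iff)

lemma the_bounded_op_graph [simp]: "the_bounded_op (op_graph T) = T"
  unfolding the_bounded_op_def by (rule the_equality) (auto intro: op_graph_inj)

lemma op_scale_scaleR_graph: "op_scale c (op_graph (r *\<^sub>R T)) = op_scale (c * complex_of_real r) (op_graph T)"
proof -
  have "c *\<^sub>C (r *\<^sub>R T) x = (c * complex_of_real r) *\<^sub>C T x" for x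
    by (simp add: blinfun.scaleR_left scaleC_of_real[symmetric] scaleC_scaleC)
  then show ?thesis by (auto simp: op_scale_def op_graph_def)
qed

theorem theorem3p2:
  fixes L :: "'b::brane L2 rel" and l :: real and \<kappa> :: "real \<Rightarrow> complex"
  assumes "self_adjoint L" and "l > 0" and "form_ge L l"
  shows "(\<forall>s::real. s > 3 / 2 \<longrightarrow>
            (\<forall>q. bounded_op (mediator_power L s q)) \<and>
            norm_bochner_integrable lborel (mediator_integrand L s) \<and>
            brane_mediator \<kappa> L s = op_scale (\<kappa> s * complex_of_real (C3 s)) (L op_powr (3 / 2 - s))) \<and>
         brane_mediator \<kappa> L (5 / 2) =
           op_scale (\<kappa> (5 / 2) / complex_of_real (6 * pi\<^sup>2)) (L op_powr (- 1)) \<and>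
         (let g = \<kappa> (5 / 2) / complex_of_real (6 * pi\<^sup>2); V\<^sub>B = brane_mediator \<kappa> L (5 / 2) in
            V\<^sub>B = op_scale g (L op_powr (- 1)))"
proof -
  interpret pvm "spectral_measure L" by (rule spectral_measure_properties(1)[OF assms])
  have main: "(\<forall>q. bounded_op (mediator_power L s q)) \<and>
      norm_bochner_integrable lborel (mediator_integrand L s) \<and>
      brane_mediator \<kappa> L s = op_scale (\<kappa> s * complex_of_real (C3 s)) (L op_powr (3 / 2 - s))"
    if s: "s > 3/2" for s
  proof -
    have power: "mediator_power L s q = op_graph (Phi (cut_power l s ((norm q)\<^sup>2)))" for q
      unfolding mediator_power_def using s by (intro shifted_op_powr_negative assms) auto
    have integrand: "mediator_integrand L s = momentum_operator l s"
      by (auto simp: mediator_integrand_def momentum_operator_def power)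
    have "L op_powr (3/2 - s) = op_graph (Phi (cut_power l (s - 3/2) 0))"
      using op_powr_negative[OF assms, of "s - 3/2"] s by simp
    then show ?thesis
      using momentum_operator_integrable[OF assms(2) s] momentum_operator_integral[OF assms(2) s]
      by (auto simp: bounded_op_def power integrand brane_mediator_def op_scale_scaleR_graph)
  qed
  have "\<kappa> (5/2) * complex_of_real (C3 (5/2)) = \<kappa> (5/2) / complex_of_real (6 * pi\<^sup>2)"
    by (simp add: C3_five_halves)
  moreover have "3/2 - 5/2 = (- 1 :: real)" by simp
  ultimately have special: "brane_mediator \<kappa> L (5/2)
      = op_scale (\<kappa> (5/2) / complex_of_real (6 * pi\<^sup>2)) (L op_powr (- 1))"
    using main[of "5/2"] by (simp only:)
  show ?thesis using main special by (simp add: Let_def)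
qed

end
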